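(* Let $\mathbf{k}$ be an algebraically closed field. Let $C$ be a finite poset whose bound Hasse quiver is one of the twelve bound quivers $\widetilde{\mathbb{A}}_3,\widetilde{\mathbb{D}}_4,\widetilde{\mathbb{E}}_6,\widetilde{\mathbb{E}}_7,\widetilde{\mathbb{E}}_8,\mathbb{R}_1,\dots,\mathbb{R}_7$ listed in the context, with any choice of orientation of the undirected edges, or the opposite of such a bound quiver. Then the incidence algebra $\mathbf{k}C$ is brick-continuous and admits a generic brick, which can be explicitly constructed.
   Context: **Incidence algebras.** The Hasse quiver $Q_P$ of a finite poset $P$ has the elements of $P$ as vertices and an arrow $x\to y$ whenever $x<y$ and no element lies strictly between $x$ and $y$. The incidence algebra is $\mathbf{k}P=\mathbf{k}Q_P/I_P$, where $I_P$ is the ideal of the path algebra $\mathbf{k}Q_P$ generated by all differences $p_1-p_2$ of paths with the same start and the same end. The pair $(Q_P,I_P)$ is the bound Hasse quiver of $P$. Modules are left modules, equivalently representations of $(Q_P,I_P)$. **Bricks.** A brick is a module whose endomorphism ring is a division ring. A finite-dimensional $\mathbf{k}$-algebra $\Lambda$ is brick-continuous if it admits an infinite family of pairwise non-isomorphic bricks with the same (finite) dimension. The endolength of a $\Lambda$-module $M$ is its length as an $\operatorname{End}_\Lambda(M)^{\mathrm{op}}$-module; $M$ is endofinite if this is finite. A generic module is an indecomposable, endofinite $\Lambda$-module of infinite length over $\Lambda$. A generic brick is a generic module which is also a brick. **The twelve families (the critical posets, up to opposites; their incidence algebras are called minimally representation-infinite).** An undirected edge, written $a - b$, may be oriented in either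 direction, independently of the others. - $\widetilde{\mathbb{A}}_3$: vertices $a,b,c,d$ and arrows $a\to c$, $a\to d$, $b\to c$, $b\to d$ (no relations). - $\widetilde{\mathbb{D}}_4$: a central vertex joined by undirected edges to four other vertices. - $\widetilde{\mathbb{E}}_6$: a tree of undirected edges with a central vertex and three linear arms with $2,2,2$ further vertices. - $\widetilde{\mathbb{E}}_7$: the same with arms of $1,3,3$ further vertices. - $\widetilde{\mathbb{E}}_8$: the same with arms of $1,2,5$ further vertices. For $\mathbb{R}_1,\dots,\mathbb{R}_4$ start with the commutative square having vertices $m,l,r,t$, arrows $m\to l\to t$ and $m\to r\to t$, and the relation that the two paths from $m$ to $t$ are equal; then attach undirected edges to new vertices as follows. - $\mathbb{R}_1$: $t - u_1$ and $r - v_1 - v_2 - v_3 - v_4$. - $\mathbb{R}_2$: $t - u_1 - u_2 - u_3 - u_4$ and $r - v_1$. - $\mathbb{R}_3$: $l - u_1 - u_2$ and $r - v_1 - v_2$. - $\mathbb{R}_4$: $l - u_1$ and $r - v_1 - v_2 - v_3 - v_4$. For $\mathbb{R}_5,\mathbb{R}_6$ start with vertices $m,l_1,l_2,r,t$, arrows $m\to l_1\to l_2\to t$ and $m\to r\to t$, and the relation that the two paths from $m$ to $t$ are equal; then attach: - $\mathbb{R}_5$: $l_2 - u_1 - u_2 - u_3 - u_4$. - $\mathbb{R}_6$: $l_2 - u_1$ and $r - v_1 - v_2 - v_3$. For $\mathbb{R}_7$ start with vertices $m,l_1,l_2,l_3,r,t$, arrows $m\to l_1\to l_2\to l_3\to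 t$ and $m\to r\to t$, and the relation that the two paths from $m$ to $t$ are equal; then attach $l_2 - u_1$ and $r - v_1 - v_2$. *)

theory Defs
  imports
    "HOL-Computational_Algebra.Polynomial"
    "HOL-Computational_Algebra.Fraction_Field"
    "HOL-Library.Extended_Nat"
    "HOL-Library.FuncSet"
    "HOL-Algebra.QuotRing"
    "HOL-Algebra.Module"
begin

section \<open>Left modules over a ring that need not be commutative\<close>

text \<open>
  The locale \<^locale>\<open>module\<close> of HOL-Algebra requires a commutative ring of scalars; the axioms
  below are the same ones over an arbitrary ring. The record type of modules and the predicate
  \<^locale>\<open>submodule\<close> are those of HOL-Algebra.
\<close>

locale left_module = R?: ring R + M?: abelian_group M for R (structure) and M (structure) +
  assumes smult_closed:
      "\<lbrakk>a \<in> carrier R; x \<in> carrier M\<rbrakk> \<Longrightarrow> a \<odot>\<^bsub>M\<^esub> x \<in> carrier M"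
    and smult_l_distr:
      "\<lbrakk>a \<in> carrier R; b \<in> carrier R; x \<in> carrier M\<rbrakk> \<Longrightarrow>
        (a \<oplus> b) \<odot>\<^bsub>M\<^esub> x = a \<odot>\<^bsub>M\<^esub> x \<oplus>\<^bsub>M\<^esub> b \<odot>\<^bsub>M\<^esub> x"
    and smult_r_distr:
      "\<lbrakk>a \<in> carrier R; x \<in> carrier M; y \<in> carrier M\<rbrakk> \<Longrightarrow>
        a \<odot>\<^bsub>M\<^esub> (x \<oplus>\<^bsub>M\<^esub> y) = a \<odot>\<^bsub>M\<^esub> x \<oplus>\<^bsub>M\<^esub> a \<odot>\<^bsub>M\<^esub> y"
    and smult_assoc1:
      "\<lbrakk>a \<in> carrier R; b \<in> carrier R; x \<in> carrier M\<rbrakk> \<Longrightarrow>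
        (a \<otimes> b) \<odot>\<^bsub>M\<^esub> x = a \<odot>\<^bsub>M\<^esub> (b \<odot>\<^bsub>M\<^esub> x)"
    and smult_one: "x \<in> carrier M \<Longrightarrow> \<one> \<odot>\<^bsub>M\<^esub> x = x"

definition lmod_hom :: "'r ring \<Rightarrow> ('r, 'm) module \<Rightarrow> ('r, 'n) module \<Rightarrow> ('m \<Rightarrow> 'n) set"
  where "lmod_hom R M N = {f \<in> carrier M \<rightarrow>\<^sub>E carrier N.
    (\<forall>x\<in>carrier M. \<forall>y\<in>carrier M. f (x \<oplus>\<^bsub>M\<^esub> y) = f x \<oplus>\<^bsub>N\<^esub> f y) \<and>
    (\<forall>a\<in>carrier R. \<forall>x\<in>carrier M. f (a \<odot>\<^bsub>M\<^esub> x) = a \<odot>\<^bsub>N\<^esub> f x)}"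

definition lmod_iso :: "'r ring \<Rightarrow> ('r, 'm) module \<Rightarrow> ('r, 'n) module \<Rightarrow> bool"
  where "lmod_iso R M N \<longleftrightarrow> (\<exists>f\<in>lmod_hom R M N. bij_betw f (carrier M) (carrier N))"

definition End_ring :: "'r ring \<Rightarrow> ('r, 'm) module \<Rightarrow> ('m \<Rightarrow> 'm) ring"
  where "End_ring R M =
    \<lparr>carrier = lmod_hom R M M,
     monoid.mult = compose (carrier M),
     one = (\<lambda>x\<in>carrier M. x),
     zero = (\<lambda>x\<in>carrier M. \<zero>\<^bsub>M\<^esub>),
     add = (\<lambda>f g. \<lambda>x\<in>carrier M. f x \<oplus>\<^bsub>M\<^esub> g x)\<rparr>"

text \<open>The equation below excludes the zero ring, since \<open>\<one>\<close> is always a unit.\<close>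

definition is_division_ring :: "'r ring \<Rightarrow> bool"
  where "is_division_ring D \<longleftrightarrow> ring D \<and> Units D = carrier D - {\<zero>\<^bsub>D\<^esub>}"

definition brick :: "'r ring \<Rightarrow> ('r, 'm) module \<Rightarrow> bool"
  where "brick R M \<longleftrightarrow> left_module R M \<and> is_division_ring (End_ring R M)"

text \<open>The length of a module is the supremum of the lengths of its chains of submodules.\<close>

definition module_length :: "'r ring \<Rightarrow> ('r, 'm) module \<Rightarrow> enat"
  where "module_length R M = (SUP n \<in> {n. \<exists>N :: nat \<Rightarrow> 'm set.
    (\<forall>i\<le>n. submodule (N i) R M) \<and> (\<forall>i<n. N i \<subset> N (Suc i))}. enat n)"

text \<open>
  \<open>M\<close> with the evaluation action \<open>f \<cdot> m = f m\<close> is a left module over its endomorphism ring, that is,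
  a right module over the opposite ring. The endolength is its length; the submodules in question
  are the subgroups of \<open>M\<close> that are stable under all endomorphisms.
\<close>

definition eval_module :: "('r, 'm) module \<Rightarrow> ('m \<Rightarrow> 'm, 'm) module"
  where "eval_module M =
    \<lparr>carrier = carrier M, monoid.mult = monoid.mult M, one = one M, zero = zero M, add = add M,
     module.smult = (\<lambda>f m. f m)\<rparr>"

definition endolength :: "'r ring \<Rightarrow> ('r, 'm) module \<Rightarrow> enat"
  where "endolength R M = module_length (End_ring R M) (eval_module M)"

definition endofinite :: "'r ring \<Rightarrow> ('r, 'm) module \<Rightarrow> bool"
  where "endofinite R M \<longleftrightarrow> endolength R M < \<infinity>"

definition indecomposable :: "'r ring \<Rightarrow> ('r, 'm) module \<Rightarrow> bool"
  where "indecomposable R M \<longleftrightarrow> carrier M \<noteq> {\<zero>\<^bsub>M\<^esub>} \<and>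
    (\<forall>A B. submodule A R M \<and> submodule B R M \<and> A \<inter> B = {\<zero>\<^bsub>M\<^esub>} \<and> A <+>\<^bsub>M\<^esub> B = carrier M \<longrightarrow>
      A = {\<zero>\<^bsub>M\<^esub>} \<or> B = {\<zero>\<^bsub>M\<^esub>})"

definition generic_module :: "'r ring \<Rightarrow> ('r, 'm) module \<Rightarrow> bool"
  where "generic_module R M \<longleftrightarrow> left_module R M \<and> indecomposable R M \<and> endofinite R M \<and>
    module_length R M = \<infinity>"

definition generic_brick :: "'r ring \<Rightarrow> ('r, 'm) module \<Rightarrow> bool"
  where "generic_brick R M \<longleftrightarrow> generic_module R M \<and> brick R M"

text \<open>
  A \<open>k\<close>-algebra is given by a ring \<open>R\<close> and its structure map \<open>\<iota> : k \<rightarrow> R\<close>, \<open>c \<mapsto> c \<cdot> \<one>\<close>, through which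
  every \<open>R\<close>-module is a \<open>k\<close>-vector space; \<open>has_dim \<iota> M d\<close> says that this space has a basis of \<open>d\<close>
  elements.
\<close>

definition has_dim :: "('k \<Rightarrow> 'r) \<Rightarrow> ('r, 'm) module \<Rightarrow> nat \<Rightarrow> bool"
  where "has_dim \<iota> M d \<longleftrightarrow> (\<exists>B \<subseteq> carrier M. finite B \<and> card B = d \<and>
    (\<forall>x\<in>carrier M. \<exists>!c. c \<in> B \<rightarrow>\<^sub>E UNIV \<and> x = (\<Oplus>\<^bsub>M\<^esub>b\<in>B. \<iota> (c b) \<odot>\<^bsub>M\<^esub> b)))"

text \<open>
  The family consists of modules whose elements are functions \<^typ>\<open>nat \<Rightarrow> 'k\<close>. This is no restriction:
  every finite-dimensional module is isomorphic to one of this kind, because \<open>k\<^sup>d\<close> embeds.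
\<close>

definition brick_continuous :: "'r ring \<Rightarrow> ('k \<Rightarrow> 'r) \<Rightarrow> bool"
  where "brick_continuous R \<iota> \<longleftrightarrow> (\<exists>(d :: nat) (F :: ('r, nat \<Rightarrow> 'k) module set).
    infinite F \<and> (\<forall>M\<in>F. brick R M \<and> has_dim \<iota> M d) \<and> pairwise (\<lambda>M N. \<not> lmod_iso R M N) F)"


section \<open>Bound quivers and their algebras\<close>

text \<open>
  No quiver considered here has multiple arrows. So the arrows form a relation on the vertices, and
  a path is the nonempty list of the vertices it passes through, where \<open>[x]\<close> is the trivial path
  at \<open>x\<close>. The third component lists pairs \<open>(p, q)\<close> of parallel paths, standing for the
  relation \<open>p = q\<close>, that is, for the generator \<open>p - q\<close> of the ideal.
\<close>

record 'v bquiver =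
  verts :: "'v set"
  arrows :: "('v \<times> 'v) set"
  rels :: "('v list \<times> 'v list) set"

definition paths :: "'v bquiver \<Rightarrow> 'v list set"
  where "paths Q = {p. p \<noteq> [] \<and> set p \<subseteq> verts Q \<and> successively (\<lambda>x y. (x, y) \<in> arrows Q) p}"

text \<open>
  An element of the path algebra is a finitely supported function on paths. The list \<open>p\<close> is
  the concatenation of \<open>take (Suc i) p\<close> followed by \<open>drop i p\<close>, for each position \<open>i\<close> in \<open>p\<close>. The
  product \<open>b \<cdot> a\<close> of paths means \<open>a\<close> followed by \<open>b\<close>, so that left modules correspond to
  (covariant) representations of the quiver.
\<close>

definition path_algebra :: "'v bquiver \<Rightarrow> ('v list \<Rightarrow> 'k::field) ring"
  where "path_algebra Q =
    \<lparr>carrier = {f. {p. f p \<noteq> 0} \<subseteq> paths Q \<and> finite {p. f p \<noteq> 0}},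
     monoid.mult = (\<lambda>f g p. \<Sum>i<length p. f (drop i p) * g (take (Suc i) p)),
     one = (\<lambda>p. if \<exists>x\<in>verts Q. p = [x] then 1 else 0),
     zero = (\<lambda>p. 0),
     add = (\<lambda>f g p. f p + g p)\<rparr>"

definition path_elt :: "'v list \<Rightarrow> 'v list \<Rightarrow> 'k::field"
  where "path_elt p = (\<lambda>r. if r = p then 1 else 0)"

definition bound_ideal :: "'v bquiver \<Rightarrow> ('v list \<Rightarrow> 'k::field) set"
  where "bound_ideal Q =
    genideal (path_algebra Q) {\<lambda>r. path_elt p r - path_elt q r | p q. (p, q) \<in> rels Q}"

definition bound_algebra :: "'v bquiver \<Rightarrow> ('v list \<Rightarrow> 'k::field) set ring"
  where "bound_algebra Q = path_algebra Q Quot bound_ideal Q"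

definition bound_scalar :: "'v bquiver \<Rightarrow> 'k::field \<Rightarrow> ('v list \<Rightarrow> 'k) set"
  where "bound_scalar Q c =
    bound_ideal Q +>\<^bsub>path_algebra Q\<^esub> (\<lambda>p. c * \<one>\<^bsub>path_algebra Q\<^esub> p)"

definition op_bquiver :: "'v bquiver \<Rightarrow> 'v bquiver"
  where "op_bquiver Q =
    \<lparr>verts = verts Q, arrows = (arrows Q)\<inverse>, rels = map_prod rev rev ` rels Q\<rparr>"

definition relabel :: "('v \<Rightarrow> 'w) \<Rightarrow> 'v bquiver \<Rightarrow> 'w bquiver"
  where "relabel f Q =
    \<lparr>verts = f ` verts Q, arrows = map_prod f f ` arrows Q,
     rels = map_prod (map f) (map f) ` rels Q\<rparr>"

text \<open>Bound quivers are compared by the ideals over \<open>k\<close> and not by the chosen generators.\<close>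

definition bquiver_iso :: "'k::field itself \<Rightarrow> 'v bquiver \<Rightarrow> 'w bquiver \<Rightarrow> bool"
  where "bquiver_iso _ Q Q' \<longleftrightarrow> (\<exists>f. inj_on f (verts Q) \<and>
    verts (relabel f Q) = verts Q' \<and> arrows (relabel f Q) = arrows Q' \<and>
    (bound_ideal (relabel f Q) :: ('w list \<Rightarrow> 'k) set) = bound_ideal Q')"


section \<open>Incidence algebras\<close>

definition hasse_arrows :: "'p set \<Rightarrow> 'p rel \<Rightarrow> 'p rel"
  where "hasse_arrows P po = {(x, y). x \<in> P \<and> y \<in> P \<and> x \<noteq> y \<and> (x, y) \<in> po \<and>
    \<not> (\<exists>z\<in>P. z \<noteq> x \<and> z \<noteq> y \<and> (x, z) \<in> po \<and> (z, y) \<in> po)}"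

definition hasse_bquiver :: "'p set \<Rightarrow> 'p rel \<Rightarrow> 'p bquiver"
  where "hasse_bquiver P po =
    (let Q = \<lparr>verts = P, arrows = hasse_arrows P po, rels = {}\<rparr>
     in Q\<lparr>rels := {(p, q). p \<in> paths Q \<and> q \<in> paths Q \<and> hd p = hd q \<and> last p = last q}\<rparr>)"

definition incidence_algebra :: "'p set \<Rightarrow> 'p rel \<Rightarrow> ('p list \<Rightarrow> 'k::field) set ring"
  where "incidence_algebra P po = bound_algebra (hasse_bquiver P po)"

definition incidence_scalar :: "'p set \<Rightarrow> 'p rel \<Rightarrow> 'k::field \<Rightarrow> ('p list \<Rightarrow> 'k) set"
  where "incidence_scalar P po = bound_scalar (hasse_bquiver P po)"


section \<open>The critical bound quivers\<close>

definition chain_edges :: "nat list \<Rightarrow> (nat \<times> nat) set"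
  where "chain_edges xs = set (zip xs (tl xs))"

definition orient :: "(nat \<times> nat \<Rightarrow> bool) \<Rightarrow> (nat \<times> nat) set \<Rightarrow> (nat \<times> nat) set"
  where "orient s E = (\<lambda>e. if s e then e else prod.swap e) ` E"

text \<open>\<open>s\<close> is an arbitrary choice of direction for each undirected edge.\<close>

definition tree_bq :: "(nat \<times> nat \<Rightarrow> bool) \<Rightarrow> nat list list \<Rightarrow> nat bquiver"
  where "tree_bq s arms =
    \<lparr>verts = \<Union> (set ` set arms), arrows = orient s (\<Union> (chain_edges ` set arms)), rels = {}\<rparr>"

text \<open>Two directed paths \<open>p\<close>, \<open>q\<close>, identified by the relation, with undirected arms attached.\<close>

definition comm_bq ::
    "(nat \<times> nat \<Rightarrow> bool) \<Rightarrow> nat list \<Rightarrow> nat list \<Rightarrow> nat list list \<Rightarrow> nat bquiver"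
  where "comm_bq s p q arms =
    \<lparr>verts = set p \<union> set q \<union> \<Union> (set ` set arms),
     arrows = chain_edges p \<union> chain_edges q \<union> orient s (\<Union> (chain_edges ` set arms)),
     rels = {(p, q)}\<rparr>"

definition A3_tilde :: "nat bquiver"
  where "A3_tilde = \<lparr>verts = {0, 1, 2, 3}, arrows = {(0, 2), (0, 3), (1, 2), (1, 3)}, rels = {}\<rparr>"

text \<open>
  The central vertex of the trees is 0. In \<open>R\<^sub>1, \<dots>, R\<^sub>7\<close> the vertices are numbered in the
  order \<open>m\<close>, \<open>l\<close> (or \<open>l\<^sub>1, l\<^sub>2, \<dots>\<close>), \<open>r\<close>, \<open>t\<close>, \<open>u\<^sub>1, u\<^sub>2, \<dots>\<close>, \<open>v\<^sub>1, v\<^sub>2, \<dots>\<close>.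
\<close>

inductive_set critical_bquivers :: "nat bquiver set"
  where
  A3: "A3_tilde \<in> critical_bquivers"
| D4: "tree_bq s [[0,1], [0,2], [0,3], [0,4]] \<in> critical_bquivers"
| E6: "tree_bq s [[0,1,2], [0,3,4], [0,5,6]] \<in> critical_bquivers"
| E7: "tree_bq s [[0,1], [0,2,3,4], [0,5,6,7]] \<in> critical_bquivers"
| E8: "tree_bq s [[0,1], [0,2,3], [0,4,5,6,7,8]] \<in> critical_bquivers"
| R1: "comm_bq s [0,1,3] [0,2,3] [[3,4], [2,5,6,7,8]] \<in> critical_bquivers"
| R2: "comm_bq s [0,1,3] [0,2,3] [[3,4,5,6,7], [2,8]] \<in> critical_bquivers"
| R3: "comm_bq s [0,1,3] [0,2,3] [[1,4,5], [2,6,7]] \<in> critical_bquivers"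
| R4: "comm_bq s [0,1,3] [0,2,3] [[1,4], [2,5,6,7,8]] \<in> critical_bquivers"
| R5: "comm_bq s [0,1,2,4] [0,3,4] [[2,5,6,7,8]] \<in> critical_bquivers"
| R6: "comm_bq s [0,1,2,4] [0,3,4] [[2,5], [3,6,7,8]] \<in> critical_bquivers"
| R7: "comm_bq s [0,1,2,3,5] [0,4,5] [[2,6], [4,7,8]] \<in> critical_bquivers"

end

theory Submission
  imports Defs "HOL-Library.Function_Algebras" "HOL-Library.Nat_Bijection"
begin

text \<open>
  A module over the incidence algebra is a representation of the Hasse quiver in which parallel paths
  act equally. All representations below come from one vector space \<open>W = K\<^sup>n\<close> over a field \<open>K\<close>
  containing the ground field \<open>k\<close>: a vertex \<open>x\<close> is sent to a subquotient \<open>X\<^sub>x / Y\<^sub>x\<close> of \<open>W\<close> and an arrow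
  \<open>x \<rightarrow> y\<close> to the map induced by the identity of \<open>W\<close>, which exists as soon as \<open>X\<^sub>x \<subseteq> X\<^sub>y\<close> and
  \<open>Y\<^sub>x \<subseteq> Y\<^sub>y\<close>. Such a family respects every relation between parallel paths.

  The subspaces depend on a parameter \<open>T \<in> K\<close>, and they are chosen with two properties. First
  (\<open>full_rep\<close>), every homomorphism from the representation at \<open>T\<close> to the one at \<open>S\<close> is induced by a
  single map \<open>f : W \<rightarrow> W\<close>, so that \<open>f\<close> carries each of the subspaces at \<open>T\<close> into its namesake at \<open>S\<close>.
  Second (\<open>scalar_rigid\<close>), the configuration of subspaces is so rigid that every such \<open>f\<close> applies one
  additive map \<open>\<phi> : K \<rightarrow> K\<close> to all coordinates, where \<open>\<phi> (T x) = S \<phi> x\<close>. Hence homomorphisms are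
  governed by the field \<open>K\<close> alone (\<open>hom_scalar\<close>).
  \<^item> For \<open>K = k\<close> this gives \<open>End = k\<close> for \<open>T = S\<close> and \<open>Hom = 0\<close> for \<open>T \<noteq> S\<close>. So there is a brick for
    every element of the infinite field \<open>k\<close>, no two of them are isomorphic, and as their dimensions
    are bounded, infinitely many of them have the same dimension.
  \<^item> For \<open>K = k(t)\<close> and \<open>T = t\<close> the map \<open>\<phi>\<close> commutes with \<open>k\<close> and \<open>t\<close>, hence with \<open>k(t)\<close>, and
    \<open>End = k(t)\<close>. The module has finite dimension over \<open>k(t)\<close> but infinite length over the algebra:
    it is a generic brick.

  Four rigid configurations suffice: four lines in a plane (\<open>d4_rigid\<close>), and flags in \<open>K\<^sup>3\<close>, \<open>K\<^sup>4\<close>,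
  \<open>K\<^sup>6\<close> with as many members as the arms of the trees \<open>E\<^sub>6\<close>, \<open>E\<^sub>7\<close>, \<open>E\<^sub>8\<close> have vertices (\<open>e6_rigid\<close>,
  \<open>e7_rigid\<close>, \<open>e8_rigid\<close>). Every critical bound quiver and its opposite is a way of displaying one of
  them. In a tree the centre carries \<open>W\<close> and each arm a flag. In \<open>A\<^sub>3\<close>, two of the four lines are at
  the sources, and at the sinks are the quotients of the plane by the other two. In a commutative
  square, \<open>W\<close> is the pushout of the two middle vertices or, for some of the opposite quivers, their
  pullback (\<open>full_rep_pushout\<close>, \<open>full_rep_pullback\<close>). The orientation of the arms does not matter: walking
  outwards, one passes to a subspace at an arrow pointing inwards and to a quotient at an arrow
  pointing outwards, and either step uses up one member of the flag (\<open>full_rep_arm\<close>).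
\<close>

section \<open>Gluing linear maps\<close>

definition scl :: "'a::field \<Rightarrow> (nat \<Rightarrow> 'a) \<Rightarrow> nat \<Rightarrow> 'a"
  where "scl c v = (\<lambda>i. c * v i)"

lemma scl_apply: "scl c v i = c * v i"
  by (simp add: scl_def)

interpretation vec: vector_space "scl :: 'a::field \<Rightarrow> (nat \<Rightarrow> 'a) \<Rightarrow> nat \<Rightarrow> 'a"
  by unfold_locales (auto simp: scl_def fun_eq_iff algebra_simps)

definition coord_space :: "nat \<Rightarrow> (nat \<Rightarrow> 'a::field) set"
  where "coord_space n = {w. \<forall>i\<ge>n. w i = 0}"

lemma subspace_coord_space: "vec.subspace (coord_space n)"
  by (auto simp: vec.subspace_def coord_space_def scl_apply)

text \<open>
  The scalars \<open>C\<close> are separate from the field of the vectors: homomorphisms of modules over a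
  \<open>k\<close>-algebra are only \<open>k\<close>-linear, also when the modules are vector spaces over \<open>k(t)\<close>.
\<close>

definition linear_on :: "'a set \<Rightarrow> (nat \<Rightarrow> 'a::field) set \<Rightarrow> ((nat \<Rightarrow> 'a) \<Rightarrow> nat \<Rightarrow> 'a) \<Rightarrow> bool"
  where "linear_on C D f \<longleftrightarrow>
    (\<forall>v\<in>D. \<forall>w\<in>D. f (v + w) = f v + f w) \<and> (\<forall>c\<in>C. \<forall>v\<in>D. f (scl c v) = scl c (f v))"

lemma linear_on_add: "linear_on C D f \<Longrightarrow> v \<in> D \<Longrightarrow> w \<in> D \<Longrightarrow> f (v + w) = f v + f w"
  by (simp add: linear_on_def)

lemma linear_on_scl: "linear_on C D f \<Longrightarrow> c \<in> C \<Longrightarrow> v \<in> D \<Longrightarrow> f (scl c v) = scl c (f v)"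
  by (simp add: linear_on_def)

lemma linear_on_diff:
  assumes "linear_on C D f" "vec.subspace D" "v \<in> D" "w \<in> D"
  shows "f (v - w) = f v - f w"
  using linear_on_add[OF assms(1), of "v - w" w] assms vec.subspace_diff[of D v w]
  by (simp add: eq_diff_eq)

lemma linear_on_0:
  assumes "linear_on C D f" "vec.subspace D"
  shows "f 0 = 0"
  using linear_on_diff[OF assms, of 0 0] vec.subspace_0[OF assms(2)] by simp

text \<open>
  The image of \<open>e\<close> on \<open>X\<close> is a complement of \<open>Y\<close>, which is how the quotient \<open>X / Y\<close> will be realised
  inside the type of vectors.
\<close>

lemma complement_projection:
  assumes X: "vec.subspace X" and Y: "vec.subspace Y" and YX: "Y \<subseteq> X"
  obtains e where "Vector_Spaces.linear scl scl e" "\<And>v. v \<in> X \<Longrightarrow> e v \<in> X" "\<And>v. v \<in> X \<Longrightarrow> v - e v \<in> Y"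
    "\<And>v. v \<in> Y \<Longrightarrow> e v = 0"
proof -
  interpret p: vector_space_pair "scl :: 'a \<Rightarrow> _" "scl :: 'a \<Rightarrow> _" ..
  obtain B where B: "B \<subseteq> Y" "vec.independent B" "Y \<subseteq> vec.span B"
    using vec.basis_exists by metis
  obtain B' where B': "B \<subseteq> B'" "B' \<subseteq> X" "vec.independent B'" "X \<subseteq> vec.span B'"
    using vec.maximal_independent_subset_extend[of B X] B YX by (metis subset_trans)
  define e where "e = p.construct B' (\<lambda>b. if b \<in> B then 0 else b)"
  have lin: "Vector_Spaces.linear scl scl e"
    unfolding e_def by (rule p.linear_construct[OF B'(3)])
  then interpret e: Vector_Spaces.linear scl scl e .
  have eb: "e b = (if b \<in> B then 0 else b)" if "b \<in> B'" for b
    unfolding e_def using p.construct_basis[OF B'(3) that] .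
  have 1: "e v \<in> X \<and> v - e v \<in> Y" if "v \<in> vec.span B'" for v
    using that
  proof (induction rule: vec.span_induct_alt)
    case base
    show "e 0 \<in> X \<and> 0 - e 0 \<in> Y" using X Y by (simp add: e.zero vec.subspace_0)
  next
    case (step c b v)
    have "e (scl c b + v) = scl c (e b) + e v" by (simp add: e.add e.scale)
    moreover have "scl c b + v - (scl c (e b) + e v) = scl c (b - e b) + (v - e v)"
      by (simp add: vec.scale_right_diff_distrib)
    moreover have b: "e b \<in> X" "b - e b \<in> Y"
      using eb[OF step(1)] step(1) B'(2) B(1) X Y by (auto simp: vec.subspace_0)
    moreover have "e v \<in> X" "v - e v \<in> Y" using step(2) by (auto simp: fun_diff_def)
    then have "scl c (e b) + e v \<in> X" "scl c (b - e b) + (v - e v) \<in> Y"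
      using b X Y by (simp_all only: vec.subspace_add vec.subspace_scale)
    ultimately show "e (scl c b + v) \<in> X \<and> scl c b + v - e (scl c b + v) \<in> Y"
      by (simp only:)
  qed
  have 2: "e v = 0" if "v \<in> vec.span B" for v
    using that
  proof (induction rule: vec.span_induct_alt)
    case base
    show "e 0 = 0" by (rule e.zero)
  next
    case (step c b v)
    have "e v = 0" using step(2) by (simp add: zero_fun_def)
    moreover have "b \<in> B" by (rule step(1))
    then have "e b = 0" using eb[of b] B'(1) by auto
    ultimately show "e (scl c b + v) = 0" by (simp only: e.add e.scale vec.scale_zero_right add_0)
  qed
  show thesis
    by (rule that[OF lin]) (use 1 2 B B' in auto)
qed

text \<open>
  The sum of two subspaces is their pushout over the intersection: maps on \<open>L\<close> and \<open>R\<close> that agree on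
  \<open>L \<inter> R\<close> extend to \<open>L + R\<close>. When they agree only modulo \<open>Y\<close>, the glued map can still be made to
  equal \<open>gl\<close>, by using \<open>gr\<close> just on a complement of \<open>L \<inter> R\<close> in \<open>R\<close>.
\<close>

lemma glue_on_sum:
  assumes L: "vec.subspace L" and R: "vec.subspace R" and Y: "vec.subspace Y"
    and gl: "linear_on C L gl" and gr: "linear_on C R gr"
    and D: "vec.subspace D" "L \<subseteq> D" "R \<subseteq> D"
    and sum: "\<And>w. w \<in> D \<Longrightarrow> \<exists>u\<in>R. w - u \<in> L"
    and agree: "\<And>v. v \<in> L \<Longrightarrow> v \<in> R \<Longrightarrow> gl v - gr v \<in> Y"
  shows "\<exists>f. linear_on C D f \<and> (\<forall>v\<in>L. f v = gl v) \<and> (\<forall>v\<in>R. f v - gr v \<in> Y) \<and>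
    (\<forall>w\<in>D. \<exists>l\<in>L. \<exists>r\<in>R. f w = gl l + gr r)"
proof -
  obtain e where e: "Vector_Spaces.linear scl scl e" "\<And>v. v \<in> R \<Longrightarrow> e v \<in> R"
    "\<And>v. v \<in> R \<Longrightarrow> v - e v \<in> L \<inter> R" "\<And>v. v \<in> L \<inter> R \<Longrightarrow> e v = 0"
    using complement_projection[OF R vec.subspace_inter[OF L R]] by blast
  interpret e: Vector_Spaces.linear scl scl e by (rule e(1))
  obtain u where u: "\<And>w. w \<in> D \<Longrightarrow> u w \<in> R" "\<And>w. w \<in> D \<Longrightarrow> w - u w \<in> L"
    using sum by metis
  \<comment> \<open>The projection of \<open>D\<close> along \<open>L\<close> onto a complement of \<open>L \<inter> R\<close> in \<open>R\<close>.\<close>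
  define p where "p w = e (u w)" for w
  have p_unique: "p w = e r" if "w \<in> D" "r \<in> R" "w - r \<in> L" for w r
  proof -
    have "u w - r = (w - r) - (w - u w)" by simp
    then have "u w - r \<in> L \<inter> R"
      using u that L R by (metis IntI vec.subspace_diff)
    then have "e (u w - r) = 0" by (rule e(4))
    then show ?thesis by (simp add: p_def e.diff)
  qed
  have pR: "p w \<in> R" if "w \<in> D" for w using that by (simp add: p_def e u)
  have pL: "w - p w \<in> L" if "w \<in> D" for w
  proof -
    have "w - p w = (w - u w) + (u w - e (u w))" by (simp add: p_def)
    then show ?thesis using that u e(3) L by (metis IntD1 vec.subspace_add)
  qed
  have pp: "p w = e (p w)" if "w \<in> D" for w
    using p_unique[OF that pR[OF that] pL[OF that]] .
  have p_add: "p (v + w) = p v + p w" if "v \<in> D" "w \<in> D" for v w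
  proof -
    have *: "v + w - (u v + u w) = (v - u v) + (w - u w)" by simp
    have "p (v + w) = e (u v + u w)"
      by (rule p_unique) (use * that u L R D in \<open>simp_all only: vec.subspace_add\<close>)
    then show ?thesis by (simp add: p_def e.add)
  qed
  have p_scl: "p (scl c v) = scl c (p v)" if "v \<in> D" for v c
  proof -
    have *: "scl c v - scl c (u v) = scl c (v - u v)" by (simp add: vec.scale_right_diff_distrib)
    have "p (scl c v) = e (scl c (u v))"
      by (rule p_unique) (use * that u L R D in \<open>simp_all only: vec.subspace_scale\<close>)
    then show ?thesis by (simp add: p_def e.scale)
  qed
  define f where "f w = gl (w - p w) + gr (p w)" for w
  have "linear_on C D f"
    unfolding linear_on_def
  proof (intro conjI ballI)
    fix v w assume vw: "v \<in> D" "w \<in> D"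
    have *: "v + w - p (v + w) = (v - p v) + (w - p w)" using vw by (simp add: p_add)
    have "gl (v + w - p (v + w)) = gl (v - p v) + gl (w - p w)"
      unfolding * by (rule linear_on_add[OF gl pL[OF vw(1)] pL[OF vw(2)]])
    moreover have "gr (p (v + w)) = gr (p v) + gr (p w)"
      unfolding p_add[OF vw] by (rule linear_on_add[OF gr pR[OF vw(1)] pR[OF vw(2)]])
    ultimately show "f (v + w) = f v + f w" by (simp add: f_def)
  next
    fix c v assume vw: "c \<in> C" "v \<in> D"
    have "scl c v - scl c (p v) = scl c (v - p v)" by (simp add: vec.scale_right_diff_distrib)
    then show "f (scl c v) = scl c (f v)"
      using vw by (simp add: f_def p_scl linear_on_scl[OF gl] linear_on_scl[OF gr] pL pR vec.scale_right_distrib)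
  qed
  moreover have "f v = gl v" if "v \<in> L" for v
  proof -
    have "p v = e 0" by (rule p_unique) (use that D R in \<open>auto simp: vec.subspace_0\<close>)
    then show ?thesis using linear_on_0[OF gr R] by (simp add: f_def e.zero)
  qed
  moreover have "f v - gr v \<in> Y" if "v \<in> R" for v
  proof -
    have v: "v \<in> D" using that D by auto
    have "v - p v \<in> R" using that v pR R by (simp add: vec.subspace_diff)
    moreover have "gr v = gr (v - p v) + gr (p v)"
      using linear_on_add[OF gr, of "v - p v" "p v"] calculation pR[OF v] by simp
    ultimately show ?thesis using agree[of "v - p v"] pL[OF v] by (simp add: f_def)
  qed
  moreover have "\<exists>l\<in>L. \<exists>r\<in>R. f w = gl l + gr r" if "w \<in> D" for w
    using pL[OF that] pR[OF that] unfolding f_def by blast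
  ultimately show ?thesis by blast
qed

text \<open>
  The dual statement. As \<open>A \<inter> B = 0\<close>, a vector is determined by its classes modulo \<open>A\<close> and \<open>B\<close>, and
  two given classes come from a vector if they agree modulo \<open>A + B\<close>.
\<close>

lemma glue_mod_intersection:
  assumes A: "vec.subspace A" and B: "vec.subspace B" and AB: "A \<inter> B \<subseteq> {0}"
    and gl: "linear_on C D gl" and gr: "linear_on C D gr" and D: "vec.subspace D"
    and agree: "\<And>v. v \<in> D \<Longrightarrow> \<exists>a\<in>A. gl v - gr v - a \<in> B"
  shows "\<exists>f. linear_on C D f \<and> (\<forall>v\<in>D. f v - gl v \<in> A \<and> f v - gr v \<in> B)"
proof -
  obtain a where a: "\<And>v. v \<in> D \<Longrightarrow> a v \<in> A" "\<And>v. v \<in> D \<Longrightarrow> gl v - gr v - a v \<in> B"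
    using agree by metis
  define f where "f v = gl v - a v" for v
  have fA: "f v - gl v \<in> A" if "v \<in> D" for v
  proof -
    have "f v - gl v = - a v" by (simp add: f_def)
    then show ?thesis using a(1)[OF that] A by (simp add: vec.subspace_neg)
  qed
  have fB: "f v - gr v \<in> B" if "v \<in> D" for v
    using a(2)[OF that] by (simp add: f_def algebra_simps)
  have unique: "x = y" if "x - z \<in> A" "y - z \<in> A" "x - z' \<in> B" "y - z' \<in> B" for x y z z' :: "nat \<Rightarrow> 'a"
  proof -
    have "x - y = (x - z) - (y - z)" "x - y = (x - z') - (y - z')" by simp_all
    then have "x - y \<in> A \<inter> B" using that A B by (metis IntI vec.subspace_diff)
    then show ?thesis using AB by auto
  qed
  have "linear_on C D f"
    unfolding linear_on_def
  proof (intro conjI ballI)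
    fix v w assume vw: "v \<in> D" "w \<in> D"
    have "f v + f w - (gl v + gl w) = (f v - gl v) + (f w - gl w)"
      "f v + f w - (gr v + gr w) = (f v - gr v) + (f w - gr w)" by simp_all
    then have "f v + f w - (gl v + gl w) \<in> A" "f v + f w - (gr v + gr w) \<in> B"
      using vw fA fB A B by (simp_all only: vec.subspace_add)
    then show "f (v + w) = f v + f w"
      using unique[of "f (v + w)" "gl v + gl w" "f v + f w" "gr v + gr w"] vw
        fA[of "v + w"] fB[of "v + w"] D
      by (simp add: linear_on_add[OF gl] linear_on_add[OF gr] vec.subspace_add)
  next
    fix c v assume vw: "c \<in> C" "v \<in> D"
    have "scl c (f v) - scl c (gl v) \<in> A" "scl c (f v) - scl c (gr v) \<in> B"
      using vec.subspace_scale[OF A fA[OF vw(2)], of c] vec.subspace_scale[OF B fB[OF vw(2)], of c]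
      by (simp_all add: vec.scale_right_diff_distrib)
    then show "f (scl c v) = scl c (f v)"
      using unique[of "f (scl c v)" "scl c (gl v)" "scl c (f v)" "scl c (gr v)"] vw
        fA[of "scl c v"] fB[of "scl c v"] D
      by (simp add: linear_on_scl[OF gl] linear_on_scl[OF gr] vec.subspace_scale)
  qed
  then show ?thesis using fA fB by blast
qed

section \<open>Representations by subquotients\<close>

text \<open>
  Sets of vectors that depend on the parameter. The order \<open>\<le>\<close> of functions compares them for all
  values of the parameter.
\<close>

type_synonym 'a subspaces = "'a \<Rightarrow> (nat \<Rightarrow> 'a) set"

text \<open>
  The space at a vertex \<open>x\<close> is the subquotient \<open>X x / Y x\<close>, and the arrows act as the identity of \<open>W\<close>.
\<close>

definition subquotient_rep ::
    "nat \<Rightarrow> 'v set \<Rightarrow> ('v \<times> 'v) set \<Rightarrow> ('v \<Rightarrow> 'a::field subspaces) \<Rightarrow> ('v \<Rightarrow> 'a subspaces) \<Rightarrow> bool"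
  where "subquotient_rep n V A X Y \<longleftrightarrow>
    (\<forall>x\<in>V. \<forall>T. vec.subspace (X x T) \<and> vec.subspace (Y x T) \<and> Y x T \<subseteq> X x T \<and> X x T \<subseteq> coord_space n) \<and>
    A \<subseteq> V \<times> V \<and> (\<forall>x y. (x, y) \<in> A \<longrightarrow> X x \<le> X y \<and> Y x \<le> Y y)"

text \<open>
  \<open>g x\<close> stands for a map from \<open>X x / Y x\<close> at \<open>T\<close> to \<open>X x / Y x\<close> at \<open>S\<close>. Its values are representatives,
  which is why the squares of a homomorphism commute only modulo \<open>Y\<close>.
\<close>

definition natural_family ::
    "'a set \<Rightarrow> 'v set \<Rightarrow> ('v \<times> 'v) set \<Rightarrow> ('v \<Rightarrow> 'a::field subspaces) \<Rightarrow> ('v \<Rightarrow> 'a subspaces) \<Rightarrow>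
     'a \<Rightarrow> 'a \<Rightarrow> ('v \<Rightarrow> (nat \<Rightarrow> 'a) \<Rightarrow> nat \<Rightarrow> 'a) \<Rightarrow> bool"
  where "natural_family C V A X Y T S g \<longleftrightarrow>
    (\<forall>x\<in>V. linear_on C (X x T) (g x) \<and> g x ` X x T \<subseteq> X x S \<and> g x ` Y x T \<subseteq> Y x S) \<and>
    (\<forall>x y. (x, y) \<in> A \<longrightarrow> (\<forall>v\<in>X x T. g y v - g x v \<in> Y y S))"

definition induces ::
    "'a set \<Rightarrow> nat \<Rightarrow> 'v set \<Rightarrow> ('v \<Rightarrow> 'a::field subspaces) \<Rightarrow> ('v \<Rightarrow> 'a subspaces) \<Rightarrow> 'a \<Rightarrow> 'a \<Rightarrow>
     ((nat \<Rightarrow> 'a) \<Rightarrow> nat \<Rightarrow> 'a) \<Rightarrow> ('v \<Rightarrow> (nat \<Rightarrow> 'a) \<Rightarrow> nat \<Rightarrow> 'a) \<Rightarrow> bool"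
  where "induces C n V X Y T S f g \<longleftrightarrow> linear_on C (coord_space n) f \<and>
    f ` coord_space n \<subseteq> coord_space n \<and> (\<forall>x\<in>V. \<forall>v\<in>X x T. f v - g x v \<in> Y x S)"

text \<open>
  Passing from maps of \<open>W\<close> to homomorphisms between the representations at \<open>T\<close> and at \<open>S\<close> is full.
\<close>

definition full_rep ::
    "'a set \<Rightarrow> nat \<Rightarrow> 'v set \<Rightarrow> ('v \<times> 'v) set \<Rightarrow> ('v \<Rightarrow> 'a::field subspaces) \<Rightarrow> ('v \<Rightarrow> 'a subspaces) \<Rightarrow> bool"
  where "full_rep C n V A X Y \<longleftrightarrow> subquotient_rep n V A X Y \<and>
    (\<forall>T S g. natural_family C V A X Y T S g \<longrightarrow> (\<exists>f. induces C n V X Y T S f g))"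

definition preserves :: "((nat \<Rightarrow> 'a) \<Rightarrow> nat \<Rightarrow> 'a) \<Rightarrow> 'a \<Rightarrow> 'a \<Rightarrow> 'a subspaces \<Rightarrow> bool"
  where "preserves f T S H \<longleftrightarrow> (\<forall>v\<in>H T. f v \<in> H S)"

lemma subquotient_repD:
  assumes "subquotient_rep n V A X Y"
  shows "x \<in> V \<Longrightarrow> vec.subspace (X x T)" "x \<in> V \<Longrightarrow> vec.subspace (Y x T)"
    "x \<in> V \<Longrightarrow> Y x T \<subseteq> X x T" "x \<in> V \<Longrightarrow> X x T \<subseteq> coord_space n"
    "(x, y) \<in> A \<Longrightarrow> x \<in> V \<and> y \<in> V" "(x, y) \<in> A \<Longrightarrow> X x T \<subseteq> X y T" "(x, y) \<in> A \<Longrightarrow> Y x T \<subseteq> Y y T"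
  using assms by (auto simp: subquotient_rep_def le_fun_def)

lemma natural_familyD:
  assumes "natural_family C V A X Y T S g"
  shows "x \<in> V \<Longrightarrow> linear_on C (X x T) (g x)" "x \<in> V \<Longrightarrow> v \<in> X x T \<Longrightarrow> g x v \<in> X x S"
    "x \<in> V \<Longrightarrow> v \<in> Y x T \<Longrightarrow> g x v \<in> Y x S" "(x, y) \<in> A \<Longrightarrow> v \<in> X x T \<Longrightarrow> g y v - g x v \<in> Y y S"
  using assms by (auto simp: natural_family_def image_subset_iff)

lemma induces_preserves:
  assumes "subquotient_rep n V A X Y" "natural_family C V A X Y T S g" "induces C n V X Y T S f g" "x \<in> V"
  shows "preserves f T S (X x)" "preserves f T S (Y x)"
proof -
  have *: "f v - g x v \<in> Y x S" if "v \<in> X x T" for v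
    using assms(3,4) that by (auto simp: induces_def)
  note rep = subquotient_repD[OF assms(1)] and nat = natural_familyD[OF assms(2)]
  have "f v \<in> X x S" if "v \<in> X x T" for v
    using vec.subspace_add[OF rep(1)[OF assms(4)], of "f v - g x v" S "g x v"] *[OF that]
      nat(2)[OF assms(4) that] rep(3)[OF assms(4), of S] by auto
  moreover have "f v \<in> Y x S" if "v \<in> Y x T" for v
    using vec.subspace_add[OF rep(2)[OF assms(4)], of "f v - g x v" S "g x v"] *[of v]
      nat(3)[OF assms(4) that] rep(3)[OF assms(4), of T] that by auto
  ultimately show "preserves f T S (X x)" "preserves f T S (Y x)"
    by (auto simp: preserves_def)
qed

lemma subquotient_rep_rtrancl:
  assumes "subquotient_rep n V A X Y" "(x, y) \<in> A\<^sup>*"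
  shows "X x T \<subseteq> X y T" "Y x T \<subseteq> Y y T"
proof -
  have "X x T \<subseteq> X y T \<and> Y x T \<subseteq> Y y T"
    using assms(2) by (induction rule: rtrancl_induct) (use subquotient_repD(6,7)[OF assms(1)] in fast)+
  then show "X x T \<subseteq> X y T" "Y x T \<subseteq> Y y T" by auto
qed

lemma natural_family_rtrancl:
  assumes rep: "subquotient_rep n V A X Y" and nat: "natural_family C V A X Y T S g"
    and xy: "(x, y) \<in> A\<^sup>*" and x: "x \<in> V" and v: "v \<in> X x T"
  shows "g y v - g x v \<in> Y y S"
proof -
  have "y \<in> V \<and> g y v - g x v \<in> Y y S"
    using xy
  proof (induction rule: rtrancl_induct)
    case base
    show "x \<in> V \<and> g x v - g x v \<in> Y x S" using x vec.subspace_0[OF subquotient_repD(2)[OF rep x]] by simp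
  next
    case (step y z)
    have z: "z \<in> V" using subquotient_repD(5)[OF rep step(2)] by simp
    have "g z v - g y v \<in> Y z S"
      using natural_familyD(4)[OF nat step(2)] subquotient_rep_rtrancl(1)[OF rep step(1)] v by blast
    moreover have "g y v - g x v \<in> Y z S"
      using step subquotient_repD(7)[OF rep step(2)] by blast
    ultimately have "(g z v - g y v) + (g y v - g x v) \<in> Y z S"
      by (rule vec.subspace_add[OF subquotient_repD(2)[OF rep z]])
    then show "z \<in> V \<and> g z v - g x v \<in> Y z S" using z by simp
  qed
  then show ?thesis by simp
qed

section \<open>Attaching arms\<close>

lemma subquotient_rep_insert:
  assumes rep: "subquotient_rep n V A X Y" and a: "a \<notin> V" and b: "b \<in> V"
    and H: "\<And>T. vec.subspace (H T)" "\<And>T. vec.subspace (H' T)" "H' \<le> H" "H \<le> X b"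
    and e: "e = (b, a) \<and> X b \<le> H \<and> Y b \<le> H' \<or> e = (a, b) \<and> H' \<le> Y b"
  shows "subquotient_rep n (insert a V) (insert e A) (X(a := H)) (Y(a := H'))"
  unfolding subquotient_rep_def
proof (intro conjI ballI allI impI)
  have AV: "A \<subseteq> V \<times> V" using rep by (simp add: subquotient_rep_def)
  then show "insert e A \<subseteq> insert a V \<times> insert a V" using e b by auto
  fix x T assume x: "x \<in> insert a V"
  have "x = a \<or> x \<noteq> a \<and> x \<in> V" using x by auto
  then show "vec.subspace ((X(a := H)) x T)" "vec.subspace ((Y(a := H')) x T)"
    "(Y(a := H')) x T \<subseteq> (X(a := H)) x T" "(X(a := H)) x T \<subseteq> coord_space n"
    using subquotient_repD(1-4)[OF rep, of x T] H(1,2) le_funD[OF H(3), of T]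
      order_trans[OF le_funD[OF H(4)] subquotient_repD(4)[OF rep b], of T]
    by auto
next
  fix x y assume xy: "(x, y) \<in> insert e A"
  have AV: "A \<subseteq> V \<times> V" and ba: "b \<noteq> a" using rep a b by (auto simp: subquotient_rep_def)
  have "(X(a := H)) x \<le> (X(a := H)) y \<and> (Y(a := H')) x \<le> (Y(a := H')) y"
  proof (cases "(x, y) = e")
    case True
    then show ?thesis using e ba H by auto
  next
    case False
    then have "(x, y) \<in> A" using xy by auto
    moreover from this have "x \<noteq> a" "y \<noteq> a" using AV a by auto
    ultimately show ?thesis using rep by (auto simp: subquotient_rep_def)
  qed
  then show "(X(a := H)) x \<le> (X(a := H)) y" "(Y(a := H')) x \<le> (Y(a := H')) y" by auto
qed

text \<open>
  A leaf \<open>a\<close> at \<open>b\<close> is given a subspace of the subquotient at \<open>b\<close> if its edge points towards \<open>b\<close>, and a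
  quotient if the edge points away. In both cases the map at \<open>a\<close> is determined by the map at \<open>b\<close>, so
  whatever induces the latter induces the former.
\<close>

lemma full_rep_leaf:
  assumes full: "full_rep C n V A X Y" and b: "b \<in> V" and a: "a \<notin> V"
    and H: "\<And>T. vec.subspace (H T)" "\<And>T. vec.subspace (H' T)" "H' \<le> H"
    and e: "e = (b, a) \<and> H = X b \<and> Y b \<le> H' \<or> e = (a, b) \<and> H \<le> X b \<and> H' = Y b"
  shows "full_rep C n (insert a V) (insert e A) (X(a := H)) (Y(a := H'))"
    (is "full_rep C n ?V ?A ?X ?Y")
  unfolding full_rep_def
proof (intro conjI allI impI)
  have rep: "subquotient_rep n V A X Y" using full by (simp add: full_rep_def)
  have AV: "A \<subseteq> V \<times> V" using rep by (simp add: subquotient_rep_def)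
  have ba: "b \<noteq> a" using a b by auto
  have HX: "H \<le> X b" using e by auto
  show "subquotient_rep n ?V ?A ?X ?Y"
    by (rule subquotient_rep_insert[OF rep a b H HX]) (use e in auto)
  fix T S g assume nat: "natural_family C ?V ?A ?X ?Y T S g"
  have old: "?X x = X x" "?Y x = Y x" if "x \<in> V" for x using that a by auto
  have "natural_family C V A X Y T S g"
    unfolding natural_family_def
  proof (intro conjI ballI allI impI)
    fix x y v assume xy: "(x, y) \<in> A" "v \<in> X x T"
    then have "x \<in> V" "y \<in> V" using AV by auto
    then show "g y v - g x v \<in> Y y S" using natural_familyD(4)[OF nat, of x y v] xy old by simp
  next
    fix x assume x: "x \<in> V"
    then have "x \<in> ?V" by simp
    then show "linear_on C (X x T) (g x)" "g x ` X x T \<subseteq> X x S" "g x ` Y x T \<subseteq> Y x S"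
      using natural_familyD(1-3)[OF nat, of x] old[OF x] by auto
  qed
  then obtain f where f: "induces C n V X Y T S f g" using full unfolding full_rep_def by blast
  have "f v - g a v \<in> H' S" if v: "v \<in> H T" for v
  proof -
    have fb: "f v - g b v \<in> Y b S"
      using f b subsetD[OF le_funD[OF HX] v] by (simp add: induces_def)
    from e show ?thesis
    proof (elim disjE conjE)
      assume e: "e = (b, a)" "H = X b" "Y b \<le> H'"
      have "(f v - g b v) - (g a v - g b v) \<in> H' S"
        by (rule vec.subspace_diff[OF H(2) subsetD[OF le_funD[OF e(3)] fb]])
          (use natural_familyD(4)[OF nat, of b a v] v e ba in simp)
      then show ?thesis by simp
    next
      assume e: "e = (a, b)" "H' = Y b"
      have "(f v - g b v) + (g b v - g a v) \<in> H' S"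
        unfolding e(2) by (rule vec.subspace_add[OF subquotient_repD(2)[OF rep b] fb])
          (use natural_familyD(4)[OF nat, of a b v] v e ba in simp)
      then show ?thesis by simp
    qed
  qed
  then have "induces C n ?V ?X ?Y T S f g" using f old by (auto simp: induces_def)
  then show "\<exists>f. induces C n ?V ?X ?Y T S f g" by blast
qed

lemma chain_edges_Cons: "chain_edges (b # a # as) = insert (b, a) (chain_edges (a # as))"
  by (simp add: chain_edges_def)

text \<open>
  The members of a flag between \<open>Y b\<close> and \<open>X b\<close> are used up one by one along an arm at \<open>b\<close>: the
  smallest one left becomes the new \<open>Y\<close> at an edge pointing outwards, the largest one left the new \<open>X\<close>
  at an edge pointing inwards. When the arm ends, each member has become the \<open>X\<close> or the \<open>Y\<close> of some
  vertex, whatever the orientation \<open>s\<close>.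
\<close>

lemma full_rep_arm:
  assumes "full_rep C n V A X Y" "b \<in> V" "distinct as" "set as \<inter> V = {}"
    and "length Hs = length as" "sorted_wrt (\<le>) (Y b # Hs @ [X b])"
    and "\<And>H T. H \<in> set Hs \<Longrightarrow> vec.subspace (H T)"
  shows "\<exists>X' Y'. full_rep C n (V \<union> set as) (A \<union> orient s (chain_edges (b # as))) X' Y' \<and>
    (\<forall>x\<in>V. X' x = X x \<and> Y' x = Y x) \<and> set Hs \<subseteq> X' ` (V \<union> set as) \<union> Y' ` (V \<union> set as)"
  using assms
proof (induction as arbitrary: b V A X Y Hs)
  case Nil
  then show ?case by (auto simp: chain_edges_def orient_def)
next
  case (Cons a as)
  have a: "a \<notin> V" and as: "set as \<inter> insert a V = {}" "distinct as" using Cons.prems by auto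
  have ne: "Hs \<noteq> []" using Cons.prems by auto
  have "subquotient_rep n V A X Y" using Cons.prems(1) by (simp add: full_rep_def)
  note sub = subquotient_repD(1,2)[OF this]
  have orient: "A \<union> orient s (chain_edges (b # a # as)) =
      insert (if s (b, a) then (b, a) else (a, b)) A \<union> orient s (chain_edges (a # as))"
    by (auto simp: orient_def chain_edges_Cons)
  have V: "insert a V \<union> set as = V \<union> set (a # as)" by auto
  \<comment> \<open>The edge points outwards if \<open>s (b, a)\<close> holds, and inwards otherwise.\<close>
  show ?case
  proof (cases "s (b, a)")
    case True
    obtain H Hs' where Hs: "Hs = H # Hs'" using ne by (cases Hs) auto
    let ?X = "X(a := X b)" and ?Y = "Y(a := H)"
    have "full_rep C n (insert a V) (insert (b, a) A) ?X ?Y"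
      by (rule full_rep_leaf[OF Cons.prems(1,2) a sub(1)[OF Cons.prems(2)] Cons.prems(7)])
        (use Cons.prems(6) Hs in auto)
    from Cons.IH[OF this, of a Hs'] obtain X' Y' where
      "full_rep C n (insert a V \<union> set as) (insert (b, a) A \<union> orient s (chain_edges (a # as))) X' Y'"
      "\<forall>x\<in>insert a V. X' x = ?X x \<and> Y' x = ?Y x"
      "set Hs' \<subseteq> X' ` (insert a V \<union> set as) \<union> Y' ` (insert a V \<union> set as)"
      using Cons.prems as Hs by auto
    then show ?thesis
      unfolding orient V[symmetric] using True a Hs
      by (intro exI[of _ X'] exI[of _ Y']) auto
  next
    case False
    obtain H Hs' where Hs: "Hs = Hs' @ [H]" using ne by (cases Hs rule: rev_cases) auto
    let ?X = "X(a := H)" and ?Y = "Y(a := Y b)"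
    have "full_rep C n (insert a V) (insert (a, b) A) ?X ?Y"
      by (rule full_rep_leaf[OF Cons.prems(1,2) a Cons.prems(7) sub(2)[OF Cons.prems(2)]])
        (use Cons.prems(6) Hs in \<open>auto simp: sorted_wrt_append\<close>)
    from Cons.IH[OF this, of a Hs'] obtain X' Y' where
      "full_rep C n (insert a V \<union> set as) (insert (a, b) A \<union> orient s (chain_edges (a # as))) X' Y'"
      "\<forall>x\<in>insert a V. X' x = ?X x \<and> Y' x = ?Y x"
      "set Hs' \<subseteq> X' ` (insert a V \<union> set as) \<union> Y' ` (insert a V \<union> set as)"
      using Cons.prems as Hs by (auto simp: sorted_wrt_append)
    then show ?thesis
      unfolding orient V[symmetric] using False a Hs
      by (intro exI[of _ X'] exI[of _ Y']) auto
  qed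
qed

section \<open>Pushouts and pullbacks\<close>

lemma full_rep_point:
  "full_rep C n {b} {} (\<lambda>_ _. coord_space n) (\<lambda>_ _. {0})"
proof -
  have "\<exists>f. induces C n {b} (\<lambda>_ _. coord_space n) (\<lambda>_ _. {0}) T S f g"
    if "natural_family C {b} {} (\<lambda>_ _. coord_space n) (\<lambda>_ _. {0}) T S g" for T S g
    using that by (intro exI[of _ "g b"]) (auto simp: natural_family_def induces_def)
  then show ?thesis
    by (auto simp: full_rep_def subquotient_rep_def subspace_coord_space vec.subspace_0)
qed

text \<open>
  Here \<open>l\<close> and \<open>r\<close> carry subspaces of \<open>W\<close> with sum \<open>W\<close>, and the maps at \<open>l\<close> and \<open>r\<close> agree on the
  intersection because it is visible at common predecessors. So they glue to a map of \<open>W\<close>. It induces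
  the map at each vertex below \<open>l\<close> or \<open>r\<close> because the subspaces embed, and at each vertex above both
  because these two generate.
\<close>

lemma full_rep_pushout:
  assumes rep: "subquotient_rep n V A X Y"
    and l: "l \<in> V" "Y l = (\<lambda>_. {0})" and r: "r \<in> V" "Y r = (\<lambda>_. {0})"
    and sum: "\<And>T w. w \<in> coord_space n \<Longrightarrow> \<exists>u\<in>X r T. w - u \<in> X l T"
    and meet: "\<And>T v. v \<in> X l T \<Longrightarrow> v \<in> X r T \<Longrightarrow> v = 0 \<or> (\<exists>m\<in>V. (m, l) \<in> A\<^sup>* \<and> (m, r) \<in> A\<^sup>* \<and> v \<in> X m T)"
    and V: "\<And>x. x \<in> V \<Longrightarrow> (x, l) \<in> A\<^sup>* \<or> (x, r) \<in> A\<^sup>* \<or> (l, x) \<in> A\<^sup>* \<and> (r, x) \<in> A\<^sup>*"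
  shows "full_rep C n V A X Y"
  unfolding full_rep_def
proof (intro conjI allI impI)
  fix T S g assume nat: "natural_family C V A X Y T S g"
  note rp = subquotient_repD[OF rep] and nt = natural_familyD[OF nat]
  note go = natural_family_rtrancl[OF rep nat]
  have agree: "g l v - g r v \<in> {0}" if v: "v \<in> X l T" "v \<in> X r T" for v
  proof (cases "v = 0")
    case True
    then show ?thesis
      using linear_on_0[OF nt(1)[OF l(1)] rp(1)[OF l(1)]] linear_on_0[OF nt(1)[OF r(1)] rp(1)[OF r(1)]]
      by simp
  next
    case False
    then obtain m where m: "m \<in> V" "(m, l) \<in> A\<^sup>*" "(m, r) \<in> A\<^sup>*" "v \<in> X m T"
      using meet[OF v] by auto
    then show ?thesis using go[OF m(2,1,4)] go[OF m(3,1,4)] l(2) r(2) by simp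
  qed
  obtain f where f: "linear_on C (coord_space n) f" "\<And>v. v \<in> X l T \<Longrightarrow> f v = g l v"
    "\<And>v. v \<in> X r T \<Longrightarrow> f v - g r v \<in> {0}"
    "\<And>w. w \<in> coord_space n \<Longrightarrow> \<exists>u\<in>X l T. \<exists>u'\<in>X r T. f w = g l u + g r u'"
    using glue_on_sum[OF rp(1)[OF l(1)] rp(1)[OF r(1)] vec.subspace_single_0 nt(1)[OF l(1)] nt(1)[OF r(1)]
        subspace_coord_space rp(4)[OF l(1)] rp(4)[OF r(1)] sum agree] by auto
  have "f w \<in> coord_space n" if w: "w \<in> coord_space n" for w
  proof -
    obtain u u' where u: "u \<in> X l T" "u' \<in> X r T" "f w = g l u + g r u'" using f(4)[OF w] by auto
    then have "g l u \<in> coord_space n" "g r u' \<in> coord_space n" using nt(2) rp(4) l r by blast+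
    then show ?thesis unfolding u(3) by (rule vec.subspace_add[OF subspace_coord_space])
  qed
  moreover have "f v - g x v \<in> Y x S" if x: "x \<in> V" and v: "v \<in> X x T" for x v
    using V[OF x]
  proof (elim disjE conjE)
    assume xl: "(x, l) \<in> A\<^sup>*"
    then have "g l v = g x v" using go[OF xl x v] l(2) by simp
    moreover have "f v = g l v" using f(2) subquotient_rep_rtrancl(1)[OF rep xl, of T] v by blast
    ultimately show ?thesis using rp(2)[OF x] by (simp add: vec.subspace_0)
  next
    assume xr: "(x, r) \<in> A\<^sup>*"
    then have "g r v = g x v" using go[OF xr x v] r(2) by simp
    moreover have "f v = g r v" using f(3)[of v] subquotient_rep_rtrancl(1)[OF rep xr, of T] v by auto
    ultimately show ?thesis using rp(2)[OF x] by (simp add: vec.subspace_0)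
  next
    assume lx: "(l, x) \<in> A\<^sup>*" and rx: "(r, x) \<in> A\<^sup>*"
    have vn: "v \<in> coord_space n" using rp(4)[OF x, of T] v by auto
    obtain u where u: "u \<in> X r T" "v - u \<in> X l T" using sum[OF vn] by auto
    have ux: "u \<in> X x T" "v - u \<in> X x T"
      using u subquotient_rep_rtrancl(1)[OF rep lx, of T] subquotient_rep_rtrancl(1)[OF rep rx, of T] by auto
    have un: "u \<in> coord_space n" "v - u \<in> coord_space n" using ux rp(4)[OF x, of T] by auto
    have "f v = f (v - u) + f u" using linear_on_add[OF f(1) un(2,1)] by simp
    moreover have "g x v = g x (v - u) + g x u" using linear_on_add[OF nt(1)[OF x] ux(2,1)] by simp
    moreover have "f (v - u) = g l (v - u)" "f u = g r u" using f(2)[OF u(2)] f(3)[OF u(1)] by auto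
    ultimately have "f v - g x v = - ((g x (v - u) - g l (v - u)) + (g x u - g r u))" by simp
    moreover have "(g x (v - u) - g l (v - u)) + (g x u - g r u) \<in> Y x S"
      by (rule vec.subspace_add[OF rp(2)[OF x] go[OF lx l(1) u(2)] go[OF rx r(1) u(1)]])
    ultimately show ?thesis using vec.subspace_neg[OF rp(2)[OF x]] by (simp only:)
  qed
  ultimately have "induces C n V X Y T S f g" using f(1) by (auto simp: induces_def)
  then show "\<exists>f. induces C n V X Y T S f g" by blast
qed (rule rep)

lemma image_from_quotient:
  assumes rep: "subquotient_rep n V A X Y" and nat: "natural_family C V A X Y T S g"
    and p: "p \<in> V" "X p = (\<lambda>_. coord_space n)" and f: "\<And>v. v \<in> coord_space n \<Longrightarrow> f v - g p v \<in> Y p S"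
  shows "f ` coord_space n \<subseteq> coord_space n"
proof (rule image_subsetI)
  fix w :: "nat \<Rightarrow> 'b" assume w: "w \<in> coord_space n"
  have "f w - g p w \<in> coord_space n" using f[OF w] subquotient_repD(3,4)[OF rep p(1)] by blast
  moreover have "g p w \<in> coord_space n" using natural_familyD(2)[OF nat p(1)] p(2) w by auto
  ultimately have "(f w - g p w) + g p w \<in> coord_space n" by (rule vec.subspace_add[OF subspace_coord_space])
  then show "f w \<in> coord_space n" by simp
qed

text \<open>
  Dually, \<open>l\<close> and \<open>r\<close> carry quotients of \<open>W\<close> by subspaces with intersection \<open>0\<close>, and the maps at \<open>l\<close>
  and \<open>r\<close> agree modulo the sum of these subspaces because of the common successor \<open>e\<close>.
\<close>

lemma full_rep_pullback:
  assumes rep: "subquotient_rep n V A X Y"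
    and l: "l \<in> V" "X l = (\<lambda>_. coord_space n)" and r: "r \<in> V" "X r = (\<lambda>_. coord_space n)"
    and meet: "\<And>T. Y l T \<inter> Y r T \<subseteq> {0}"
    and e: "e \<in> V" "(l, e) \<in> A\<^sup>*" "(r, e) \<in> A\<^sup>*"
    and sum: "\<And>T w. w \<in> Y e T \<Longrightarrow> \<exists>u\<in>Y l T. w - u \<in> Y r T"
    and V: "\<And>x. x \<in> V \<Longrightarrow> (l, x) \<in> A\<^sup>* \<or> (r, x) \<in> A\<^sup>* \<or> (x, l) \<in> A\<^sup>* \<and> (x, r) \<in> A\<^sup>*"
  shows "full_rep C n V A X Y"
  unfolding full_rep_def
proof (intro conjI allI impI)
  fix T S g assume nat: "natural_family C V A X Y T S g"
  note rp = subquotient_repD[OF rep] and nt = natural_familyD[OF nat]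
  note go = natural_family_rtrancl[OF rep nat]
  have lin: "linear_on C (coord_space n) (g l)" "linear_on C (coord_space n) (g r)"
    using nt(1)[OF l(1)] nt(1)[OF r(1)] l r by auto
  have agree: "\<exists>a\<in>Y l S. g l v - g r v - a \<in> Y r S" if v: "v \<in> coord_space n" for v
  proof -
    have "(g e v - g r v) - (g e v - g l v) \<in> Y e S"
      by (rule vec.subspace_diff[OF rp(2)[OF e(1)] go[OF e(3) r(1)] go[OF e(2) l(1)]]) (use v l r in auto)
    then have "g l v - g r v \<in> Y e S" by simp
    then show ?thesis by (rule sum)
  qed
  obtain f where f: "linear_on C (coord_space n) f" "\<And>v. v \<in> coord_space n \<Longrightarrow> f v - g l v \<in> Y l S"
    "\<And>v. v \<in> coord_space n \<Longrightarrow> f v - g r v \<in> Y r S"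
    using glue_mod_intersection[OF rp(2)[OF l(1)] rp(2)[OF r(1)] meet lin subspace_coord_space agree] by auto
  have "f ` coord_space n \<subseteq> coord_space n" by (rule image_from_quotient[OF rep nat l f(2)])
  moreover have "f v - g x v \<in> Y x S" if x: "x \<in> V" and v: "v \<in> X x T" for x v
  proof -
    have vn: "v \<in> coord_space n" using rp(4)[OF x, of T] v by auto
    have down: "f v - g x v \<in> Y x S" if z: "(z, x) \<in> A\<^sup>*" "z \<in> V" "v \<in> X z T" "f v - g z v \<in> Y z S" for z
    proof -
      have "(f v - g z v) - (g x v - g z v) \<in> Y x S"
        by (rule vec.subspace_diff[OF rp(2)[OF x] subsetD[OF subquotient_rep_rtrancl(2)[OF rep z(1)] z(4)]
              go[OF z(1,2,3)]])
      then show ?thesis by simp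
    qed
    have up: "f v - g x v \<in> Y z S" if z: "(x, z) \<in> A\<^sup>*" "z \<in> V" "f v - g z v \<in> Y z S" for z
    proof -
      have "(f v - g z v) + (g z v - g x v) \<in> Y z S"
        by (rule vec.subspace_add[OF rp(2)[OF z(2)] z(3) go[OF z(1) x v]])
      then show ?thesis by simp
    qed
    show ?thesis
      using V[OF x]
    proof (elim disjE conjE)
      assume "(l, x) \<in> A\<^sup>*"
      then show ?thesis using down[of l] l vn f(2) by simp
    next
      assume "(r, x) \<in> A\<^sup>*"
      then show ?thesis using down[of r] r vn f(3) by simp
    next
      assume "(x, l) \<in> A\<^sup>*" "(x, r) \<in> A\<^sup>*"
      then have "f v - g x v \<in> Y l S \<inter> Y r S" using up[of l] up[of r] l r vn f(2,3) by simp
      then have "f v - g x v = 0" using meet by blast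
      then show ?thesis using rp(2)[OF x] by (simp add: vec.subspace_0)
    qed
  qed
  ultimately have "induces C n V X Y T S f g" using f(1) by (auto simp: induces_def)
  then show "\<exists>f. induces C n V X Y T S f g" by blast
qed (rule rep)

text \<open>
  A pushout followed by a pullback: gluing the maps at \<open>l\<close> and \<open>r\<close> yields a map of \<open>W\<close> that is correct
  modulo \<open>Y r\<close> only, and the map at \<open>p\<close>, which is correct modulo \<open>Y p\<close>, removes the ambiguity.
\<close>

lemma full_rep_mixed:
  assumes rep: "subquotient_rep n V A X Y"
    and l: "l \<in> V" "Y l = (\<lambda>_. {0})" and r: "r \<in> V" and p: "p \<in> V" "X p = (\<lambda>_. coord_space n)" and t: "t \<in> V"
    and arrows: "(l, p) \<in> A\<^sup>*" "(p, t) \<in> A\<^sup>*" "(r, t) \<in> A\<^sup>*"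
    and sum: "\<And>T w. w \<in> coord_space n \<Longrightarrow> \<exists>u\<in>X r T. w - u \<in> X l T"
    and meet: "\<And>T v. v \<in> X l T \<Longrightarrow> v \<in> X r T \<Longrightarrow> \<exists>m\<in>V. (m, l) \<in> A\<^sup>* \<and> (m, r) \<in> A\<^sup>* \<and> v \<in> X m T"
    and Yrp: "\<And>T. Y r T \<inter> Y p T \<subseteq> {0}"
    and Yt: "\<And>T w. w \<in> Y t T \<Longrightarrow> \<exists>u\<in>Y r T. w - u \<in> Y p T"
    and V: "\<And>x. x \<in> V \<Longrightarrow> (x, l) \<in> A\<^sup>* \<or> (p, x) \<in> A\<^sup>* \<or> x = r"
  shows "full_rep C n V A X Y"
  unfolding full_rep_def
proof (intro conjI allI impI)
  fix T S g assume nat: "natural_family C V A X Y T S g"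
  note rp = subquotient_repD[OF rep] and nt = natural_familyD[OF nat]
  note go = natural_family_rtrancl[OF rep nat]
  have agree: "g l v - g r v \<in> Y r S" if v: "v \<in> X l T" "v \<in> X r T" for v
  proof -
    obtain m where m: "m \<in> V" "(m, l) \<in> A\<^sup>*" "(m, r) \<in> A\<^sup>*" "v \<in> X m T"
      using meet[OF v] by auto
    have "g l v = g m v" using go[OF m(2,1,4)] l(2) by simp
    moreover have "- (g r v - g m v) \<in> Y r S"
      by (rule vec.subspace_neg[OF rp(2)[OF r] go[OF m(3,1,4)]])
    ultimately show ?thesis by simp
  qed
  obtain h where h: "linear_on C (coord_space n) h" "\<And>v. v \<in> X l T \<Longrightarrow> h v = g l v"
    "\<And>v. v \<in> X r T \<Longrightarrow> h v - g r v \<in> Y r S"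
    using glue_on_sum[OF rp(1)[OF l(1)] rp(1)[OF r(1)] rp(2)[OF r] nt(1)[OF l(1)] nt(1)[OF r(1)]
        subspace_coord_space rp(4)[OF l(1)] rp(4)[OF r(1)] sum agree] by auto
  have lt: "(l, t) \<in> A\<^sup>*" using arrows by (meson rtrancl_trans)
  have hp: "h v - g p v \<in> Y t S" if v: "v \<in> coord_space n" for v
  proof -
    obtain u where u: "u \<in> X r T" "v - u \<in> X l T" using sum[OF v] by auto
    have ut: "u \<in> X t T" "v - u \<in> X t T"
      using u subquotient_rep_rtrancl(1)[OF rep lt, of T] subquotient_rep_rtrancl(1)[OF rep arrows(3), of T]
      by auto
    have un: "u \<in> coord_space n" "v - u \<in> coord_space n" using ut rp(4)[OF t, of T] by auto
    have "h v = h (v - u) + h u" using linear_on_add[OF h(1) un(2,1)] by simp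
    moreover have "g t v = g t (v - u) + g t u" using linear_on_add[OF nt(1)[OF t] ut(2,1)] by simp
    moreover have "h (v - u) = g l (v - u)" by (rule h(2)[OF u(2)])
    ultimately have "h v - g p v = (h u - g r u) - (g t (v - u) - g l (v - u)) - (g t u - g r u) + (g t v - g p v)"
      by simp
    moreover have "h u - g r u \<in> Y t S"
      using h(3)[OF u(1)] subquotient_rep_rtrancl(2)[OF rep arrows(3)] by blast
    moreover have "g t (v - u) - g l (v - u) \<in> Y t S" by (rule go[OF lt l(1) u(2)])
    moreover have "g t u - g r u \<in> Y t S" by (rule go[OF arrows(3) r u(1)])
    moreover have "g t v - g p v \<in> Y t S" by (rule go[OF arrows(2) p(1)]) (use p v in simp)
    ultimately show ?thesis
      by (simp only: vec.subspace_add[OF rp(2)[OF t]] vec.subspace_diff[OF rp(2)[OF t]])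
  qed
  have lin_p: "linear_on C (coord_space n) (g p)" using nt(1)[OF p(1)] p(2) by simp
  obtain f where f: "linear_on C (coord_space n) f" "\<And>v. v \<in> coord_space n \<Longrightarrow> f v - h v \<in> Y r S"
    "\<And>v. v \<in> coord_space n \<Longrightarrow> f v - g p v \<in> Y p S"
    using glue_mod_intersection[OF rp(2)[OF r(1)] rp(2)[OF p(1)] Yrp h(1) lin_p subspace_coord_space Yt[OF hp]]
    by auto
  have "f ` coord_space n \<subseteq> coord_space n" by (rule image_from_quotient[OF rep nat p f(3)])
  moreover have "f v - g x v \<in> Y x S" if x: "x \<in> V" and v: "v \<in> X x T" for x v
  proof -
    have vn: "v \<in> coord_space n" using rp(4)[OF x, of T] v by auto
    show ?thesis
      using V[OF x]
    proof (elim disjE)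
      assume xl: "(x, l) \<in> A\<^sup>*"
      then have eq: "g l v = g x v" using go[OF xl x v] l(2) by simp
      have vl: "v \<in> X l T" using subquotient_rep_rtrancl(1)[OF rep xl, of T] v by blast
      have "f v - g l v \<in> Y r S" using f(2)[OF vn] h(2)[OF vl] by simp
      moreover have "(f v - g p v) + (g p v - g l v) \<in> Y p S"
        by (rule vec.subspace_add[OF rp(2)[OF p(1)] f(3)[OF vn] go[OF arrows(1) l(1) vl]])
      then have "f v - g l v \<in> Y p S" by simp
      ultimately have "f v = g l v" using Yrp[of S] by auto
      then show ?thesis using eq rp(2)[OF x] by (simp add: vec.subspace_0)
    next
      assume px: "(p, x) \<in> A\<^sup>*"
      have "(f v - g p v) - (g x v - g p v) \<in> Y x S"
        by (rule vec.subspace_diff[OF rp(2)[OF x] subsetD[OF subquotient_rep_rtrancl(2)[OF rep px] f(3)[OF vn]]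
              go[OF px p(1)]]) (use p vn in simp)
      then show ?thesis by simp
    next
      assume "x = r"
      then have "(f v - h v) + (h v - g x v) \<in> Y x S"
        using vec.subspace_add[OF rp(2)[OF r] f(2)[OF vn] h(3)[of v]] v by simp
      then show ?thesis by simp
    qed
  qed
  ultimately have "induces C n V X Y T S f g" using f(1) by (auto simp: induces_def)
  then show "\<exists>f. induces C n V X Y T S f g" by blast
qed (rule rep)

text \<open>
  The lower corner of the square carries \<open>L \<inter> R\<close> and the upper one \<open>W / Z\<close>.
\<close>

lemma square_pushout:
  assumes "distinct [m, l, r, t]"
    and "\<And>T. vec.subspace (L T)" "\<And>T. vec.subspace (R T)" "\<And>T. vec.subspace (Z T)"
    and "\<And>T. L T \<subseteq> coord_space n" "\<And>T. R T \<subseteq> coord_space n" "\<And>T. Z T \<subseteq> coord_space n"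
    and "\<And>T w. w \<in> coord_space n \<Longrightarrow> \<exists>u\<in>R T. w - u \<in> L T"
  shows "full_rep C n {m, l, r, t} {(m, l), (l, t), (m, r), (r, t)}
    ((\<lambda>_ _. coord_space n)(m := \<lambda>T. L T \<inter> R T, l := L, r := R)) ((\<lambda>_ _. {0})(t := Z))"
proof (rule full_rep_pushout[where l = l and r = r])
  have "L T \<inter> R T \<subseteq> coord_space n" for T
    using assms(5)[of T] by blast
  then show "subquotient_rep n {m, l, r, t} {(m, l), (l, t), (m, r), (r, t)}
    ((\<lambda>_ _. coord_space n)(m := \<lambda>T. L T \<inter> R T, l := L, r := R)) ((\<lambda>_ _. {0})(t := Z))"
    using assms by (auto simp: subquotient_rep_def le_fun_def subspace_coord_space vec.subspace_0
        intro: vec.subspace_inter)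
qed (use assms in \<open>auto intro: r_into_rtrancl\<close>)

text \<open>
  The upper corner carries \<open>W / E\<close>, where \<open>E = A + B\<close>, and the lower one the subspace \<open>N\<close>.
\<close>

lemma square_pullback:
  assumes "distinct [s, l, r, e]"
    and "\<And>T. vec.subspace (N T)" "\<And>T. vec.subspace (A T)" "\<And>T. vec.subspace (B T)" "\<And>T. vec.subspace (E T)"
    and "\<And>T. N T \<subseteq> coord_space n" "A \<le> E" "B \<le> E" "\<And>T. E T \<subseteq> coord_space n"
    and "\<And>T. A T \<inter> B T \<subseteq> {0}" "\<And>T w. w \<in> E T \<Longrightarrow> \<exists>u\<in>A T. w - u \<in> B T"
  shows "full_rep C n {s, l, r, e} {(s, l), (l, e), (s, r), (r, e)}
    ((\<lambda>_ _. coord_space n)(s := N)) ((\<lambda>_ _. {0})(l := A, r := B, e := E))"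
proof (rule full_rep_pullback[where l = l and r = r and e = e])
  have "A T \<subseteq> coord_space n" "B T \<subseteq> coord_space n" for T
    using le_funD[OF assms(7), of T] le_funD[OF assms(8), of T] assms(9)[of T] by auto
  then show "subquotient_rep n {s, l, r, e} {(s, l), (l, e), (s, r), (r, e)}
    ((\<lambda>_ _. coord_space n)(s := N)) ((\<lambda>_ _. {0})(l := A, r := B, e := E))"
    using assms by (auto simp: subquotient_rep_def le_fun_def subspace_coord_space vec.subspace_0)
qed (use assms in \<open>auto intro: r_into_rtrancl\<close>)

lemma rtrancl2: "(x, y) \<in> A \<Longrightarrow> (y, z) \<in> A \<Longrightarrow> (x, z) \<in> A\<^sup>*"
  by (meson converse_rtrancl_into_rtrancl r_into_rtrancl)

lemma pentagon_pushout:
  assumes "distinct [m, k, l, r, t]"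
    and "\<And>T. vec.subspace (K T)" "\<And>T. vec.subspace (L T)" "\<And>T. vec.subspace (R T)" "\<And>T. vec.subspace (Z T)"
    and "\<And>T. L T \<inter> R T \<subseteq> K T" "K \<le> L"
    and "\<And>T. L T \<subseteq> coord_space n" "\<And>T. R T \<subseteq> coord_space n" "\<And>T. Z T \<subseteq> coord_space n"
    and "\<And>T w. w \<in> coord_space n \<Longrightarrow> \<exists>u\<in>R T. w - u \<in> L T"
  shows "full_rep C n {m, k, l, r, t} {(m, k), (k, l), (l, t), (m, r), (r, t)}
    ((\<lambda>_ _. coord_space n)(m := \<lambda>T. L T \<inter> R T, k := K, l := L, r := R)) ((\<lambda>_ _. {0})(t := Z))"
proof (rule full_rep_pushout[where l = l and r = r])
  have "K T \<subseteq> coord_space n" "L T \<inter> R T \<subseteq> coord_space n" for T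
    using le_funD[OF assms(7), of T] assms(8)[of T] by auto
  then show "subquotient_rep n {m, k, l, r, t} {(m, k), (k, l), (l, t), (m, r), (r, t)}
    ((\<lambda>_ _. coord_space n)(m := \<lambda>T. L T \<inter> R T, k := K, l := L, r := R)) ((\<lambda>_ _. {0})(t := Z))"
    using assms by (auto simp: subquotient_rep_def le_fun_def subspace_coord_space vec.subspace_0
        intro: vec.subspace_inter)
qed (use assms in \<open>auto intro: r_into_rtrancl rtrancl2\<close>)

lemma pentagon_pullback:
  assumes "distinct [s, l, k, r, e]"
    and "\<And>T. vec.subspace (N T)" "\<And>T. vec.subspace (A T)" "\<And>T. vec.subspace (K T)"
    "\<And>T. vec.subspace (B T)" "\<And>T. vec.subspace (E T)"
    and "\<And>T. N T \<subseteq> coord_space n" "A \<le> K" "K \<le> E" "B \<le> E" "\<And>T. E T \<subseteq> coord_space n"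
    and "\<And>T. A T \<inter> B T \<subseteq> {0}" "\<And>T w. w \<in> E T \<Longrightarrow> \<exists>u\<in>A T. w - u \<in> B T"
  shows "full_rep C n {s, l, k, r, e} {(s, l), (l, k), (k, e), (s, r), (r, e)}
    ((\<lambda>_ _. coord_space n)(s := N)) ((\<lambda>_ _. {0})(l := A, k := K, r := B, e := E))"
proof (rule full_rep_pullback[where l = l and r = r and e = e])
  have "A T \<subseteq> coord_space n" "K T \<subseteq> coord_space n" "B T \<subseteq> coord_space n" for T
    using le_funD[OF assms(8), of T] le_funD[OF assms(9), of T] le_funD[OF assms(10), of T]
      assms(11)[of T] by auto
  then show "subquotient_rep n {s, l, k, r, e} {(s, l), (l, k), (k, e), (s, r), (r, e)}
    ((\<lambda>_ _. coord_space n)(s := N)) ((\<lambda>_ _. {0})(l := A, k := K, r := B, e := E))"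
    using assms by (auto simp: subquotient_rep_def le_fun_def subspace_coord_space vec.subspace_0)
qed (use assms in \<open>auto intro: r_into_rtrancl rtrancl2\<close>)

section \<open>Rigid configurations of subspaces\<close>

text \<open>
  When \<open>C\<close> is the whole field, \<open>\<phi>\<close> is linear, and the last condition forces \<open>\<phi> = 0\<close> unless \<open>T = S\<close>. When
  \<open>T = S\<close> generates the field over \<open>C\<close>, it makes \<open>\<phi>\<close> linear over the whole field.
\<close>

definition scalar_map :: "'a set \<Rightarrow> nat \<Rightarrow> 'a::field \<Rightarrow> 'a \<Rightarrow> ((nat \<Rightarrow> 'a) \<Rightarrow> nat \<Rightarrow> 'a) \<Rightarrow> bool"
  where "scalar_map C n T S f \<longleftrightarrow> (\<exists>\<phi>. (\<forall>w\<in>coord_space n. f w = (\<lambda>i. \<phi> (w i))) \<and> (\<forall>x y. \<phi> (x + y) = \<phi> x + \<phi> y) \<and>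
      (\<forall>c\<in>C. \<forall>x. \<phi> (c * x) = c * \<phi> x) \<and> (\<forall>x. \<phi> (T * x) = S * \<phi> x))"

definition scalar_rigid :: "'a set \<Rightarrow> nat \<Rightarrow> 'a::field subspaces set \<Rightarrow> bool"
  where "scalar_rigid C n M \<longleftrightarrow> (\<forall>T S f. linear_on C (coord_space n) f \<longrightarrow>
    f ` coord_space n \<subseteq> coord_space n \<longrightarrow> (\<forall>H\<in>M. preserves f T S H) \<longrightarrow> scalar_map C n T S f)"

lemma scalar_rigid_derived:
  assumes "scalar_rigid C n M"
    and "\<And>T S f H. linear_on C (coord_space n) f \<Longrightarrow> (\<And>H. H \<in> M' \<Longrightarrow> preserves f T S H) \<Longrightarrow> H \<in> M \<Longrightarrow>
      preserves f T S H"
  shows "scalar_rigid C n M'"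
  unfolding scalar_rigid_def
proof (intro allI impI)
  fix T S f
  assume f: "linear_on C (coord_space n) f" "f ` coord_space n \<subseteq> coord_space n" "\<forall>H\<in>M'. preserves f T S H"
  then have "\<forall>H\<in>M. preserves f T S H" using assms(2)[of f T S] by blast
  then show "scalar_map C n T S f"
    using assms(1)[unfolded scalar_rigid_def, rule_format, OF f(1,2)] by simp
qed

definition single :: "nat \<Rightarrow> 'a \<Rightarrow> nat \<Rightarrow> 'a::zero"
  where "single i x = (\<lambda>j. if j = i then x else 0)"

lemma single_apply: "single i x j = (if j = i then x else 0)"
  by (simp add: single_def)

lemma single_in_coord_space [simp]: "i < n \<Longrightarrow> single i x \<in> coord_space n"
  by (auto simp: single_apply coord_space_def)

lemma image_single_outside:
  assumes "f ` coord_space n \<subseteq> coord_space n" "i < n" "n \<le> j"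
  shows "f (single i x) j = 0"
proof -
  have "f (single i x) \<in> coord_space n" using assms(1,2) by (simp add: image_subset_iff)
  then show ?thesis using assms(3) by (simp add: coord_space_def)
qed

lemma scalar_mapI:
  fixes f :: "(nat \<Rightarrow> 'a::field) \<Rightarrow> nat \<Rightarrow> 'a"
  assumes lin: "linear_on C (coord_space n) f" and im: "f ` coord_space n \<subseteq> coord_space n" and n: "0 < n"
    and diagonal: "\<And>i x. i < n \<Longrightarrow> f (single i x) i = \<phi> x"
    and off_diagonal: "\<And>i j x. i < n \<Longrightarrow> j < n \<Longrightarrow> i \<noteq> j \<Longrightarrow> f (single i x) j = 0"
    and T: "\<And>x. \<phi> (T * x) = S * \<phi> x"
  shows "scalar_map C n T S f"
  unfolding scalar_map_def
proof (intro exI[of _ \<phi>] conjI ballI allI)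
  have f: "f (single i x) = single i (\<phi> x)" if i: "i < n" for i x
  proof
    show "f (single i x) j = single i (\<phi> x) j" for j
      using diagonal[OF i] off_diagonal[OF i, of j] image_single_outside[OF im i, of j]
      by (cases "j < n") (auto simp: single_apply)
  qed
  have phi: "\<phi> x = f (single 0 x) 0" for x using diagonal[OF n] by simp
  show add: "\<phi> (x + y) = \<phi> x + \<phi> y" for x y
  proof -
    have "single 0 (x + y) = single 0 x + single 0 y" by (auto simp: single_apply fun_eq_iff)
    then show ?thesis using linear_on_add[OF lin, of "single 0 x" "single 0 y"] n by (simp add: phi)
  qed
  have "single 0 (0 :: 'a) = 0" by (simp add: single_def fun_eq_iff)
  then have phi0: "\<phi> 0 = 0" using linear_on_0[OF lin subspace_coord_space] by (simp add: phi)
  show "\<phi> (c * x) = c * \<phi> x" if "c \<in> C" for c x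
  proof -
    have "single 0 (c * x) = scl c (single 0 x)" by (auto simp: single_apply fun_eq_iff scl_apply)
    then show ?thesis using linear_on_scl[OF lin that, of "single 0 x"] n by (simp add: phi scl_apply)
  qed
  show "\<phi> (T * x) = S * \<phi> x" for x by (rule T)
  fix w :: "nat \<Rightarrow> 'a" assume w: "w \<in> coord_space n"
  define cut where "cut m = (\<lambda>i. if i < m then w i else 0)" for m
  have "f (cut m) = (\<lambda>i. \<phi> (cut m i))" if "m \<le> n" for m
    using that
  proof (induction m)
    case 0
    have "cut 0 = single 0 0" by (auto simp: cut_def single_apply fun_eq_iff)
    then show "f (cut 0) = (\<lambda>i. \<phi> (cut 0 i))"
      using f[OF n, of 0] phi0 by (auto simp: single_apply)
  next
    case (Suc m)
    have "cut (Suc m) = cut m + single m (w m)" by (auto simp: cut_def single_apply fun_eq_iff)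
    moreover have "cut m \<in> coord_space n" using Suc by (auto simp: cut_def coord_space_def)
    ultimately have "f (cut (Suc m)) = f (cut m) + f (single m (w m))"
      using linear_on_add[OF lin, of "cut m" "single m (w m)"] Suc by simp
    then show ?case using Suc f[of m "w m"] phi0 by (auto simp: cut_def single_apply fun_eq_iff)
  qed
  from this[of n] show "f w = (\<lambda>i. \<phi> (w i))"
  proof -
    have "cut n = w" using w by (auto simp: cut_def coord_space_def fun_eq_iff)
    then show ?thesis using \<open>n \<le> n \<Longrightarrow> f (cut n) = (\<lambda>i. \<phi> (cut n i))\<close> by simp
  qed
qed

definition cut_out :: "nat \<Rightarrow> ('a \<Rightarrow> (nat \<Rightarrow> 'a) \<Rightarrow> bool) \<Rightarrow> 'a::field subspaces"
  where "cut_out n P = (\<lambda>T. {w \<in> coord_space n. P T w})"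

lemma preserves_single:
  assumes "preserves f T S (cut_out n P)" "i < n" "P T (single i x)"
  shows "P S (f (single i x))"
  using assms by (auto simp: preserves_def cut_out_def)

lemma preserves_single_pair:
  assumes "preserves f T S (cut_out n P)" "linear_on C (coord_space n) f" "i < n" "j < n"
    "P T (single i x + single j y)"
  shows "P S (f (single i x) + f (single j y))"
proof -
  have "single i x + single j y \<in> coord_space n"
    using assms(3,4) by (simp add: vec.subspace_add[OF subspace_coord_space])
  then have "P S (f (single i x + single j y))"
    using assms(1,5) by (auto simp: preserves_def cut_out_def)
  then show ?thesis using linear_on_add[OF assms(2)] assms(3,4) by simp
qed

lemma less_numeral_cases:
  fixes i :: nat
  shows "i < 2 \<longleftrightarrow> i = 0 \<or> i = 1" "i < 3 \<longleftrightarrow> i = 0 \<or> i = 1 \<or> i = 2"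
    "i < 4 \<longleftrightarrow> i = 0 \<or> i = 1 \<or> i = 2 \<or> i = 3" "i < 6 \<longleftrightarrow> i = 0 \<or> i = 1 \<or> i = 2 \<or> i = 3 \<or> i = 4 \<or> i = 5"
  by linarith+

text \<open>
  Four lines in the plane, of which the last one has slope \<open>T\<close>: the parameter is the cross ratio. The
  first two lines make \<open>f\<close> diagonal, the third one makes the diagonal entries equal.
\<close>

definition d4_L1 :: "'a::field subspaces" where "d4_L1 = cut_out 2 (\<lambda>T w. w 1 = 0)"
definition d4_L2 :: "'a::field subspaces" where "d4_L2 = cut_out 2 (\<lambda>T w. w 0 = 0)"
definition d4_L3 :: "'a::field subspaces" where "d4_L3 = cut_out 2 (\<lambda>T w. w 0 = w 1)"
definition d4_L4 :: "'a::field subspaces" where "d4_L4 = cut_out 2 (\<lambda>T w. w 1 = T * w 0)"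

lemmas d4_defs = d4_L1_def d4_L2_def d4_L3_def d4_L4_def

lemma d4_rigid: "scalar_rigid C 2 {d4_L1, d4_L2, d4_L3, d4_L4}"
  unfolding scalar_rigid_def
proof (intro allI impI)
  fix T S :: 'a and f
  assume lin: "linear_on C (coord_space 2) f" and im: "f ` coord_space 2 \<subseteq> coord_space 2"
    and "\<forall>H\<in>{d4_L1, d4_L2, d4_L3, d4_L4}. preserves f T S H"
  then have pres: "preserves f T S d4_L1" "preserves f T S d4_L2" "preserves f T S d4_L3" "preserves f T S d4_L4"
    by simp_all
  note pres = pres[unfolded d4_defs]
  have c: "f (single 0 x) 1 = 0" "f (single 1 x) 0 = 0" for x
    using preserves_single[OF pres(1), of 0 x] preserves_single[OF pres(2), of 1 x]
    by (simp_all add: single_apply)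
  have 3: "f (single 0 x) 0 = f (single 1 x) 1" for x
    using preserves_single_pair[OF pres(3) lin, of 0 1 x x] c by (simp add: single_apply)
  have 4: "f (single 1 (T * x)) 1 = S * f (single 0 x) 0" for x
    using preserves_single_pair[OF pres(4) lin, of 0 1 x "T * x"] c by (simp add: single_apply)
  define \<phi> where "\<phi> x = f (single 0 x) 0" for x
  have d: "f (single 1 x) 1 = \<phi> x" for x using 3 by (simp add: \<phi>_def)
  have "\<phi> (T * x) = S * \<phi> x" for x using 4[of x] d by (simp add: \<phi>_def)
  moreover have "f (single i x) i = \<phi> x" if "i < 2" for i x
    using that by (auto simp: less_numeral_cases c d \<phi>_def simp del: One_nat_def)
  moreover have "f (single i x) j = 0" if "i < 2" "j < 2" "i \<noteq> j" for i j x
    using that by (auto simp: less_numeral_cases c d simp del: One_nat_def)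
  ultimately show "scalar_map C 2 T S f" by (intro scalar_mapI[OF lin im]) simp_all
qed

text \<open>
  The sides of a triangle in the projective plane with a point on each side. Preserving the sides, \<open>f\<close>
  preserves the vertices and so is diagonal; each point compares two of the diagonal entries, the last
  one with the factor \<open>T\<close>.
\<close>

definition e6_P0 :: "'a::field subspaces" where "e6_P0 = cut_out 3 (\<lambda>T w. w 0 = 0)"
definition e6_P1 :: "'a::field subspaces" where "e6_P1 = cut_out 3 (\<lambda>T w. w 1 = 0)"
definition e6_P2 :: "'a::field subspaces" where "e6_P2 = cut_out 3 (\<lambda>T w. w 2 = 0)"
definition e6_L0 :: "'a::field subspaces" where "e6_L0 = cut_out 3 (\<lambda>T w. w 0 = 0 \<and> w 1 = w 2)"
definition e6_L1 :: "'a::field subspaces" where "e6_L1 = cut_out 3 (\<lambda>T w. w 1 = 0 \<and> w 2 = w 0)"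
definition e6_L2 :: "'a::field subspaces" where "e6_L2 = cut_out 3 (\<lambda>T w. w 2 = 0 \<and> w 1 = T * w 0)"

lemmas e6_defs = e6_P0_def e6_P1_def e6_P2_def e6_L0_def e6_L1_def e6_L2_def

lemma e6_rigid: "scalar_rigid C 3 {e6_P0, e6_P1, e6_P2, e6_L0, e6_L1, e6_L2}"
  unfolding scalar_rigid_def
proof (intro allI impI)
  fix T S :: 'a and f
  assume lin: "linear_on C (coord_space 3) f" and im: "f ` coord_space 3 \<subseteq> coord_space 3"
    and "\<forall>H\<in>{e6_P0, e6_P1, e6_P2, e6_L0, e6_L1, e6_L2}. preserves f T S H"
  then have pres: "preserves f T S e6_P0" "preserves f T S e6_P1" "preserves f T S e6_P2"
    "preserves f T S e6_L0" "preserves f T S e6_L1" "preserves f T S e6_L2" by simp_all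
  note pres = pres[unfolded e6_defs]
  have c: "f (single 0 x) 1 = 0" "f (single 0 x) 2 = 0" "f (single 1 x) 0 = 0" "f (single 1 x) 2 = 0"
    "f (single 2 x) 0 = 0" "f (single 2 x) 1 = 0" for x
    using preserves_single[OF pres(2), of 0 x] preserves_single[OF pres(3), of 0 x]
      preserves_single[OF pres(1), of 1 x] preserves_single[OF pres(3), of 1 x]
      preserves_single[OF pres(1), of 2 x] preserves_single[OF pres(2), of 2 x]
    by (simp_all add: single_apply)
  define \<phi> where "\<phi> x = f (single 0 x) 0" for x
  have d2: "f (single 2 x) 2 = \<phi> x" for x
    using preserves_single_pair[OF pres(5) lin, of 2 0 x x] c by (simp add: single_apply \<phi>_def)
  have d1: "f (single 1 x) 1 = \<phi> x" for x
    using preserves_single_pair[OF pres(4) lin, of 1 2 x x] c d2 by (simp add: single_apply)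
  have "\<phi> (T * x) = S * \<phi> x" for x
    using preserves_single_pair[OF pres(6) lin, of 0 1 x "T * x"] c d1 by (simp add: single_apply \<phi>_def)
  moreover have "f (single i x) i = \<phi> x" if "i < 3" for i x
    using that by (auto simp: less_numeral_cases c d1 d2 \<phi>_def simp del: One_nat_def)
  moreover have "f (single i x) j = 0" if "i < 3" "j < 3" "i \<noteq> j" for i j x
    using that by (auto simp: less_numeral_cases c d1 d2 simp del: One_nat_def)
  ultimately show "scalar_map C 3 T S f" by (intro scalar_mapI[OF lin im]) simp_all
qed

text \<open>
  Two opposite coordinate flags, which make \<open>f\<close> diagonal, and a plane \<open>Z\<close>, the graph of the matrix
  with rows \<open>(1, 1)\<close> and \<open>(1, T)\<close>; each of its entries compares two of the diagonal entries of \<open>f\<close>.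
\<close>

definition e7_F1 :: "'a::field subspaces" where "e7_F1 = cut_out 4 (\<lambda>T w. w 1 = 0 \<and> w 2 = 0 \<and> w 3 = 0)"
definition e7_F2 :: "'a::field subspaces" where "e7_F2 = cut_out 4 (\<lambda>T w. w 2 = 0 \<and> w 3 = 0)"
definition e7_F3 :: "'a::field subspaces" where "e7_F3 = cut_out 4 (\<lambda>T w. w 3 = 0)"
definition e7_G1 :: "'a::field subspaces" where "e7_G1 = cut_out 4 (\<lambda>T w. w 0 = 0 \<and> w 1 = 0 \<and> w 2 = 0)"
definition e7_G2 :: "'a::field subspaces" where "e7_G2 = cut_out 4 (\<lambda>T w. w 0 = 0 \<and> w 1 = 0)"
definition e7_G3 :: "'a::field subspaces" where "e7_G3 = cut_out 4 (\<lambda>T w. w 0 = 0)"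
definition e7_Z :: "'a::field subspaces" where "e7_Z = cut_out 4 (\<lambda>T w. w 2 = w 0 + w 1 \<and> w 3 = w 0 + T * w 1)"

lemmas e7_defs = e7_F1_def e7_F2_def e7_F3_def e7_G1_def e7_G2_def e7_G3_def e7_Z_def

lemma e7_rigid: "scalar_rigid C 4 {e7_F1, e7_F2, e7_F3, e7_G1, e7_G2, e7_G3, e7_Z}"
  unfolding scalar_rigid_def
proof (intro allI impI)
  fix T S :: 'a and f
  assume lin: "linear_on C (coord_space 4) f" and im: "f ` coord_space 4 \<subseteq> coord_space 4"
    and "\<forall>H\<in>{e7_F1, e7_F2, e7_F3, e7_G1, e7_G2, e7_G3, e7_Z}. preserves f T S H"
  then have pres: "preserves f T S e7_F1" "preserves f T S e7_F2" "preserves f T S e7_F3"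
    "preserves f T S e7_G1" "preserves f T S e7_G2" "preserves f T S e7_G3"
    and Z: "preserves f T S e7_Z" by simp_all
  note pres = pres[unfolded e7_defs]
  have c: "f (single 0 x) 1 = 0" "f (single 0 x) 2 = 0" "f (single 0 x) 3 = 0"
    "f (single 1 x) 0 = 0" "f (single 1 x) 2 = 0" "f (single 1 x) 3 = 0"
    "f (single 2 x) 0 = 0" "f (single 2 x) 1 = 0" "f (single 2 x) 3 = 0"
    "f (single 3 x) 0 = 0" "f (single 3 x) 1 = 0" "f (single 3 x) 2 = 0" for x
    using preserves_single[OF pres(1), of 0 x] preserves_single[OF pres(2), of 1 x]
      preserves_single[OF pres(6), of 1 x] preserves_single[OF pres(3), of 2 x]
      preserves_single[OF pres(5), of 2 x] preserves_single[OF pres(4), of 3 x]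
    by (simp_all add: single_apply)
  have 0: "f (single i x) 2 + f (single 2 y) 2 = f (single i x) 0 + f (single i x) 1"
      "f (single 3 y') 3 + f (single i x) 3 = f (single i x) 0 + S * f (single i x) 1"
    if "i < 2" "single i x + (single 2 y + single 3 y') \<in> e7_Z T" for i x y y'
  proof -
    have "f (single 2 y + single 3 y') = f (single 2 y) + f (single 3 y')"
      by (rule linear_on_add[OF lin]) simp_all
    moreover have "f (single i x + (single 2 y + single 3 y')) = f (single i x) + f (single 2 y + single 3 y')"
      using that(1) by (intro linear_on_add[OF lin] vec.subspace_add[OF subspace_coord_space]) simp_all
    moreover have "f (single i x + (single 2 y + single 3 y')) \<in> e7_Z S"
      using Z that(2) unfolding preserves_def by blast
    ultimately have "f (single i x) + (f (single 2 y) + f (single 3 y')) \<in> e7_Z S" by simp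
    then show "f (single i x) 2 + f (single 2 y) 2 = f (single i x) 0 + f (single i x) 1"
      "f (single 3 y') 3 + f (single i x) 3 = f (single i x) 0 + S * f (single i x) 1"
      using c by (simp_all add: e7_Z_def cut_out_def add.commute)
  qed
  have Z0: "single 0 x + (single 2 x + single 3 x) \<in> e7_Z T"
    "single 1 x + (single 2 x + single 3 (T * x)) \<in> e7_Z T" for x
    by (auto simp: e7_Z_def cut_out_def single_apply coord_space_def)
  define \<phi> where "\<phi> x = f (single 0 x) 0" for x
  have d2: "f (single 2 x) 2 = \<phi> x" for x using 0(1)[OF _ Z0(1), of x] c by (simp add: \<phi>_def)
  have d3: "f (single 3 x) 3 = \<phi> x" for x using 0(2)[OF _ Z0(1), of x] c by (simp add: \<phi>_def)
  have d1: "f (single 1 x) 1 = \<phi> x" for x using 0(1)[OF _ Z0(2), of x] c d2 by simp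
  have "\<phi> (T * x) = S * \<phi> x" for x using 0(2)[OF _ Z0(2), of x] c d1 d3 by simp
  moreover have "f (single i x) i = \<phi> x" if "i < 4" for i x
    using that by (auto simp: less_numeral_cases c d1 d2 d3 \<phi>_def simp del: One_nat_def)
  moreover have "f (single i x) j = 0" if "i < 4" "j < 4" "i \<noteq> j" for i j x
    using that by (auto simp: less_numeral_cases c d1 d2 d3 simp del: One_nat_def)
  ultimately show "scalar_map C 4 T S f" by (intro scalar_mapI[OF lin im]) simp_all
qed

text \<open>
  The coordinates are arranged in a hexagon. The flags \<open>F\<close> and \<open>G\<close> split \<open>W\<close> into the three planes
  \<open>F\<^sub>2\<close>, \<open>F\<^sub>4 \<inter> G\<^sub>4\<close>, \<open>G\<^sub>2\<close> of the coordinate pairs \<open>01\<close>, \<open>23\<close>, \<open>45\<close>. The space \<open>Z\<close> meets the sum of any two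
  of these planes in a line, and these three lines couple the coordinates \<open>12\<close>, \<open>34\<close>, \<open>50\<close>; so \<open>f\<close> is
  diagonal and its entries within each of these pairs are equal. The odd members of the flag \<open>F\<close>
  single out a line in each of the three planes and thus compare the entries at \<open>01\<close>, \<open>23\<close>, and, with
  the factor \<open>T\<close>, \<open>45\<close>.
\<close>

definition e8_F1 :: "'a::field subspaces" where "e8_F1 = cut_out 6 (\<lambda>T w. w 0 = w 1 \<and> w 2 = 0 \<and> w 3 = 0 \<and> w 4 = 0 \<and> w 5 = 0)"
definition e8_F2 :: "'a::field subspaces" where "e8_F2 = cut_out 6 (\<lambda>T w. w 2 = 0 \<and> w 3 = 0 \<and> w 4 = 0 \<and> w 5 = 0)"
definition e8_F3 :: "'a::field subspaces" where "e8_F3 = cut_out 6 (\<lambda>T w. w 2 = w 3 \<and> w 4 = 0 \<and> w 5 = 0)"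
definition e8_F4 :: "'a::field subspaces" where "e8_F4 = cut_out 6 (\<lambda>T w. w 4 = 0 \<and> w 5 = 0)"
definition e8_F5 :: "'a::field subspaces" where "e8_F5 = cut_out 6 (\<lambda>T w. w 5 = T * w 4)"
definition e8_G2 :: "'a::field subspaces" where "e8_G2 = cut_out 6 (\<lambda>T w. w 0 = 0 \<and> w 1 = 0 \<and> w 2 = 0 \<and> w 3 = 0)"
definition e8_G4 :: "'a::field subspaces" where "e8_G4 = cut_out 6 (\<lambda>T w. w 0 = 0 \<and> w 1 = 0)"
definition e8_Z :: "'a::field subspaces" where "e8_Z = cut_out 6 (\<lambda>T w. w 1 = w 2 \<and> w 3 = w 4 \<and> w 5 = w 0)"

lemmas e8_defs = e8_F1_def e8_F2_def e8_F3_def e8_F4_def e8_F5_def e8_G2_def e8_G4_def e8_Z_def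

lemma e8_rigid: "scalar_rigid C 6 {e8_F1, e8_F2, e8_F3, e8_F4, e8_F5, e8_G2, e8_G4, e8_Z}"
  unfolding scalar_rigid_def
proof (intro allI impI)
  fix T S :: 'a and f
  assume lin: "linear_on C (coord_space 6) f" and im: "f ` coord_space 6 \<subseteq> coord_space 6"
    and "\<forall>H\<in>{e8_F1, e8_F2, e8_F3, e8_F4, e8_F5, e8_G2, e8_G4, e8_Z}. preserves f T S H"
  then have pres: "preserves f T S e8_F1" "preserves f T S e8_F2" "preserves f T S e8_F3"
    "preserves f T S e8_F4" "preserves f T S e8_F5" "preserves f T S e8_G2" "preserves f T S e8_G4"
    "preserves f T S e8_Z" by simp_all
  note pres = pres[unfolded e8_defs]
  have c: "f (single 0 x) 2 = 0" "f (single 0 x) 3 = 0" "f (single 0 x) 4 = 0" "f (single 0 x) 5 = 0"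
    "f (single 1 x) 2 = 0" "f (single 1 x) 3 = 0" "f (single 1 x) 4 = 0" "f (single 1 x) 5 = 0" for x
    using preserves_single[OF pres(2), of 0 x] preserves_single[OF pres(2), of 1 x]
    by (simp_all add: single_apply)
  have c': "f (single 2 x) 0 = 0" "f (single 2 x) 1 = 0" "f (single 2 x) 4 = 0" "f (single 2 x) 5 = 0"
    "f (single 3 x) 0 = 0" "f (single 3 x) 1 = 0" "f (single 3 x) 4 = 0" "f (single 3 x) 5 = 0" for x
    using preserves_single[OF pres(4), of 2 x] preserves_single[OF pres(4), of 3 x]
      preserves_single[OF pres(7), of 2 x] preserves_single[OF pres(7), of 3 x]
    by (simp_all add: single_apply)
  have c'': "f (single 4 x) 0 = 0" "f (single 4 x) 1 = 0" "f (single 4 x) 2 = 0" "f (single 4 x) 3 = 0"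
    "f (single 5 x) 0 = 0" "f (single 5 x) 1 = 0" "f (single 5 x) 2 = 0" "f (single 5 x) 3 = 0" for x
    using preserves_single[OF pres(6), of 4 x] preserves_single[OF pres(6), of 5 x]
    by (simp_all add: single_apply)
  note pair = preserves_single_pair[OF _ lin]
  define \<phi> where "\<phi> x = f (single 0 x) 0" for x
  have Z1: "f (single 1 x) 1 = f (single 2 x) 2" "f (single 2 x) 3 = 0" "f (single 1 x) 0 = 0" for x
    using pair[OF pres(8), of 1 2 x x] by (simp_all add: single_apply c c' del: One_nat_def)
  have Z2: "f (single 3 x) 3 = f (single 4 x) 4" "f (single 3 x) 2 = 0" "f (single 4 x) 5 = 0" for x
    using pair[OF pres(8), of 3 4 x x] by (simp_all add: single_apply c' c'' del: One_nat_def)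
  have Z3: "f (single 5 x) 5 = \<phi> x" "f (single 0 x) 1 = 0" "f (single 5 x) 4 = 0" for x
    using pair[OF pres(8), of 5 0 x x] by (simp_all add: single_apply c c'' \<phi>_def del: One_nat_def)
  have d1: "f (single 1 x) 1 = \<phi> x" for x
    using pair[OF pres(1), of 0 1 x x] by (simp add: single_apply c Z1(3) Z3(2) \<phi>_def del: One_nat_def)
  have d2: "f (single 2 x) 2 = \<phi> x" for x using Z1(1) d1 by simp
  have d3: "f (single 3 x) 3 = \<phi> x" for x
    using pair[OF pres(3), of 2 3 x x] by (simp add: single_apply c' Z1(2) Z2(2) d2 del: One_nat_def)
  have d4: "f (single 4 x) 4 = \<phi> x" for x using Z2(1) d3 by simp
  have "\<phi> (T * x) = S * \<phi> x" for x
    using pair[OF pres(5), of 4 5 x "T * x"] by (simp add: single_apply Z2(3) Z3(1,3) d4)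
  moreover have "f (single i x) i = \<phi> x" if "i < 6" for i x
    using that by (auto simp: less_numeral_cases c c' c'' Z1(2,3) Z2(2,3) Z3 d1 d2 d3 d4 \<phi>_def simp del: One_nat_def)
  moreover have "f (single i x) j = 0" if "i < 6" "j < 6" "i \<noteq> j" for i j x
    using that by (auto simp: less_numeral_cases c c' c'' Z1(2,3) Z2(2,3) Z3 d1 d2 d3 d4 simp del: One_nat_def)
  ultimately show "scalar_map C 6 T S f" by (intro scalar_mapI[OF lin im]) simp_all
qed

lemma scalar_rigid_mono: "scalar_rigid C n M \<Longrightarrow> M \<subseteq> M' \<Longrightarrow> scalar_rigid C n M'"
  by (rule scalar_rigid_derived) auto

definition cap :: "'a::field subspaces \<Rightarrow> 'a subspaces \<Rightarrow> 'a subspaces"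
  where "cap H K = (\<lambda>T. H T \<inter> K T)"

text \<open>
  The sums of two members of the configuration, in terms of equations.
\<close>

definition e8_G2F1 :: "'a::field subspaces" where "e8_G2F1 = cut_out 6 (\<lambda>T w. w 0 = w 1 \<and> w 2 = 0 \<and> w 3 = 0)"
definition e8_G4F1 :: "'a::field subspaces" where "e8_G4F1 = cut_out 6 (\<lambda>T w. w 0 = w 1)"
definition e8_G2F2 :: "'a::field subspaces" where "e8_G2F2 = cut_out 6 (\<lambda>T w. w 2 = 0 \<and> w 3 = 0)"
definition e8_ZF1 :: "'a::field subspaces" where "e8_ZF1 = cut_out 6 (\<lambda>T w. w 3 = w 4 \<and> w 0 + w 2 = w 1 + w 5)"
definition e8_ZG2 :: "'a::field subspaces" where "e8_ZG2 = cut_out 6 (\<lambda>T w. w 1 = w 2)"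
lemmas e8_sum_defs = e8_G2F1_def e8_G4F1_def e8_G2F2_def e8_ZF1_def e8_ZG2_def

lemma cut_out_le_space [simp]: "cut_out n P \<le> (\<lambda>_. coord_space n)"
  by (auto simp: cut_out_def le_fun_def)

lemma zero_le_cut_out: "(\<And>T. P T 0) \<Longrightarrow> (\<lambda>_. {0}) \<le> cut_out n P"
  by (auto simp: cut_out_def le_fun_def coord_space_def)

lemma zero_le_space [simp]: "(\<lambda>_. {0}) \<le> (\<lambda>_. coord_space n)"
  by (auto simp: le_fun_def coord_space_def)

lemma cut_out_mono: "(\<And>T w. P T w \<Longrightarrow> P' T w) \<Longrightarrow> cut_out n P \<le> cut_out n P'"
  by (auto simp: cut_out_def le_fun_def)

lemma subspace_cut_out:
  assumes "P T 0" "\<And>v w. P T v \<Longrightarrow> P T w \<Longrightarrow> P T (v + w)" "\<And>c v. P T v \<Longrightarrow> P T (scl c v)"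
  shows "vec.subspace (cut_out n P T)"
  using assms by (auto simp: vec.subspace_def cut_out_def coord_space_def scl_apply)

lemma d4_subspace [simp]: "vec.subspace (d4_L1 T)" "vec.subspace (d4_L2 T)" "vec.subspace (d4_L3 T)" "vec.subspace (d4_L4 T)"
  unfolding d4_defs by (rule subspace_cut_out; simp add: scl_apply algebra_simps)+

lemma d4_bounds [simp]: "(\<lambda>_. {0}) \<le> d4_L1" "(\<lambda>_. {0}) \<le> d4_L2" "(\<lambda>_. {0}) \<le> d4_L3" "(\<lambda>_. {0}) \<le> d4_L4"
  "d4_L1 \<le> (\<lambda>_. coord_space 2)" "d4_L2 \<le> (\<lambda>_. coord_space 2)" "d4_L3 \<le> (\<lambda>_. coord_space 2)"
  "d4_L4 \<le> (\<lambda>_. coord_space 2)"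
  unfolding d4_defs by (simp_all add: zero_le_cut_out)

lemma e6_subspace [simp]: "vec.subspace (e6_P0 T)" "vec.subspace (e6_P1 T)" "vec.subspace (e6_P2 T)"
  "vec.subspace (e6_L0 T)" "vec.subspace (e6_L1 T)" "vec.subspace (e6_L2 T)"
  unfolding e6_defs by (rule subspace_cut_out; simp add: scl_apply algebra_simps)+

lemma e6_bounds [simp]: "(\<lambda>_. {0}) \<le> e6_P0" "(\<lambda>_. {0}) \<le> e6_P1" "(\<lambda>_. {0}) \<le> e6_P2"
  "(\<lambda>_. {0}) \<le> e6_L0" "(\<lambda>_. {0}) \<le> e6_L1" "(\<lambda>_. {0}) \<le> e6_L2"
  "e6_L0 \<le> e6_P0" "e6_L1 \<le> e6_P1" "e6_L2 \<le> e6_P2"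
  "e6_P0 \<le> (\<lambda>_. coord_space 3)" "e6_P1 \<le> (\<lambda>_. coord_space 3)" "e6_P2 \<le> (\<lambda>_. coord_space 3)"
  "e6_L0 \<le> (\<lambda>_. coord_space 3)" "e6_L1 \<le> (\<lambda>_. coord_space 3)" "e6_L2 \<le> (\<lambda>_. coord_space 3)"
  unfolding e6_defs by (rule zero_le_cut_out cut_out_le_space cut_out_mono; simp)+

lemma e7_subspace [simp]: "vec.subspace (e7_F1 T)" "vec.subspace (e7_F2 T)" "vec.subspace (e7_F3 T)"
  "vec.subspace (e7_G1 T)" "vec.subspace (e7_G2 T)" "vec.subspace (e7_G3 T)" "vec.subspace (e7_Z T)"
  unfolding e7_defs by (rule subspace_cut_out; simp add: scl_apply algebra_simps)+

lemma e7_bounds [simp]: "(\<lambda>_. {0}) \<le> e7_F1" "(\<lambda>_. {0}) \<le> e7_F2" "(\<lambda>_. {0}) \<le> e7_F3"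
  "(\<lambda>_. {0}) \<le> e7_G1" "(\<lambda>_. {0}) \<le> e7_G2" "(\<lambda>_. {0}) \<le> e7_G3" "(\<lambda>_. {0}) \<le> e7_Z"
  "e7_F1 \<le> e7_F2" "e7_F1 \<le> e7_F3" "e7_F2 \<le> e7_F3" "e7_G1 \<le> e7_G2" "e7_G1 \<le> e7_G3" "e7_G2 \<le> e7_G3"
  "e7_F1 \<le> (\<lambda>_. coord_space 4)" "e7_F2 \<le> (\<lambda>_. coord_space 4)" "e7_F3 \<le> (\<lambda>_. coord_space 4)"
  "e7_G1 \<le> (\<lambda>_. coord_space 4)" "e7_G2 \<le> (\<lambda>_. coord_space 4)" "e7_G3 \<le> (\<lambda>_. coord_space 4)"
  "e7_Z \<le> (\<lambda>_. coord_space 4)"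
  unfolding e7_defs by (rule zero_le_cut_out cut_out_le_space cut_out_mono; simp)+

lemma e8_subspace [simp]: "vec.subspace (e8_F1 T)" "vec.subspace (e8_F2 T)" "vec.subspace (e8_F3 T)"
  "vec.subspace (e8_F4 T)" "vec.subspace (e8_F5 T)" "vec.subspace (e8_G2 T)" "vec.subspace (e8_G4 T)"
  "vec.subspace (e8_Z T)" "vec.subspace (e8_G2F1 T)" "vec.subspace (e8_G4F1 T)" "vec.subspace (e8_G2F2 T)"
  "vec.subspace (e8_ZF1 T)" "vec.subspace (e8_ZG2 T)"
  unfolding e8_defs e8_sum_defs by (rule subspace_cut_out; simp add: scl_apply algebra_simps flip: distrib_left)+

lemma e8_bounds [simp]: "(\<lambda>_. {0}) \<le> e8_F1" "(\<lambda>_. {0}) \<le> e8_F2" "(\<lambda>_. {0}) \<le> e8_F3" "(\<lambda>_. {0}) \<le> e8_F4"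
  "(\<lambda>_. {0}) \<le> e8_F5" "(\<lambda>_. {0}) \<le> e8_G2" "(\<lambda>_. {0}) \<le> e8_G4" "(\<lambda>_. {0}) \<le> e8_Z"
  "e8_F1 \<le> (\<lambda>_. coord_space 6)" "e8_F2 \<le> (\<lambda>_. coord_space 6)" "e8_F3 \<le> (\<lambda>_. coord_space 6)"
  "e8_F4 \<le> (\<lambda>_. coord_space 6)" "e8_F5 \<le> (\<lambda>_. coord_space 6)" "e8_G2 \<le> (\<lambda>_. coord_space 6)"
  "e8_G4 \<le> (\<lambda>_. coord_space 6)" "e8_Z \<le> (\<lambda>_. coord_space 6)"
  "e8_G2F1 \<le> (\<lambda>_. coord_space 6)" "e8_G4F1 \<le> (\<lambda>_. coord_space 6)" "e8_G2F2 \<le> (\<lambda>_. coord_space 6)"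
  "e8_ZF1 \<le> (\<lambda>_. coord_space 6)" "e8_ZG2 \<le> (\<lambda>_. coord_space 6)"
  unfolding e8_defs e8_sum_defs by (rule zero_le_cut_out cut_out_le_space; simp)+

lemma e8_chains [simp]: "e8_F1 \<le> e8_F2" "e8_F1 \<le> e8_F3" "e8_F1 \<le> e8_F4" "e8_F1 \<le> e8_F5"
  "e8_F2 \<le> e8_F3" "e8_F2 \<le> e8_F4" "e8_F2 \<le> e8_F5" "e8_F3 \<le> e8_F4" "e8_F3 \<le> e8_F5" "e8_F4 \<le> e8_F5"
  "e8_G2 \<le> e8_G4" "e8_G2 \<le> e8_G2F1" "e8_F1 \<le> e8_G2F1" "e8_G2F1 \<le> e8_G4F1" "e8_G2F1 \<le> e8_G2F2"
  "e8_G4 \<le> e8_G4F1" "e8_F2 \<le> e8_G2F2" "e8_Z \<le> e8_ZF1" "e8_F1 \<le> e8_ZF1" "e8_Z \<le> e8_ZG2" "e8_G2 \<le> e8_ZG2"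
  unfolding e8_defs e8_sum_defs by (rule cut_out_mono; simp)+

lemma subset_space: "H \<le> (\<lambda>_. coord_space n) \<Longrightarrow> H T \<subseteq> coord_space n"
  by (simp add: le_fun_def)

lemma subspace_cap: "vec.subspace (H T) \<Longrightarrow> vec.subspace (K T) \<Longrightarrow> vec.subspace (cap H K T)"
  by (simp add: cap_def vec.subspace_inter)

lemma preserves_sum:
  assumes lin: "linear_on C (coord_space n) f" and "H \<le> (\<lambda>_. coord_space n)" "K \<le> (\<lambda>_. coord_space n)"
    and "preserves f T S H" "preserves f T S K" "vec.subspace (M S)" "H \<le> M" "K \<le> M"
    and sum: "\<And>v. v \<in> M T \<Longrightarrow> \<exists>u\<in>H T. v - u \<in> K T"
  shows "preserves f T S M"
  unfolding preserves_def
proof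
  fix v assume "v \<in> M T"
  then obtain u where u: "u \<in> H T" "v - u \<in> K T" using sum by auto
  then have "f (u + (v - u)) = f u + f (v - u)"
    using assms(2,3) by (intro linear_on_add[OF lin]) (auto simp: le_fun_def)
  moreover have "f u \<in> M S" "f (v - u) \<in> M S"
    using assms(4,5) u le_funD[OF assms(7), of S] le_funD[OF assms(8), of S] by (auto simp: preserves_def)
  ultimately show "f v \<in> M S" using vec.subspace_add[OF assms(6)] by simp
qed

text \<open>
  In some diagrams not all members of the configuration occur at a vertex, but those missing are sums
  or intersections of subspaces that do occur: \<open>F\<^sub>1 = (G\<^sub>2 + F\<^sub>1) \<inter> F\<^sub>2\<close>, \<open>G\<^sub>2 = (G\<^sub>2 + F\<^sub>1) \<inter> G\<^sub>4\<close>,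
  \<open>F\<^sub>5 = (F\<^sub>5 \<inter> G\<^sub>4) + F\<^sub>4\<close> and \<open>G\<^sub>4 = (F\<^sub>5 \<inter> G\<^sub>4) + G\<^sub>2\<close>.
\<close>

lemma e8_rigid_derived:
  assumes M: "e8_F2 \<in> M" "e8_F3 \<in> M" "e8_F4 \<in> M" "e8_Z \<in> M"
    and F1: "e8_F1 \<in> M \<or> e8_G2F1 \<in> M"
    and F5: "e8_F5 \<in> M \<or> cap e8_F5 e8_G4 \<in> M"
    and G4: "e8_G4 \<in> M \<or> cap e8_F5 e8_G4 \<in> M \<and> e8_G2 \<in> M"
    and G2: "e8_G2 \<in> M \<or> e8_G2F1 \<in> M \<and> e8_G4 \<in> M"
  shows "scalar_rigid C 6 M"
proof (rule scalar_rigid_derived[OF e8_rigid])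
  fix T S :: 'a and f and H :: "'a subspaces"
  assume lin: "linear_on C (coord_space 6) f" and pres: "\<And>H. H \<in> M \<Longrightarrow> preserves f T S H"
    and H: "H \<in> {e8_F1, e8_F2, e8_F3, e8_F4, e8_F5, e8_G2, e8_G4, e8_Z}"
  have Int: "preserves f T S K" if "preserves f T S K1" "preserves f T S K2" "\<And>T. K T = K1 T \<inter> K2 T" for K K1 K2
    using that by (simp add: preserves_def)
  have "e8_F1 T = e8_G2F1 T \<inter> e8_F2 T" for T :: 'a
    by (auto simp: e8_defs e8_sum_defs cut_out_def)
  then have 1: "preserves f T S e8_F1" using F1 Int[OF pres pres, of e8_G2F1 e8_F2] M pres by blast
  have "e8_G2 T = e8_G2F1 T \<inter> e8_G4 T" for T :: 'a
    by (auto simp: e8_defs e8_sum_defs cut_out_def)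
  then have 2: "preserves f T S e8_G2" using G2 Int[OF pres pres, of e8_G2F1 e8_G4] pres by blast
  have le: "cap e8_F5 e8_G4 \<le> (e8_F5 :: 'a subspaces)" "cap e8_F5 e8_G4 \<le> (e8_G4 :: 'a subspaces)"
    by (auto simp: cap_def le_fun_def)
  have le': "cap e8_F5 e8_G4 \<le> (\<lambda>_ :: 'a. coord_space 6)" by (rule order_trans[OF le(1) e8_bounds(13)])
  have 3: "preserves f T S e8_F5"
  proof (cases "e8_F5 \<in> M")
    case False
    show ?thesis
    proof (rule preserves_sum[OF lin _ _ pres pres])
      show "cap e8_F5 e8_G4 \<in> M" "e8_F4 \<in> M" using F5 False M by auto
      fix v assume "v \<in> e8_F5 T"
      then show "\<exists>u\<in>cap e8_F5 e8_G4 T. v - u \<in> e8_F4 T"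
        by (intro bexI[of _ "\<lambda>j. if j < 4 then 0 else v j"])
          (auto simp: e8_defs cut_out_def cap_def coord_space_def)
    qed (use le le' in auto)
  qed (rule pres)
  have 4: "preserves f T S e8_G4"
  proof (cases "e8_G4 \<in> M")
    case False
    show ?thesis
    proof (rule preserves_sum[OF lin _ _ pres pres])
      show "cap e8_F5 e8_G4 \<in> M" "e8_G2 \<in> M" using G4 False by auto
      fix v assume "v \<in> e8_G4 T"
      then show "\<exists>u\<in>cap e8_F5 e8_G4 T. v - u \<in> e8_G2 T"
        by (intro bexI[of _ "\<lambda>j. if j < 4 then v j else 0"])
          (auto simp: e8_defs cut_out_def cap_def coord_space_def)
    qed (use le le' in auto)
  qed (rule pres)
  show "preserves f T S H" using H 1 2 3 4 M pres by blast
qed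

lemma space_neq_zero [simp]: "0 < n \<Longrightarrow> coord_space n \<noteq> {0 :: nat \<Rightarrow> 'a::field}"
proof
  assume n: "0 < n" and "coord_space n = {0 :: nat \<Rightarrow> 'a}"
  then have "single 0 1 = (0 :: nat \<Rightarrow> 'a)" using single_in_coord_space[OF n, of 1] by blast
  then have "single 0 1 0 = (0 :: 'a)" by simp
  then show False by (simp add: single_apply)
qed

section \<open>Diagrams with arms\<close>

text \<open>
  The last condition keeps the modules from being zero.
\<close>

definition scalar_model :: "'a::field set \<Rightarrow> 'v set \<Rightarrow> ('v \<times> 'v) set \<Rightarrow> bool"
  where "scalar_model C V A \<longleftrightarrow> (\<exists>n X Y. full_rep C n V A X Y \<and> scalar_rigid C n (X ` V \<union> Y ` V) \<and>
    (\<exists>x\<in>V. \<forall>T. X x T \<noteq> Y x T))"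

lemma full_rep_arms:
  assumes "full_rep C n V A X Y"
    and "\<And>b as Hs. (b, as, Hs) \<in> set arms \<Longrightarrow> b \<in> V \<and> length Hs = length as \<and>
      sorted_wrt (\<le>) (Y b # Hs @ [X b]) \<and> (\<forall>H\<in>set Hs. \<forall>T. vec.subspace (H T))"
    and "distinct (concat (map (fst \<circ> snd) arms))" "set (concat (map (fst \<circ> snd) arms)) \<inter> V = {}"
  shows "\<exists>X' Y'. full_rep C n (V \<union> \<Union> ((\<lambda>(b, as, Hs). set as) ` set arms))
      (A \<union> orient s (\<Union> ((\<lambda>(b, as, Hs). chain_edges (b # as)) ` set arms))) X' Y' \<and>
    (\<forall>x\<in>V. X' x = X x \<and> Y' x = Y x) \<and>
    (\<forall>(b, as, Hs)\<in>set arms. set Hs \<subseteq> X' ` (V \<union> \<Union> ((\<lambda>(b, as, Hs). set as) ` set arms)) \<union>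
       Y' ` (V \<union> \<Union> ((\<lambda>(b, as, Hs). set as) ` set arms)))"
  using assms
proof (induction arms arbitrary: V A X Y)
  case Nil
  then show ?case by (auto simp: orient_def)
next
  case (Cons arm arms)
  obtain b as Hs where arm: "arm = (b, as, Hs)" by (cases arm) auto
  let ?U = "\<Union> ((\<lambda>(b, as, Hs). set as) ` set arms)"
    and ?E = "\<Union> ((\<lambda>(b, as, Hs). chain_edges (b # as)) ` set arms)"
  have "\<exists>X' Y'. full_rep C n (V \<union> set as) (A \<union> orient s (chain_edges (b # as))) X' Y' \<and>
    (\<forall>x\<in>V. X' x = X x \<and> Y' x = Y x) \<and> set Hs \<subseteq> X' ` (V \<union> set as) \<union> Y' ` (V \<union> set as)"
    using Cons.prems(2)[of b as Hs] Cons.prems(3,4) arm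
    by (intro full_rep_arm[OF Cons.prems(1)]) auto
  then obtain X1 Y1 where 1: "full_rep C n (V \<union> set as) (A \<union> orient s (chain_edges (b # as))) X1 Y1"
    "\<forall>x\<in>V. X1 x = X x \<and> Y1 x = Y x" "set Hs \<subseteq> X1 ` (V \<union> set as) \<union> Y1 ` (V \<union> set as)" by blast
  have arms: "b' \<in> V \<union> set as \<and> length Hs' = length as' \<and> sorted_wrt (\<le>) (Y1 b' # Hs' @ [X1 b']) \<and>
      (\<forall>H\<in>set Hs'. \<forall>T. vec.subspace (H T))" if "(b', as', Hs') \<in> set arms" for b' as' Hs'
  proof -
    have *: "b' \<in> V \<and> length Hs' = length as' \<and> sorted_wrt (\<le>) (Y b' # Hs' @ [X b']) \<and>
      (\<forall>H\<in>set Hs'. \<forall>T. vec.subspace (H T))"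
      by (rule Cons.prems(2)) (use that in simp)
    then have "X1 b' = X b'" "Y1 b' = Y b'" using 1(2) by auto
    then show ?thesis using * by simp
  qed
  have dist: "distinct (concat (map (fst \<circ> snd) arms))"
    and disj: "set (concat (map (fst \<circ> snd) arms)) \<inter> (V \<union> set as) = {}"
    using Cons.prems(3,4) arm by (auto simp: comp_def)
  obtain X2 Y2 where 2:
    "full_rep C n ((V \<union> set as) \<union> ?U) ((A \<union> orient s (chain_edges (b # as))) \<union> orient s ?E) X2 Y2"
    "\<forall>x\<in>V \<union> set as. X2 x = X1 x \<and> Y2 x = Y1 x"
    "\<forall>(b, as', Hs)\<in>set arms. set Hs \<subseteq> X2 ` ((V \<union> set as) \<union> ?U) \<union> Y2 ` ((V \<union> set as) \<union> ?U)"
    using Cons.IH[OF 1(1) arms dist disj] by blast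
  have V: "V \<union> \<Union> ((\<lambda>(b, as, Hs). set as) ` set (arm # arms)) = (V \<union> set as) \<union> ?U"
    using arm by auto
  have E: "A \<union> orient s (\<Union> ((\<lambda>(b, as, Hs). chain_edges (b # as)) ` set (arm # arms))) =
    (A \<union> orient s (chain_edges (b # as))) \<union> orient s ?E"
    using arm by (auto simp: orient_def)
  have "X1 ` (V \<union> set as) = X2 ` (V \<union> set as)" "Y1 ` (V \<union> set as) = Y2 ` (V \<union> set as)"
    using 2(2) by (auto intro!: image_cong)
  then have "set Hs \<subseteq> X2 ` ((V \<union> set as) \<union> ?U) \<union> Y2 ` ((V \<union> set as) \<union> ?U)"
    using 1(3) by (auto simp: image_Un)
  then have "\<forall>(b, as', Hs)\<in>set (arm # arms).
      set Hs \<subseteq> X2 ` ((V \<union> set as) \<union> ?U) \<union> Y2 ` ((V \<union> set as) \<union> ?U)"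
    using 2(3) arm by simp
  then show ?case
    unfolding V E using 2(1,2) 1(2) by (intro exI[of _ X2] exI[of _ Y2]) auto
qed

lemma scalar_model_arms:
  assumes core: "full_rep C n V A X Y"
    and arms: "\<And>b as Hs. (b, as, Hs) \<in> set arms \<Longrightarrow> b \<in> V \<and> length Hs = length as \<and>
      sorted_wrt (\<le>) (Y b # Hs @ [X b]) \<and> (\<forall>H\<in>set Hs. \<forall>T. vec.subspace (H T))"
    and dist: "distinct (concat (map (fst \<circ> snd) arms))" "set (concat (map (fst \<circ> snd) arms)) \<inter> V = {}"
    and rigid: "scalar_rigid C n (X ` V \<union> Y ` V \<union> \<Union> ((\<lambda>(b, as, Hs). set Hs) ` set arms))"
    and ne: "\<exists>x\<in>V. \<forall>T. X x T \<noteq> Y x T"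
    and V': "V' = V \<union> \<Union> ((\<lambda>(b, as, Hs). set as) ` set arms)"
    and A': "A' = A \<union> orient s (\<Union> ((\<lambda>(b, as, Hs). chain_edges (b # as)) ` set arms))"
  shows "scalar_model C V' A'"
proof -
  obtain X' Y' where *: "full_rep C n V' A' X' Y'" "\<forall>x\<in>V. X' x = X x \<and> Y' x = Y x"
    "\<forall>(b, as, Hs)\<in>set arms. set Hs \<subseteq> X' ` V' \<union> Y' ` V'"
    using full_rep_arms[OF core arms dist, of s] unfolding V'[symmetric] A'[symmetric] by blast
  have sub: "X ` V \<union> Y ` V \<union> \<Union> ((\<lambda>(b, as, Hs). set Hs) ` set arms) \<subseteq> X' ` V' \<union> Y' ` V'"
  proof -
    have "X ` V = X' ` V" "Y ` V = Y' ` V" using *(2) by (auto intro!: image_cong)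
    then show ?thesis using *(3) V' by (auto simp: image_Un)
  qed
  have "scalar_rigid C n (X' ` V' \<union> Y' ` V')"
    by (rule scalar_rigid_derived[OF rigid]) (use sub in blast)
  moreover obtain x where "x \<in> V" "\<forall>T. X x T \<noteq> Y x T" using ne by blast
  then have "\<exists>x\<in>V'. \<forall>T. X' x T \<noteq> Y' x T" using *(2) V' by (intro bexI[of _ x]) auto
  ultimately show ?thesis using *(1) unfolding scalar_model_def by blast
qed

section \<open>Trees\<close>

lemma D4_model:
  "scalar_model C (verts (tree_bq s [[0,1], [0,2], [0,3], [0,4]])) (arrows (tree_bq s [[0,1], [0,2], [0,3], [0,4]]))"
  by (rule scalar_model_arms[OF full_rep_point[where b = 0 and n = 2], where s = s and
        arms = "[(0, [1], [d4_L1]), (0, [2], [d4_L2]), (0, [3], [d4_L3]), (0, [4], [d4_L4])]"])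
    (auto simp: tree_bq_def intro: scalar_rigid_mono[OF d4_rigid])

lemma E6_model:
  "scalar_model C (verts (tree_bq s [[0,1,2], [0,3,4], [0,5,6]])) (arrows (tree_bq s [[0,1,2], [0,3,4], [0,5,6]]))"
  by (rule scalar_model_arms[OF full_rep_point[where b = 0 and n = 3], where s = s and
        arms = "[(0, [1,2], [e6_L0, e6_P0]), (0, [3,4], [e6_L1, e6_P1]), (0, [5,6], [e6_L2, e6_P2])]"])
    (auto simp: tree_bq_def intro: scalar_rigid_mono[OF e6_rigid])

lemma E7_model:
  "scalar_model C (verts (tree_bq s [[0,1], [0,2,3,4], [0,5,6,7]])) (arrows (tree_bq s [[0,1], [0,2,3,4], [0,5,6,7]]))"
  by (rule scalar_model_arms[OF full_rep_point[where b = 0 and n = 4], where s = s and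
        arms = "[(0, [1], [e7_Z]), (0, [2,3,4], [e7_F1, e7_F2, e7_F3]), (0, [5,6,7], [e7_G1, e7_G2, e7_G3])]"])
    (auto simp: tree_bq_def intro: scalar_rigid_mono[OF e7_rigid])

lemma E8_model:
  "scalar_model C (verts (tree_bq s [[0,1], [0,2,3], [0,4,5,6,7,8]])) (arrows (tree_bq s [[0,1], [0,2,3], [0,4,5,6,7,8]]))"
  by (rule scalar_model_arms[OF full_rep_point[where b = 0 and n = 6], where s = s and
        arms = "[(0, [1], [e8_Z]), (0, [2,3], [e8_G2, e8_G4]), (0, [4,5,6,7,8], [e8_F1, e8_F2, e8_F3, e8_F4, e8_F5])]"])
    (auto simp: tree_bq_def intro: scalar_rigid_mono[OF e8_rigid])

section \<open>Commutative diagrams\<close>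

lemma nonzero_if: "v \<in> H \<Longrightarrow> v i \<noteq> 0 \<Longrightarrow> H \<noteq> {0 :: nat \<Rightarrow> 'a::zero}"
  by auto

lemma nonzero [simp]: "d4_L1 T \<noteq> {0}" "e7_F3 T \<noteq> {0}" "e8_F5 T \<noteq> {0}" "e8_G4 T \<noteq> {0}" "e8_Z T \<noteq> {0}"
proof -
  show "d4_L1 T \<noteq> {0}"
    by (rule nonzero_if[of "single 0 1" _ 0]) (auto simp: d4_defs cut_out_def single_apply)
  show "e7_F3 T \<noteq> {0}"
    by (rule nonzero_if[of "single 0 1" _ 0]) (auto simp: e7_defs cut_out_def single_apply)
  show "e8_F5 T \<noteq> {0}"
    by (rule nonzero_if[of "single 0 1" _ 0]) (auto simp: e8_defs cut_out_def single_apply)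
  show "e8_G4 T \<noteq> {0}"
    by (rule nonzero_if[of "single 2 1" _ 2]) (auto simp: e8_defs cut_out_def single_apply)
  show "e8_Z T \<noteq> {0}"
    by (rule nonzero_if[of "\<lambda>j. if j = 1 \<or> j = 2 then 1 else 0" _ 1])
      (auto simp: e8_defs cut_out_def coord_space_def)
qed

lemma coord6_zeroI:
  assumes "v \<in> coord_space 6" "v 0 = 0" "v 1 = 0" "v 2 = 0" "v 3 = 0" "v 4 = 0" "v 5 = 0"
  shows "v = 0"
proof
  fix j :: nat
  consider "j = 0" | "j = 1" | "j = 2" | "j = 3" | "j = 4" | "j = 5" | "6 \<le> j" by linarith
  then show "v j = 0 j" using assms by cases (auto simp: coord_space_def)
qed

lemmas e8_subset [simp] = e8_bounds(9-21)[THEN subset_space]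
lemmas e7_subset [simp] = e7_bounds(14-20)[THEN subset_space]
lemmas d4_subset [simp] = d4_bounds(5-8)[THEN subset_space]

lemma chain_edges_rev: "chain_edges (rev xs) = (chain_edges xs)\<inverse>"
proof -
  have "chain_edges (xs @ [y, z]) = insert (y, z) (chain_edges (xs @ [y]))" for xs :: "nat list" and y z
  proof (induction xs)
    case (Cons x xs)
    then show ?case by (cases xs) (auto simp: chain_edges_def)
  qed (simp add: chain_edges_def)
  then show ?thesis
    by (induction xs rule: induct_list012) (auto simp: chain_edges_def)
qed

lemma converse_orient: "(orient s E)\<inverse> = orient (\<lambda>e. \<not> s e) E"
  by (force simp: orient_def image_iff split: if_splits)

lemma verts_op [simp]: "verts (op_bquiver Q) = verts Q"
  by (simp add: op_bquiver_def)

lemma verts_op_comm: "verts (op_bquiver (comm_bq s p q arms)) = verts (comm_bq (\<lambda>e. \<not> s e) (rev p) (rev q) arms)"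
  by (simp add: comm_bq_def)

lemma arrows_op_comm:
  "arrows (op_bquiver (comm_bq s p q arms)) = arrows (comm_bq (\<lambda>e. \<not> s e) (rev p) (rev q) arms)"
  by (simp add: op_bquiver_def comm_bq_def converse_Un converse_orient chain_edges_rev)

lemma arrows_op_tree: "arrows (op_bquiver (tree_bq s arms)) = arrows (tree_bq (\<lambda>e. \<not> s e) arms)"
  and verts_op_tree: "verts (op_bquiver (tree_bq s arms)) = verts (tree_bq (\<lambda>e. \<not> s e) arms)"
  by (simp_all add: op_bquiver_def tree_bq_def converse_orient)

abbreviation "bq_model C Q \<equiv> scalar_model C (verts Q) (arrows Q)"

text \<open>
  In the following diagrams, the dimensions of the spaces are the entries of the radical vector of the
  quadratic form of the quiver; \<open>W\<close> has dimension 4 in the third family and 6 in the others. An arm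
  of \<open>p\<close> vertices takes \<open>p\<close> consecutive members of a flag.

  For the first family, \<open>l = Z\<close>, \<open>r = F\<^sub>5\<close> and \<open>t = W / G\<^sub>2\<close>.
\<close>

lemma R1_model: "bq_model C (comm_bq s [0,1,3] [0,2,3] [[3,4], [2,5,6,7,8]])"
proof (rule scalar_model_arms[where s = s and arms = "[(3, [4], [e8_G4]), (2, [5,6,7,8], [e8_F1, e8_F2, e8_F3, e8_F4])]"],
    rule square_pushout[where n = 6 and m = 0 and l = 1 and r = 2 and t = 3 and L = e8_Z and R = e8_F5 and Z = e8_G2])
  fix T :: 'a and w :: "nat \<Rightarrow> 'a" assume "w \<in> coord_space 6"
  then show "\<exists>u\<in>e8_F5 T. w - u \<in> e8_Z T"
    by (intro bexI[of _ "\<lambda>j. w j - (if j = 0 \<or> j = 5 then w 5 - T * w 4 else 0)"])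
      (auto simp: e8_defs cut_out_def coord_space_def)
qed (auto simp: comm_bq_def chain_edges_def intro: e8_rigid_derived)

text \<open>
  The opposite quiver has its source at \<open>t\<close>, where the subspace \<open>G\<^sub>4\<close> is placed, and \<open>W\<close> is the pullback
  of \<open>l = W / Z\<close> and \<open>r = W / F\<^sub>1\<close>.
\<close>

lemma R1_op_model: "bq_model C (comm_bq s [3,1,0] [3,2,0] [[3,4], [2,5,6,7,8]])"
proof (rule scalar_model_arms[where s = s and arms = "[(3, [4], [e8_G2]), (2, [5,6,7,8], [e8_F2, e8_F3, e8_F4, e8_F5])]"],
    rule square_pullback[where n = 6 and s = 3 and l = 1 and r = 2 and e = 0 and N = e8_G4 and A = e8_Z and B = e8_F1 and E = e8_ZF1])
  fix T :: 'a and w :: "nat \<Rightarrow> 'a"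
  show "e8_Z T \<inter> e8_F1 T \<subseteq> {0}"
    by (auto simp: e8_defs cut_out_def intro!: coord6_zeroI)
  assume "w \<in> e8_ZF1 T"
  then show "\<exists>u\<in>e8_Z T. w - u \<in> e8_F1 T"
    by (intro bexI[of _ "\<lambda>j. w j - (if j \<le> 1 then w 0 - w 5 else 0)"])
      (auto simp: e8_defs e8_sum_defs cut_out_def coord_space_def algebra_simps)
qed (auto simp: comm_bq_def chain_edges_def intro: e8_rigid_derived)

lemma R2_model: "bq_model C (comm_bq s [0,1,3] [0,2,3] [[3,4,5,6,7], [2,8]])"
proof (rule scalar_model_arms[where s = s and arms = "[(3, [4,5,6,7], [e8_F2, e8_F3, e8_F4, e8_F5]), (2, [8], [e8_G2])]"],
    rule square_pushout[where n = 6 and m = 0 and l = 1 and r = 2 and t = 3 and L = e8_Z and R = e8_G4 and Z = e8_F1])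
  fix T :: 'a and w :: "nat \<Rightarrow> 'a" assume "w \<in> coord_space 6"
  then show "\<exists>u\<in>e8_G4 T. w - u \<in> e8_Z T"
    by (intro bexI[of _ "\<lambda>j. if j = 2 then w 2 - w 1 else if j = 3 then w 3 - w 4 else if j = 5 then w 5 - w 0 else 0"])
      (auto simp: e8_defs cut_out_def coord_space_def)
qed (auto simp: comm_bq_def chain_edges_def intro: e8_rigid_derived)

lemma R2_op_model: "bq_model C (comm_bq s [3,1,0] [3,2,0] [[3,4,5,6,7], [2,8]])"
proof (rule scalar_model_arms[where s = s and arms = "[(3, [4,5,6,7], [e8_F1, e8_F2, e8_F3, e8_F4]), (2, [8], [e8_G4])]"],
    rule square_pullback[where n = 6 and s = 3 and l = 1 and r = 2 and e = 0 and N = e8_F5 and A = e8_Z and B = e8_G2 and E = e8_ZG2])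
  fix T :: 'a and w :: "nat \<Rightarrow> 'a"
  show "e8_Z T \<inter> e8_G2 T \<subseteq> {0}"
    by (auto simp: e8_defs cut_out_def intro!: coord6_zeroI)
  assume "w \<in> e8_ZG2 T"
  then show "\<exists>u\<in>e8_Z T. w - u \<in> e8_G2 T"
    by (intro bexI[of _ "\<lambda>j. if j = 4 then w 3 else if j = 5 then w 0 else w j"])
      (auto simp: e8_defs e8_sum_defs cut_out_def coord_space_def)
qed (auto simp: comm_bq_def chain_edges_def intro: e8_rigid_derived)

text \<open>
  The third and the fourth family, with \<open>m\<close> and \<open>t\<close> exchanged, are their own opposites up to the
  orientation of the arms, so that one diagram serves both.
\<close>

lemma R3_square:
  fixes m t :: nat and C :: "'a::field set"
  assumes "distinct [m, 1, 2, t]"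
  shows "full_rep C 4 {m, 1, 2, t} {(m, 1), (1, t), (m, 2), (2, t)}
    ((\<lambda>_ _. coord_space 4)(m := \<lambda>T. e7_F3 T \<inter> e7_G3 T, 1 := e7_F3, 2 := e7_G3)) ((\<lambda>_ _. {0})(t := e7_Z))"
proof (rule square_pushout[OF assms])
  fix T :: 'a and w :: "nat \<Rightarrow> 'a" assume "w \<in> coord_space 4"
  then show "\<exists>u\<in>e7_G3 T. w - u \<in> e7_F3 T"
    by (intro bexI[of _ "single 3 (w 3)"])
      (auto simp: e7_defs cut_out_def coord_space_def single_apply)
qed auto

lemma R3_model: "bq_model C (comm_bq s [0,1,3] [0,2,3] [[1,4,5], [2,6,7]])"
  by (rule scalar_model_arms[OF R3_square[where m = 0 and t = 3], where s = s and
        arms = "[(1, [4,5], [e7_F1, e7_F2]), (2, [6,7], [e7_G1, e7_G2])]"])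
    (auto simp: comm_bq_def chain_edges_def intro: scalar_rigid_mono[OF e7_rigid])

lemma R3_op_model: "bq_model C (comm_bq s [3,1,0] [3,2,0] [[1,4,5], [2,6,7]])"
  by (rule scalar_model_arms[OF R3_square[where m = 3 and t = 0], where s = s and
        arms = "[(1, [4,5], [e7_F1, e7_F2]), (2, [6,7], [e7_G1, e7_G2])]"])
    (auto simp: comm_bq_def chain_edges_def intro: scalar_rigid_mono[OF e7_rigid])

lemma R4_square:
  fixes m t :: nat and C :: "'a::field set"
  assumes "distinct [m, 1, 2, t]"
  shows "full_rep C 6 {m, 1, 2, t} {(m, 1), (1, t), (m, 2), (2, t)}
    ((\<lambda>_ _. coord_space 6)(m := \<lambda>T. e8_G4 T \<inter> e8_F5 T, 1 := e8_G4, 2 := e8_F5)) ((\<lambda>_ _. {0})(t := e8_Z))"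
proof (rule square_pushout[OF assms])
  fix T :: 'a and w :: "nat \<Rightarrow> 'a" assume "w \<in> coord_space 6"
  then show "\<exists>u\<in>e8_F5 T. w - u \<in> e8_G4 T"
    by (intro bexI[of _ "w(5 := T * w 4)"]) (auto simp: e8_defs cut_out_def coord_space_def)
qed auto

lemma R4_model: "bq_model C (comm_bq s [0,1,3] [0,2,3] [[1,4], [2,5,6,7,8]])"
  by (rule scalar_model_arms[OF R4_square[where m = 0 and t = 3], where s = s and
        arms = "[(1, [4], [e8_G2]), (2, [5,6,7,8], [e8_F1, e8_F2, e8_F3, e8_F4])]"])
    (auto simp: comm_bq_def chain_edges_def intro: e8_rigid_derived)

lemma R4_op_model: "bq_model C (comm_bq s [3,1,0] [3,2,0] [[1,4], [2,5,6,7,8]])"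
  by (rule scalar_model_arms[OF R4_square[where m = 3 and t = 0], where s = s and
        arms = "[(1, [4], [e8_G2]), (2, [5,6,7,8], [e8_F1, e8_F2, e8_F3, e8_F4])]"])
    (auto simp: comm_bq_def chain_edges_def intro: e8_rigid_derived)

lemma cap_subset [simp]: "cap H K \<le> H" "cap H K \<le> K"
  by (auto simp: cap_def le_fun_def)

text \<open>
  The subspace \<open>G\<^sub>4\<close> is present as the sum of \<open>l\<^sub>1 = F\<^sub>5 \<inter> G\<^sub>4\<close> and \<open>r = G\<^sub>2\<close>.
\<close>

lemma R5_model: "bq_model C (comm_bq s [0,1,2,4] [0,3,4] [[2,5,6,7,8]])"
proof (rule scalar_model_arms[where s = s and arms = "[(2, [5,6,7,8], [e8_F1, e8_F2, e8_F3, e8_F4])]"],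
    rule pentagon_pushout[where n = 6 and m = 0 and k = 1 and l = 2 and r = 3 and t = 4 and
      K = "cap e8_F5 e8_G4" and L = e8_F5 and R = e8_G2 and Z = e8_Z])
  fix T :: 'a and w :: "nat \<Rightarrow> 'a" assume "w \<in> coord_space 6"
  then show "\<exists>u\<in>e8_G2 T. w - u \<in> e8_F5 T"
    by (intro bexI[of _ "single 5 (w 5 - T * w 4)"])
      (auto simp: e8_defs cut_out_def coord_space_def single_apply)
next
  show "e8_F5 T \<inter> e8_G2 T \<subseteq> cap e8_F5 e8_G4 T" for T :: 'a
    using e8_chains(11) by (auto simp: cap_def le_fun_def)
qed (auto simp: comm_bq_def chain_edges_def subspace_cap intro: e8_rigid_derived)

lemma R5_op_model: "bq_model C (comm_bq s [4,2,1,0] [4,3,0] [[2,5,6,7,8]])"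
proof (rule scalar_model_arms[where s = s and arms = "[(2, [5,6,7,8], [e8_F2, e8_F3, e8_F4, e8_F5])]"],
    rule pentagon_pullback[where n = 6 and s = 4 and l = 2 and k = 1 and r = 3 and e = 0 and N = e8_Z and
      A = e8_F1 and K = e8_G2F1 and B = e8_G4 and E = e8_G4F1])
  fix T :: 'a and w :: "nat \<Rightarrow> 'a"
  show "e8_F1 T \<inter> e8_G4 T \<subseteq> {0}"
    by (auto simp: e8_defs cut_out_def intro!: coord6_zeroI)
  assume "w \<in> e8_G4F1 T"
  then show "\<exists>u\<in>e8_F1 T. w - u \<in> e8_G4 T"
    by (intro bexI[of _ "\<lambda>j. if j \<le> 1 then w j else 0"])
      (auto simp: e8_defs e8_sum_defs cut_out_def coord_space_def)
qed (auto simp: comm_bq_def chain_edges_def intro: e8_rigid_derived)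

text \<open>
  The subspace \<open>F\<^sub>5\<close> is present as the sum of \<open>l\<^sub>1 = F\<^sub>5 \<inter> G\<^sub>4\<close> and \<open>r = F\<^sub>4\<close>.
\<close>

lemma R6_model: "bq_model C (comm_bq s [0,1,2,4] [0,3,4] [[2,5], [3,6,7,8]])"
proof (rule scalar_model_arms[where s = s and arms = "[(2, [5], [e8_G2]), (3, [6,7,8], [e8_F1, e8_F2, e8_F3])]"],
    rule pentagon_pushout[where n = 6 and m = 0 and k = 1 and l = 2 and r = 3 and t = 4 and
      K = "cap e8_F5 e8_G4" and L = e8_G4 and R = e8_F4 and Z = e8_Z])
  fix T :: 'a and w :: "nat \<Rightarrow> 'a" assume "w \<in> coord_space 6"
  then show "\<exists>u\<in>e8_F4 T. w - u \<in> e8_G4 T"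
    by (intro bexI[of _ "\<lambda>j. if j < 2 then w j else 0"])
      (auto simp: e8_defs cut_out_def coord_space_def)
next
  show "e8_G4 T \<inter> e8_F4 T \<subseteq> cap e8_F5 e8_G4 T" for T :: 'a
    using e8_chains(10) by (auto simp: cap_def le_fun_def)
qed (auto simp: comm_bq_def chain_edges_def subspace_cap intro: e8_rigid_derived)

lemma R6_op_model: "bq_model C (comm_bq s [4,2,1,0] [4,3,0] [[2,5], [3,6,7,8]])"
proof (rule scalar_model_arms[where s = s and arms = "[(2, [5], [e8_G4]), (3, [6,7,8], [e8_F3, e8_F4, e8_F5])]"],
    rule pentagon_pullback[where n = 6 and s = 4 and l = 2 and k = 1 and r = 3 and e = 0 and N = e8_Z and
      A = e8_G2 and K = e8_G2F1 and B = e8_F2 and E = e8_G2F2])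
  fix T :: 'a and w :: "nat \<Rightarrow> 'a"
  show "e8_G2 T \<inter> e8_F2 T \<subseteq> {0}"
    by (auto simp: e8_defs cut_out_def intro!: coord6_zeroI)
  assume "w \<in> e8_G2F2 T"
  then show "\<exists>u\<in>e8_G2 T. w - u \<in> e8_F2 T"
    by (intro bexI[of _ "\<lambda>j. if j \<le> 3 then 0 else w j"])
      (auto simp: e8_defs e8_sum_defs cut_out_def coord_space_def)
qed (auto simp: comm_bq_def chain_edges_def intro: e8_rigid_derived)

text \<open>
  The pushout of \<open>l\<^sub>2 = G\<^sub>4\<close> and \<open>r = F\<^sub>4 / F\<^sub>1\<close> is \<open>W / F\<^sub>1\<close>, and \<open>W\<close> itself is the pullback of this
  and \<open>l\<^sub>3 = W / Z\<close>. The shape is its own opposite under \<open>m \<leftrightarrow> t\<close> and \<open>l\<^sub>1 \<leftrightarrow> l\<^sub>3\<close>.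
\<close>

lemma R7_hexagon:
  fixes m l1 l2 l3 r t :: nat and C :: "'a::field set"
  assumes "distinct [m, l1, l2, l3, r, t]"
  shows "full_rep C 6 {m, l1, l2, l3, r, t} {(m, l1), (l1, l2), (l2, l3), (l3, t), (m, r), (r, t)}
    ((\<lambda>_ _. coord_space 6)(m := cap e8_G4 e8_F4, l1 := cap e8_F5 e8_G4, l2 := e8_G4, r := e8_F4))
    ((\<lambda>_ _. {0})(l3 := e8_Z, r := e8_F1, t := e8_ZF1))" (is "full_rep C 6 ?V ?A ?X ?Y")
proof (rule full_rep_mixed[where l = l2 and r = r and p = l3 and t = t])
  have "cap e8_G4 e8_F4 \<le> (cap e8_F5 e8_G4 :: 'a subspaces)"
    using e8_chains(10) by (auto simp: cap_def le_fun_def)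
  moreover have "cap e8_G4 e8_F4 \<le> (\<lambda>_ :: 'a. coord_space 6)" "cap e8_F5 e8_G4 \<le> (\<lambda>_ :: 'a. coord_space 6)"
    by (rule order_trans[OF cap_subset(1)]; simp)+
  moreover have "cap e8_G4 e8_F4 T \<subseteq> (coord_space 6 :: (nat \<Rightarrow> 'a) set)" 
    "cap e8_F5 e8_G4 T \<subseteq> (coord_space 6 :: (nat \<Rightarrow> 'a) set)" for T
    by (auto simp: cap_def e8_defs cut_out_def)
  moreover have "(0 :: nat \<Rightarrow> 'a) \<in> cap e8_G4 e8_F4 T" "(0 :: nat \<Rightarrow> 'a) \<in> cap e8_F5 e8_G4 T" "(0 :: nat \<Rightarrow> 'a) \<in> e8_G4 T" for T
    by (auto simp: cap_def e8_defs cut_out_def coord_space_def)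
  moreover have "e8_F1 T \<subseteq> (e8_F4 T :: (nat \<Rightarrow> 'a) set)" for T
    using e8_chains(3) by (auto simp: le_fun_def)
  ultimately show "subquotient_rep 6 ?V ?A ?X ?Y"
    using assms by (auto simp: subquotient_rep_def subspace_coord_space vec.subspace_0 subspace_cap)
next
  fix T :: 'a and w :: "nat \<Rightarrow> 'a" assume "w \<in> coord_space 6"
  then show "\<exists>u\<in>?X r T. w - u \<in> ?X l2 T"
    using assms by (intro bexI[of _ "\<lambda>j. if j < 2 then w j else 0"])
      (auto simp: e8_defs cut_out_def coord_space_def)
next
  fix T :: 'a and w :: "nat \<Rightarrow> 'a" assume "w \<in> ?Y t T"
  then show "\<exists>u\<in>?Y r T. w - u \<in> ?Y l3 T"
    using assms by (intro bexI[of _ "\<lambda>j. if j \<le> 1 then w 0 - w 5 else 0"])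
      (auto simp: e8_defs e8_sum_defs cut_out_def coord_space_def algebra_simps)
next
  have "e8_F1 T \<inter> e8_Z T \<subseteq> {0}" for T :: 'a
    by (auto simp: e8_defs cut_out_def intro!: coord6_zeroI)
  then show "?Y r T \<inter> ?Y l3 T \<subseteq> {0}" for T :: 'a
    using assms by simp
next
  show "(m', l2) \<in> ?A\<^sup>* \<or> (l3, m') \<in> ?A\<^sup>* \<or> m' = r" if "m' \<in> ?V" for m'
    using that by (auto intro: r_into_rtrancl rtrancl2)
next
  fix T v assume "v \<in> ?X l2 T" "v \<in> ?X r T"
  then have "v \<in> ?X m T" using assms by (simp add: cap_def)
  then show "\<exists>m'\<in>?V. (m', l2) \<in> ?A\<^sup>* \<and> (m', r) \<in> ?A\<^sup>* \<and> v \<in> ?X m' T"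
    by (intro bexI[of _ m]) (auto intro: r_into_rtrancl rtrancl2)
qed (use assms in \<open>auto intro: r_into_rtrancl\<close>)

lemma R7_model: "bq_model C (comm_bq s [0,1,2,3,5] [0,4,5] [[2,6], [4,7,8]])"
  by (rule scalar_model_arms[OF R7_hexagon[of 0 1 2 3 4 5], where s = s and
        arms = "[(2, [6], [e8_G2]), (4, [7,8], [e8_F2, e8_F3])]"])
    (auto simp: comm_bq_def chain_edges_def intro: e8_rigid_derived)

lemma R7_op_model: "bq_model C (comm_bq s [5,3,2,1,0] [5,4,0] [[2,6], [4,7,8]])"
  by (rule scalar_model_arms[OF R7_hexagon[of 5 3 2 1 4 0], where s = s and
        arms = "[(2, [6], [e8_G2]), (4, [7,8], [e8_F2, e8_F3])]"])
    (auto simp: comm_bq_def chain_edges_def intro: e8_rigid_derived)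

lemma A3_rep:
  fixes a b c d :: nat and C :: "'a::field set"
  assumes "distinct [a, b, c, d]"
  shows "full_rep C 2 {a, b, c, d} {(a, c), (a, d), (b, c), (b, d)}
    ((\<lambda>_ _. coord_space 2)(a := d4_L1, b := d4_L2)) ((\<lambda>_ _. {0})(c := d4_L3, d := d4_L4))"
    (is "full_rep C 2 ?V ?A ?X ?Y")
proof (rule full_rep_pushout[where l = a and r = b])
  show "subquotient_rep 2 ?V ?A ?X ?Y"
    using assms by (auto simp: subquotient_rep_def subspace_coord_space vec.subspace_0)
next
  fix T :: 'a and w :: "nat \<Rightarrow> 'a" assume "w \<in> coord_space 2"
  then show "\<exists>u\<in>?X b T. w - u \<in> ?X a T"
    using assms by (intro bexI[of _ "single 1 (w 1)"])
      (auto simp: d4_defs cut_out_def coord_space_def single_apply)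
next
  fix T v assume "v \<in> ?X a T" "v \<in> ?X b T"
  then have "v \<in> coord_space 2" "v 0 = 0" "v 1 = 0"
    using assms by (auto simp: d4_defs cut_out_def)
  then have "v j = 0" for j by (cases "j = 0 \<or> j = 1") (auto simp: coord_space_def)
  then show "v = 0 \<or> (\<exists>m\<in>?V. (m, a) \<in> ?A\<^sup>* \<and> (m, b) \<in> ?A\<^sup>* \<and> v \<in> ?X m T)"
    by (auto simp: fun_eq_iff)
qed (use assms in \<open>auto intro: r_into_rtrancl\<close>)

lemma scalar_model_core:
  assumes "full_rep C n V A X Y" "scalar_rigid C n (X ` V \<union> Y ` V)" "\<exists>x\<in>V. \<forall>T. X x T \<noteq> Y x T"
  shows "scalar_model C V A"
  using assms unfolding scalar_model_def by blast

lemma A3_model: "bq_model C A3_tilde"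
proof -
  have V: "verts A3_tilde = {0, 1, 2, 3}" "arrows A3_tilde = {(0, 2), (0, 3), (1, 2), (1, 3)}"
    by (simp_all add: A3_tilde_def)
  show ?thesis
    unfolding V by (rule scalar_model_core[OF A3_rep]) (auto intro: scalar_rigid_mono[OF d4_rigid])
qed

lemma A3_op_model: "bq_model C (op_bquiver A3_tilde)"
proof -
  have V: "verts (op_bquiver A3_tilde) = {2, 3, 0, 1}" "arrows (op_bquiver A3_tilde) = {(2, 0), (2, 1), (3, 0), (3, 1)}"
    by (auto simp: A3_tilde_def op_bquiver_def)
  show ?thesis
    unfolding V by (rule scalar_model_core[OF A3_rep]) (auto intro: scalar_rigid_mono[OF d4_rigid])
qed

theorem critical_model:
  assumes "Q \<in> critical_bquivers"
  shows "bq_model C Q \<and> bq_model C (op_bquiver Q)"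
  using assms
  by cases (simp_all add: arrows_op_comm verts_op_comm arrows_op_tree verts_op_tree
      A3_model A3_op_model D4_model E6_model E7_model E8_model R1_model R1_op_model R2_model R2_op_model
      R3_model R3_op_model R4_model R4_op_model R5_model R5_op_model R6_model R6_op_model R7_model R7_op_model
      del: verts_op One_nat_def)

section \<open>Path algebras\<close>

lemma path_algebra_simps:
  "carrier (path_algebra Q) = {f. {p. f p \<noteq> 0} \<subseteq> paths Q \<and> finite {p. f p \<noteq> 0}}"
  "f \<otimes>\<^bsub>path_algebra Q\<^esub> g = (\<lambda>p. \<Sum>i<length p. f (drop i p) * g (take (Suc i) p))"
  "\<one>\<^bsub>path_algebra Q\<^esub> = (\<lambda>p. if \<exists>x\<in>verts Q. p = [x] then 1 else 0)"
  "\<zero>\<^bsub>path_algebra Q\<^esub> = (\<lambda>p. 0)"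
  "f \<oplus>\<^bsub>path_algebra Q\<^esub> g = (\<lambda>p. f p + g p)"
  by (simp_all add: path_algebra_def)

lemma path_split_iff:
  assumes "i < length p"
  shows "p \<in> paths Q \<longleftrightarrow> take (Suc i) p \<in> paths Q \<and> drop i p \<in> paths Q"
proof -
  have p: "p = take i p @ p ! i # drop (Suc i) p" using assms by (rule id_take_nth_drop)
  have t: "take (Suc i) p = take i p @ [p ! i]" using assms by (rule take_Suc_conv_app_nth)
  have d: "drop i p = p ! i # drop (Suc i) p" using assms by (simp add: Cons_nth_drop_Suc)
  have "successively R p \<longleftrightarrow> successively R (take i p @ [p ! i]) \<and> successively R (p ! i # drop (Suc i) p)" for R
    by (subst p, subst successively_append_iff, subst successively_append_iff) auto
  moreover have "set p = set (take i p @ [p ! i]) \<union> set (p ! i # drop (Suc i) p)"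
    by (subst (1) p) auto
  moreover have "p \<noteq> []" using assms by auto
  ultimately show ?thesis unfolding paths_def t d by (auto simp del: take_Suc)
qed

lemma hd_last_split:
  assumes "i < length p"
  shows "hd (take (Suc i) p) = hd p" "last (take (Suc i) p) = p ! i" "hd (drop i p) = p ! i" "last (drop i p) = last p"
    "take (Suc i) p @ tl (drop i p) = p" "length (take (Suc i) p) = Suc i"
proof -
  have t: "take (Suc i) p = take i p @ [p ! i]" using assms by (rule take_Suc_conv_app_nth)
  have d: "drop i p = p ! i # drop (Suc i) p" using assms by (simp add: Cons_nth_drop_Suc)
  show "hd (take (Suc i) p) = hd p" using assms by (cases p) auto
  show "last (take (Suc i) p) = p ! i" by (simp add: t)
  show "hd (drop i p) = p ! i" by (simp add: d)
  show "last (drop i p) = last p" using assms by (simp add: last_drop)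
  show "take (Suc i) p @ tl (drop i p) = p" by (simp add: d)
  show "length (take (Suc i) p) = Suc i" using assms by simp
qed

lemma join_split:
  assumes "a \<noteq> []" "b \<noteq> []" "last b = hd a"
  shows "take (length b) (b @ tl a) = b" "drop (length b - 1) (b @ tl a) = a" "length b - 1 < length (b @ tl a)"
    "Suc (length b - 1) = length b"
proof -
  obtain b' z where b: "b = b' @ [z]" using assms(2) by (cases b rule: rev_cases) auto
  show "take (length b) (b @ tl a) = b" by simp
  show "drop (length b - 1) (b @ tl a) = a" using b assms(1,3) by (cases a) auto
  show "length b - 1 < length (b @ tl a)" "Suc (length b - 1) = length b" using b by auto
qed

lemma path_algebra_mult_closed:
  fixes f g :: "'v list \<Rightarrow> 'k::field"
  assumes "f \<in> carrier (path_algebra Q)" "g \<in> carrier (path_algebra Q)"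
  shows "f \<otimes>\<^bsub>path_algebra Q\<^esub> g \<in> carrier (path_algebra Q)"
proof -
  have *: "p \<in> paths Q \<and> p \<in> (\<lambda>(a, b). b @ tl a) ` ({p. f p \<noteq> 0} \<times> {p. g p \<noteq> 0})"
    if nz: "(f \<otimes>\<^bsub>path_algebra Q\<^esub> g) p \<noteq> 0" for p
  proof -
    obtain i where i: "i < length p" "f (drop i p) \<noteq> 0" "g (take (Suc i) p) \<noteq> 0"
      using nz unfolding path_algebra_simps by (metis (no_types, lifting) lessThan_iff mult_eq_0_iff sum.neutral)
    then have "p \<in> paths Q" using assms path_split_iff[of i p Q] by (auto simp: path_algebra_simps)
    moreover have "p = (\<lambda>(a, b). b @ tl a) (drop i p, take (Suc i) p)" using hd_last_split(5)[OF i(1)] by simp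
    ultimately show ?thesis using i by blast
  qed
  have "finite ((\<lambda>(a, b). b @ tl a) ` ({p. f p \<noteq> 0} \<times> {p. g p \<noteq> 0}))"
    using assms by (simp add: path_algebra_simps)
  then have "finite {p. (f \<otimes>\<^bsub>path_algebra Q\<^esub> g) p \<noteq> 0}"
    by (rule finite_subset[rotated]) (use * in blast)
  then show ?thesis using * by (auto simp: path_algebra_simps(1))
qed

lemma path_algebra_mult_assoc:
  fixes f g h :: "'v list \<Rightarrow> 'k::field"
  shows "(f \<otimes>\<^bsub>path_algebra Q\<^esub> g) \<otimes>\<^bsub>path_algebra Q\<^esub> h = f \<otimes>\<^bsub>path_algebra Q\<^esub> (g \<otimes>\<^bsub>path_algebra Q\<^esub> h)"
proof
  fix p :: "'v list"
  let ?n = "length p"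
  have "((f \<otimes>\<^bsub>path_algebra Q\<^esub> g) \<otimes>\<^bsub>path_algebra Q\<^esub> h) p =
    (\<Sum>i<?n. \<Sum>j<?n - i. f (drop (i + j) p) * g (take (Suc j) (drop i p)) * h (take (Suc i) p))"
    by (simp add: path_algebra_simps sum_distrib_right add.commute)
  also have "\<dots> = (\<Sum>(i, j)\<in>(SIGMA i:{..<?n}. {..<?n - i}).
      f (drop (i + j) p) * g (take (Suc j) (drop i p)) * h (take (Suc i) p))"
    by (simp add: sum.Sigma)
  also have "\<dots> = (\<Sum>(l, i)\<in>(SIGMA l:{..<?n}. {..<Suc l}).
      f (drop l p) * g (take (Suc (l - i)) (drop i p)) * h (take (Suc i) p))"
    by (rule sum.reindex_bij_witness[where i = "\<lambda>(l, i). (i, l - i)" and j = "\<lambda>(i, j). (i + j, i)"]) auto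
  also have "\<dots> = (\<Sum>l<?n. \<Sum>i<Suc l. f (drop l p) * g (take (Suc (l - i)) (drop i p)) * h (take (Suc i) p))"
    by (simp add: sum.Sigma del: sum.lessThan_Suc)
  also have "\<dots> = (\<Sum>l<?n. \<Sum>i<Suc l.
      f (drop l p) * (g (drop i (take (Suc l) p)) * h (take (Suc i) (take (Suc l) p))))"
    by (intro sum.cong refl) (auto simp: drop_take Suc_diff_le min_def mult.assoc)
  also have "\<dots> = (\<Sum>l<?n. \<Sum>i<length (take (Suc l) p).
      f (drop l p) * (g (drop i (take (Suc l) p)) * h (take (Suc i) (take (Suc l) p))))"
    by (intro sum.cong refl) simp
  also have "\<dots> = (f \<otimes>\<^bsub>path_algebra Q\<^esub> (g \<otimes>\<^bsub>path_algebra Q\<^esub> h)) p"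
    by (simp only: path_algebra_simps sum_distrib_left)
  finally show "((f \<otimes>\<^bsub>path_algebra Q\<^esub> g) \<otimes>\<^bsub>path_algebra Q\<^esub> h) p = (f \<otimes>\<^bsub>path_algebra Q\<^esub> (g \<otimes>\<^bsub>path_algebra Q\<^esub> h)) p" .
qed

lemma path_algebra_one:
  fixes f :: "'v list \<Rightarrow> 'k::field"
  assumes f: "f \<in> carrier (path_algebra Q)"
  shows "\<one>\<^bsub>path_algebra Q\<^esub> \<otimes>\<^bsub>path_algebra Q\<^esub> f = f" "f \<otimes>\<^bsub>path_algebra Q\<^esub> \<one>\<^bsub>path_algebra Q\<^esub> = f"
proof -
  have nil: "f [] = 0" using f by (auto simp: path_algebra_simps paths_def)
  have verts: "f p = 0" if "x \<in> set p" "x \<notin> verts Q" for x p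
    using f that by (auto simp: path_algebra_simps paths_def)
  show "\<one>\<^bsub>path_algebra Q\<^esub> \<otimes>\<^bsub>path_algebra Q\<^esub> f = f"
  proof
    fix p
    show "(\<one>\<^bsub>path_algebra Q\<^esub> \<otimes>\<^bsub>path_algebra Q\<^esub> f) p = f p"
    proof (cases "p = []")
      case False
      then obtain q x where p: "p = q @ [x]" by (cases p rule: rev_cases) auto
      have "(\<one>\<^bsub>path_algebra Q\<^esub> \<otimes>\<^bsub>path_algebra Q\<^esub> f) p =
        (\<Sum>i<length p. if i = length q then (if x \<in> verts Q then f p else 0) else 0)"
        unfolding path_algebra_simps
      proof (intro sum.cong refl)
        fix i assume i: "i \<in> {..<length p}"
        have "drop i p = [y] \<longleftrightarrow> i = length q \<and> y = x" for y
          using i p by (auto simp: append_eq_Cons_conv Cons_eq_append_conv)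
        then show "(if \<exists>x\<in>verts Q. drop i p = [x] then 1 else 0) * f (take (Suc i) p) =
            (if i = length q then (if x \<in> verts Q then f p else 0) else 0)"
          using p by auto
      qed
      also have "\<dots> = f p" using p verts[of x p] by (auto simp: sum.delta)
      finally show ?thesis .
    qed (simp add: path_algebra_simps nil)
  qed
  show "f \<otimes>\<^bsub>path_algebra Q\<^esub> \<one>\<^bsub>path_algebra Q\<^esub> = f"
  proof
    fix p
    show "(f \<otimes>\<^bsub>path_algebra Q\<^esub> \<one>\<^bsub>path_algebra Q\<^esub>) p = f p"
    proof (cases p)
      case (Cons x q)
      have "(f \<otimes>\<^bsub>path_algebra Q\<^esub> \<one>\<^bsub>path_algebra Q\<^esub>) p =
        (\<Sum>i<length p. if i = 0 then (if x \<in> verts Q then f p else 0) else 0)"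
        unfolding path_algebra_simps
      proof (intro sum.cong refl)
        fix i assume i: "i \<in> {..<length p}"
        have "take (Suc i) p = [y] \<longleftrightarrow> i = 0 \<and> y = x" for y
          using i Cons by (cases i; cases q) auto
        then show "f (drop i p) * (if \<exists>x\<in>verts Q. take (Suc i) p = [x] then 1 else 0) =
            (if i = 0 then (if x \<in> verts Q then f p else 0) else 0)"
          by auto
      qed
      also have "\<dots> = f p" using Cons verts[of x p] by (auto simp: sum.delta)
      finally show ?thesis .
    qed (simp add: path_algebra_simps nil)
  qed
qed

lemma path_algebra_add_closed:
  fixes f g :: "'v list \<Rightarrow> 'k::field"
  assumes "f \<in> carrier (path_algebra Q)" "g \<in> carrier (path_algebra Q)"
  shows "(\<lambda>p. f p + g p) \<in> carrier (path_algebra Q)"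
proof -
  have sub: "{p. f p + g p \<noteq> 0} \<subseteq> {p. f p \<noteq> 0} \<union> {p. g p \<noteq> 0}" by auto
  have "finite ({p. f p \<noteq> 0} \<union> {p. g p \<noteq> 0})" "{p. f p \<noteq> 0} \<union> {p. g p \<noteq> 0} \<subseteq> paths Q"
    using assms by (auto simp: path_algebra_simps)
  then show ?thesis using sub finite_subset[OF sub] by (auto simp: path_algebra_simps)
qed

lemma path_algebra_scale_closed:
  fixes f :: "'v list \<Rightarrow> 'k::field"
  assumes "f \<in> carrier (path_algebra Q)"
  shows "(\<lambda>p. c * f p) \<in> carrier (path_algebra Q)"
proof -
  have sub: "{p. c * f p \<noteq> 0} \<subseteq> {p. f p \<noteq> 0}" by auto
  then show ?thesis using assms finite_subset[OF sub] by (auto simp: path_algebra_simps)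
qed

lemma ring_path_algebra:
  assumes "finite (verts Q)"
  shows "ring (path_algebra Q :: ('v list \<Rightarrow> 'k::field) ring)"
proof (rule ringI)
  let ?R = "path_algebra Q :: ('v list \<Rightarrow> 'k) ring"
  show "abelian_group ?R"
  proof (rule abelian_groupI)
    fix f g h assume fgh: "f \<in> carrier ?R" "g \<in> carrier ?R" "h \<in> carrier ?R"
    show "f \<oplus>\<^bsub>?R\<^esub> g \<oplus>\<^bsub>?R\<^esub> h = f \<oplus>\<^bsub>?R\<^esub> (g \<oplus>\<^bsub>?R\<^esub> h)"
      by (simp add: path_algebra_simps add.assoc)
  next
    fix f g assume fg: "f \<in> carrier ?R" "g \<in> carrier ?R"
    show "f \<oplus>\<^bsub>?R\<^esub> g \<in> carrier ?R"
      unfolding path_algebra_simps(5) by (rule path_algebra_add_closed[OF fg])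
    show "f \<oplus>\<^bsub>?R\<^esub> g = g \<oplus>\<^bsub>?R\<^esub> f" by (simp add: path_algebra_simps add.commute)
  next
    fix f assume f: "f \<in> carrier ?R"
    show "\<exists>g\<in>carrier ?R. g \<oplus>\<^bsub>?R\<^esub> f = \<zero>\<^bsub>?R\<^esub>"
      using path_algebra_scale_closed[OF f, of "-1"] by (intro bexI[of _ "\<lambda>p. -1 * f p"]) (auto simp: path_algebra_simps)
  qed (auto simp: path_algebra_simps)
  show "monoid ?R"
  proof (rule monoidI)
    show "\<one>\<^bsub>?R\<^esub> \<in> carrier ?R"
    proof -
      have eq: "{p. \<one>\<^bsub>?R\<^esub> p \<noteq> 0} = (\<lambda>x. [x]) ` verts Q" by (auto simp: path_algebra_simps)
      show ?thesis
        unfolding path_algebra_simps(1) using assms by (simp add: eq) (auto simp: paths_def)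
    qed
  qed (auto simp: path_algebra_mult_closed path_algebra_mult_assoc path_algebra_one)
  fix f g h
  show "(f \<oplus>\<^bsub>?R\<^esub> g) \<otimes>\<^bsub>?R\<^esub> h = f \<otimes>\<^bsub>?R\<^esub> h \<oplus>\<^bsub>?R\<^esub> g \<otimes>\<^bsub>?R\<^esub> h"
    "h \<otimes>\<^bsub>?R\<^esub> (f \<oplus>\<^bsub>?R\<^esub> g) = h \<otimes>\<^bsub>?R\<^esub> f \<oplus>\<^bsub>?R\<^esub> h \<otimes>\<^bsub>?R\<^esub> g"
    by (simp_all add: path_algebra_simps algebra_simps sum.distrib)
qed

section \<open>Sums over parallel paths\<close>

definition parallel_paths :: "'v bquiver \<Rightarrow> 'v \<Rightarrow> 'v \<Rightarrow> 'v list set"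
  where "parallel_paths Q x y = {p \<in> paths Q. hd p = x \<and> last p = y}"

text \<open>
  Summing the coefficients over parallel paths turns an element of the path algebra into a matrix over
  the vertices. By \<open>path_sum_mult\<close> below, products become products of matrices, and elements that
  differ by a relation between parallel paths become equal.
\<close>

definition path_sum :: "'v bquiver \<Rightarrow> ('v list \<Rightarrow> 'k::field) \<Rightarrow> 'v \<Rightarrow> 'v \<Rightarrow> 'k"
  where "path_sum Q f x y = (\<Sum>p\<in>parallel_paths Q x y. f p)"

lemma path_sum_add: "path_sum Q (\<lambda>p. f p + g p) x y = path_sum Q f x y + path_sum Q g x y"
  by (simp add: path_sum_def sum.distrib)

lemma path_sum_scale: "path_sum Q (\<lambda>p. c * f p) x y = c * path_sum Q f x y"
  by (simp add: path_sum_def sum_distrib_left)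

lemma path_sum_path_elt:
  assumes "finite (paths Q)" "p \<in> paths Q"
  shows "path_sum Q (path_elt p) x y = (if hd p = x \<and> last p = y then 1 else 0)"
proof -
  have "finite (parallel_paths Q x y)" using assms(1) by (simp add: parallel_paths_def)
  then show ?thesis using assms(2) by (auto simp: path_sum_def path_elt_def parallel_paths_def)
qed

lemma path_sum_one:
  assumes "finite (paths Q)" "x \<in> verts Q" "y \<in> verts Q"
  shows "path_sum Q \<one>\<^bsub>path_algebra Q\<^esub> x y = (if x = y then 1 else 0 :: 'k::field)"
proof -
  have fin: "finite (parallel_paths Q x y)" using assms(1) by (simp add: parallel_paths_def)
  have eq: "\<one>\<^bsub>path_algebra Q\<^esub> p = (if p = [x] then if x = y then 1 else 0 else 0 :: 'k)"
    if "p \<in> parallel_paths Q x y" for p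
    using that assms by (auto simp: path_algebra_simps parallel_paths_def)
  have "path_sum Q \<one>\<^bsub>path_algebra Q\<^esub> x y =
      (\<Sum>p\<in>parallel_paths Q x y. if p = [x] then if x = y then 1 else 0 else 0 :: 'k)"
    unfolding path_sum_def by (rule sum.cong[OF refl eq])
  also have "\<dots> = (if x = y then 1 else 0)"
    using assms fin by (auto simp: sum.delta parallel_paths_def paths_def)
  finally show ?thesis .
qed

lemma path_sum_mult:
  fixes f g :: "'v list \<Rightarrow> 'k::field"
  assumes fin: "finite (paths Q)" and V: "finite (verts Q)"
  shows "path_sum Q (f \<otimes>\<^bsub>path_algebra Q\<^esub> g) x y = (\<Sum>z\<in>verts Q. path_sum Q f z y * path_sum Q g x z)"
proof -
  have finp: "finite (parallel_paths Q x y)" for x y using fin by (simp add: parallel_paths_def)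
  have "path_sum Q (f \<otimes>\<^bsub>path_algebra Q\<^esub> g) x y =
    (\<Sum>(p, i)\<in>(SIGMA p:parallel_paths Q x y. {..<length p}). f (drop i p) * g (take (Suc i) p))"
    by (simp add: path_sum_def path_algebra_simps sum.Sigma finp)
  also have "\<dots> = (\<Sum>(z, a, b)\<in>(SIGMA z:verts Q. parallel_paths Q z y \<times> parallel_paths Q x z). f a * g b)"
  proof (rule sum.reindex_bij_witness[where j = "\<lambda>(p, i). (p ! i, drop i p, take (Suc i) p)" and
        i = "\<lambda>(z, a, b). (b @ tl a, length b - 1)"])
    fix u assume "u \<in> (SIGMA p:parallel_paths Q x y. {..<length p})"
    then obtain p i where u: "u = (p, i)" and p: "p \<in> paths Q" "hd p = x" "last p = y" "i < length p"
      by (auto simp: parallel_paths_def)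
    note s = hd_last_split[OF p(4)]
    show "(case case u of (p, i) \<Rightarrow> (p ! i, drop i p, take (Suc i) p) of (z, a, b) \<Rightarrow> (b @ tl a, length b - 1)) = u"
      by (simp only: u prod.case s diff_Suc_1)
    have "p ! i \<in> verts Q" using p by (auto simp: paths_def)
    then show "(case u of (p, i) \<Rightarrow> (p ! i, drop i p, take (Suc i) p)) \<in>
        (SIGMA z:verts Q. parallel_paths Q z y \<times> parallel_paths Q x z)"
      using p path_split_iff[OF p(4), of Q] s by (simp add: u parallel_paths_def)
    show "(case case u of (p, i) \<Rightarrow> (p ! i, drop i p, take (Suc i) p) of (z, a, b) \<Rightarrow> f a * g b) =
        (case u of (p, i) \<Rightarrow> f (drop i p) * g (take (Suc i) p))"
      by (simp only: u prod.case)
  next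
    fix u assume "u \<in> (SIGMA z:verts Q. parallel_paths Q z y \<times> parallel_paths Q x z)"
    then obtain z a b where u: "u = (z, a, b)"
      and ab: "a \<in> paths Q" "b \<in> paths Q" "hd a = z" "last a = y" "hd b = x" "last b = z"
      by (auto simp: parallel_paths_def)
    then have ne: "a \<noteq> []" "b \<noteq> []" "last b = hd a" by (auto simp: paths_def)
    note j = join_split[OF ne]
    have a: "drop (length b - 1) (b @ tl a) = a" by (rule j)
    have b: "take (Suc (length b - 1)) (b @ tl a) = b" by (simp only: j)
    note s = hd_last_split[OF j(3), unfolded a b]
    have z: "(b @ tl a) ! (length b - 1) = z" using s(2) ab by simp
    show "(case case u of (z, a, b) \<Rightarrow> (b @ tl a, length b - 1) of (p, i) \<Rightarrow> (p ! i, drop i p, take (Suc i) p)) = u"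
      by (simp only: u prod.case a b z)
    have "b @ tl a \<in> paths Q" using ab(1,2) by (simp only: path_split_iff[OF j(3)] a b)
    then show "(case u of (z, a, b) \<Rightarrow> (b @ tl a, length b - 1)) \<in> (SIGMA p:parallel_paths Q x y. {..<length p})"
      using s(1,4) ab j(3) by (simp add: u parallel_paths_def)
  qed
  also have "\<dots> = (\<Sum>z\<in>verts Q. \<Sum>a\<in>parallel_paths Q z y. \<Sum>b\<in>parallel_paths Q x z. f a * g b)"
    using V finp by (simp add: sum.Sigma sum.cartesian_product)
  also have "\<dots> = (\<Sum>z\<in>verts Q. path_sum Q f z y * path_sum Q g x z)"
    by (simp add: path_sum_def sum_product)
  finally show ?thesis .
qed

section \<open>Incidence algebras\<close>

lemma verts_hasse [simp]: "verts (hasse_bquiver P po) = P"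
  and arrows_hasse: "arrows (hasse_bquiver P po) = hasse_arrows P po"
  by (simp_all add: hasse_bquiver_def Let_def)

lemma rels_hasse:
  assumes "(p, q) \<in> rels (hasse_bquiver P po)"
  shows "p \<in> paths (hasse_bquiver P po)" "q \<in> paths (hasse_bquiver P po)" "hd p = hd q" "last p = last q"
  using assms by (auto simp: hasse_bquiver_def Let_def paths_def)

lemma hasse_path_sorted:
  assumes po: "partial_order_on P po" and p: "p \<in> paths (hasse_bquiver P po)"
  shows "sorted_wrt (\<lambda>x y. x \<noteq> y \<and> (x, y) \<in> po) p"
proof -
  have "transp (\<lambda>x y. x \<noteq> y \<and> (x, y) \<in> po)"
    using partial_order_onD(2,3)[OF po] by (auto simp: transp_def trans_def antisym_def) 
  moreover have "successively (\<lambda>x y. x \<noteq> y \<and> (x, y) \<in> po) p"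
    using p by (auto simp: paths_def arrows_hasse hasse_arrows_def elim: successively_mono)
  ultimately show ?thesis using successively_conv_sorted_wrt by blast
qed

lemma finite_hasse_paths:
  assumes "finite P" "partial_order_on P po"
  shows "finite (paths (hasse_bquiver P po))"
proof (rule finite_subset[OF _ finite_subset_distinct[OF assms(1)]], clarify)
  fix p assume p: "p \<in> paths (hasse_bquiver P po)"
  have "distinct p"
    using hasse_path_sorted[OF assms(2) p] by (induction p) auto
  then show "set p \<subseteq> P \<and> distinct p" using p by (auto simp: paths_def)
qed

lemma hasse_path_po:
  assumes "partial_order_on P po" "p \<in> paths (hasse_bquiver P po)"
  shows "(hd p, last p) \<in> po"
proof (cases p)
  case (Cons x q)
  then show ?thesis
    using hasse_path_sorted[OF assms] assms partial_order_onD(1)[OF assms(1)]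
    by (cases q rule: rev_cases) (auto simp: paths_def refl_on_def)
qed (use assms in \<open>simp add: paths_def\<close>)

lemma hasse_path_rtrancl:
  assumes "p \<in> paths (hasse_bquiver P po)"
  shows "(hd p, last p) \<in> (hasse_arrows P po)\<^sup>*"
proof -
  have "p \<noteq> []" "successively (\<lambda>x y. (x, y) \<in> hasse_arrows P po) p"
    using assms by (auto simp: paths_def arrows_hasse)
  then show ?thesis
    by (induction p rule: induct_list012) (auto intro: converse_rtrancl_into_rtrancl)
qed

definition path_sum_kernel :: "'v bquiver \<Rightarrow> ('v list \<Rightarrow> 'k::field) set"
  where "path_sum_kernel Q = {f \<in> carrier (path_algebra Q). \<forall>x\<in>verts Q. \<forall>y\<in>verts Q. path_sum Q f x y = 0}"

lemma ideal_path_sum_kernel: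
  assumes fin: "finite (paths Q)" "finite (verts Q)"
  shows "ideal (path_sum_kernel Q :: ('v list \<Rightarrow> 'k::field) set) (path_algebra Q)"
proof (rule idealI)
  let ?R = "path_algebra Q :: ('v list \<Rightarrow> 'k) ring"
  interpret ring ?R by (rule ring_path_algebra[OF fin(2)])
  show "ring ?R" by (rule ring_axioms)
  show "subgroup (path_sum_kernel Q) (add_monoid ?R)"
  proof (rule subgroup.intro)
    fix f assume f: "f \<in> (path_sum_kernel Q :: ('v list \<Rightarrow> 'k) set)"
    then have fR: "f \<in> carrier ?R" by (simp add: path_sum_kernel_def)
    have "\<ominus>\<^bsub>?R\<^esub> f = (\<lambda>p. -1 * f p)"
      by (rule minus_equality) (use fR path_algebra_scale_closed[OF fR, of "-1"] in \<open>auto simp: path_algebra_simps\<close>)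
    moreover have "(\<lambda>p. -1 * f p) \<in> path_sum_kernel Q"
      using f path_algebra_scale_closed[OF fR, of "-1"] path_sum_scale[of Q "-1" f]
      by (simp add: path_sum_kernel_def)
    ultimately show "inv\<^bsub>add_monoid ?R\<^esub> f \<in> path_sum_kernel Q" by (simp add: a_inv_def)
  next
    fix f g assume "f \<in> (path_sum_kernel Q :: ('v list \<Rightarrow> 'k) set)" "g \<in> (path_sum_kernel Q :: ('v list \<Rightarrow> 'k) set)"
    then show "f \<otimes>\<^bsub>add_monoid ?R\<^esub> g \<in> path_sum_kernel Q"
      using path_algebra_add_closed[of f Q g] path_sum_add[of Q f g]
      by (simp add: path_sum_kernel_def path_algebra_simps(5))
  qed (auto simp: path_sum_kernel_def path_sum_def path_algebra_simps)
  fix f g assume "f \<in> (path_sum_kernel Q :: ('v list \<Rightarrow> 'k) set)" "g \<in> carrier ?R"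
  then show "g \<otimes>\<^bsub>?R\<^esub> f \<in> path_sum_kernel Q" "f \<otimes>\<^bsub>?R\<^esub> g \<in> path_sum_kernel Q"
    by (auto simp: path_sum_kernel_def path_sum_mult[OF fin])
qed

lemma path_elt_carrier: "p \<in> paths Q \<Longrightarrow> path_elt p \<in> carrier (path_algebra Q)"
  by (auto simp: path_algebra_simps path_elt_def)

lemma hasse_relations_kernel:
  assumes "finite P" "partial_order_on P po"
  defines "Q \<equiv> hasse_bquiver P po"
  shows "{\<lambda>r. path_elt p r - path_elt q r | p q. (p, q) \<in> rels Q} \<subseteq> (path_sum_kernel Q :: ('p list \<Rightarrow> 'k::field) set)"
proof clarify
  fix p q assume pq: "(p, q) \<in> rels Q"
  note pp = rels_hasse[OF pq[unfolded Q_def], folded Q_def]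
  have fin: "finite (paths Q)" unfolding Q_def by (rule finite_hasse_paths[OF assms(1,2)])
  have eq: "(\<lambda>r. path_elt p r - path_elt q r) = (\<lambda>r. path_elt p r + (-1) * path_elt q r :: 'k)" by simp
  have "(\<lambda>r. path_elt p r + (-1) * path_elt q r :: 'k) \<in> carrier (path_algebra Q)"
    by (intro path_algebra_add_closed path_algebra_scale_closed path_elt_carrier pp)
  moreover have "path_sum Q (\<lambda>r. path_elt p r + (-1) * path_elt q r :: 'k) x y = 0" for x y
    by (subst path_sum_add, subst path_sum_scale) (simp add: path_sum_path_elt[OF fin] pp)
  ultimately show "(\<lambda>r. path_elt p r - path_elt q r) \<in> (path_sum_kernel Q :: ('p list \<Rightarrow> 'k) set)"
    unfolding eq by (simp add: path_sum_kernel_def)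
qed

lemma bound_ideal_hasse:
  assumes fin: "finite P" and po: "partial_order_on P po"
  defines "Q \<equiv> hasse_bquiver P po"
  shows "ideal (bound_ideal Q :: ('p list \<Rightarrow> 'k::field) set) (path_algebra Q)"
    and "bound_ideal Q \<subseteq> (path_sum_kernel Q :: ('p list \<Rightarrow> 'k) set)"
proof -
  have finQ: "finite (paths Q)" "finite (verts Q)"
    unfolding Q_def using finite_hasse_paths[OF fin po] fin by simp_all
  interpret ring "path_algebra Q :: ('p list \<Rightarrow> 'k) ring" by (rule ring_path_algebra[OF finQ(2)])
  note rel = hasse_relations_kernel[OF fin po, where ?'k = 'k, folded Q_def]
  show "ideal (bound_ideal Q :: ('p list \<Rightarrow> 'k) set) (path_algebra Q)"
    unfolding bound_ideal_def by (rule genideal_ideal) (use rel in \<open>auto simp: path_sum_kernel_def\<close>)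
  show "bound_ideal Q \<subseteq> (path_sum_kernel Q :: ('p list \<Rightarrow> 'k) set)"
    unfolding bound_ideal_def by (rule genideal_minimal[OF ideal_path_sum_kernel[OF finQ] rel])
qed

section \<open>The module of a representation by subquotients\<close>

text \<open>
  The function \<open>lab\<close> numbers the vertices, for the encoding of families of vectors as single
  functions on \<^typ>\<open>nat\<close>.
\<close>

locale poset_rep =
  fixes P :: "'p set" and po :: "'p rel" and emb :: "'k::field \<Rightarrow> 'a::field"
    and n :: nat and X Y :: "'p \<Rightarrow> 'a subspaces" and lab :: "'p \<Rightarrow> nat"
  assumes finite_P: "finite P" and po: "partial_order_on P po" and lab: "inj_on lab P"
    and emb_add: "\<And>a b. emb (a + b) = emb a + emb b" and emb_mult: "\<And>a b. emb (a * b) = emb a * emb b"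
    and emb_one: "emb 1 = 1"
    and full: "full_rep (range emb) n P (hasse_arrows P po) X Y"
    and rigid: "scalar_rigid (range emb) n (X ` P \<union> Y ` P)"
    and nonzero: "\<exists>x\<in>P. \<forall>T. X x T \<noteq> Y x T"
begin

abbreviation "Q \<equiv> hasse_bquiver P po"

abbreviation PA :: "('p list \<Rightarrow> 'k) ring"
  where "PA \<equiv> path_algebra Q"

abbreviation I :: "('p list \<Rightarrow> 'k) set"
  where "I \<equiv> bound_ideal Q"

abbreviation R :: "('p list \<Rightarrow> 'k) set ring"
  where "R \<equiv> incidence_algebra P po"

lemma emb_zero: "emb 0 = 0"
  using emb_add[of 0 0] by (metis add.right_neutral add_left_cancel)

lemma emb_sum: "emb (sum f A) = (\<Sum>x\<in>A. emb (f x))"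
  by (induction A rule: infinite_finite_induct) (auto simp: emb_zero emb_add)

lemma rep: "subquotient_rep n P (hasse_arrows P po) X Y"
  using full by (simp add: full_rep_def)

lemmas sub = subquotient_repD[OF rep]

lemma finite_paths: "finite (paths Q)"
  by (rule finite_hasse_paths[OF finite_P po])

definition proj :: "'p \<Rightarrow> 'a \<Rightarrow> (nat \<Rightarrow> 'a) \<Rightarrow> nat \<Rightarrow> 'a"
  where "proj x T = (SOME e. Vector_Spaces.linear scl scl e \<and>
    (\<forall>v\<in>X x T. e v \<in> X x T \<and> v - e v \<in> Y x T) \<and> (\<forall>v\<in>Y x T. e v = 0))"

lemma proj_ex:
  assumes "x \<in> P"
  shows "Vector_Spaces.linear scl scl (proj x T) \<and>
    (\<forall>v\<in>X x T. proj x T v \<in> X x T \<and> v - proj x T v \<in> Y x T) \<and> (\<forall>v\<in>Y x T. proj x T v = 0)"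
    (is "?good (proj x T)")
proof -
  have "\<exists>e. ?good e"
    by (rule complement_projection[OF sub(1-3)[OF assms, of T]]) blast
  then have "?good (SOME e. ?good e)" by (rule someI_ex)
  then show ?thesis unfolding proj_def .
qed

lemma proj:
  assumes "x \<in> P"
  shows "v \<in> X x T \<Longrightarrow> proj x T v \<in> X x T" "v \<in> X x T \<Longrightarrow> v - proj x T v \<in> Y x T"
    "v \<in> Y x T \<Longrightarrow> proj x T v = 0"
  using proj_ex[OF assms, of T] by auto

lemma proj_linear:
  assumes "x \<in> P"
  shows "proj x T (v + w) = proj x T v + proj x T w" "proj x T (scl c v) = scl c (proj x T v)"
    "proj x T 0 = 0" "proj x T (v - w) = proj x T v - proj x T w"
proof -
  interpret e: Vector_Spaces.linear scl scl "proj x T" using proj_ex[OF assms] by blast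
  show "proj x T (v + w) = proj x T v + proj x T w" "proj x T (scl c v) = scl c (proj x T v)"
    "proj x T 0 = 0" "proj x T (v - w) = proj x T v - proj x T w"
    by (rule e.add e.scale e.zero e.diff)+
qed

lemma proj_sum: "x \<in> P \<Longrightarrow> proj x T (sum f A) = (\<Sum>a\<in>A. proj x T (f a))"
  by (induction A rule: infinite_finite_induct) (auto simp: proj_linear)

definition complement :: "'p \<Rightarrow> 'a \<Rightarrow> (nat \<Rightarrow> 'a) set"
  where "complement x T = {v \<in> X x T. proj x T v = v}"

lemma subspace_complement: "x \<in> P \<Longrightarrow> vec.subspace (complement x T)"
  using sub(1)[of x T] by (auto simp: complement_def vec.subspace_def proj_linear)

lemma complement_meets_Y: "x \<in> P \<Longrightarrow> v \<in> complement x T \<Longrightarrow> v \<in> Y x T \<Longrightarrow> v = 0"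
  using proj(3)[of x v T] by (simp add: complement_def)

lemma proj_complement: "x \<in> P \<Longrightarrow> v \<in> X x T \<Longrightarrow> proj x T v \<in> complement x T"
  using proj[of x v T] proj(3)[of x "v - proj x T v" T] by (simp add: complement_def proj_linear)

text \<open>
  This makes the action of paths multiplicative: projecting first to the complement at \<open>hd p\<close> changes
  \<open>v\<close> by an element of \<open>Y (hd p) \<subseteq> Y (last p)\<close>.
\<close>

lemma proj_proj:
  assumes "p \<in> paths Q" "v \<in> X (hd p) T"
  shows "proj (last p) T (proj (hd p) T v) = proj (last p) T v"
proof -
  have x: "hd p \<in> P" "last p \<in> P" using assms(1) by (auto simp: paths_def)
  have "v - proj (hd p) T v \<in> Y (last p) T"
    using proj(2)[OF x(1) assms(2)] subquotient_rep_rtrancl(2)[OF rep hasse_path_rtrancl[OF assms(1)]] by blast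
  then have "proj (last p) T (v - proj (hd p) T v) = 0" by (rule proj(3)[OF x(2)])
  then show ?thesis using proj_linear(4)[OF x(2)] by simp
qed

lemma path_X: "p \<in> paths Q \<Longrightarrow> v \<in> X (hd p) T \<Longrightarrow> v \<in> X (last p) T"
  using subquotient_rep_rtrancl(1)[OF rep hasse_path_rtrancl] by blast

lemma path_sum_path:
  assumes "path_sum Q f x y \<noteq> 0"
  obtains p where "p \<in> paths Q" "hd p = x" "last p = y"
  using assms by (auto simp: path_sum_def parallel_paths_def elim: sum.not_neutral_contains_not_neutral)

definition part :: "(nat \<Rightarrow> 'a) \<Rightarrow> 'p \<Rightarrow> nat \<Rightarrow> 'a"
  where "part m x = (\<lambda>i. m (prod_encode (lab x, i)))"

definition assemble :: "('p \<Rightarrow> nat \<Rightarrow> 'a) \<Rightarrow> nat \<Rightarrow> 'a"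
  where "assemble u = (\<lambda>j. case prod_decode j of (a, i) \<Rightarrow> if a \<in> lab ` P then u (inv_into P lab a) i else 0)"

lemma part_assemble [simp]: "x \<in> P \<Longrightarrow> part (assemble u) x = u x"
  by (auto simp: part_def assemble_def lab)

lemma part_linear: "part (m + m') x = part m x + part m' x" "part (scl c m) x = scl c (part m x)" "part 0 x = 0"
  by (auto simp: part_def fun_eq_iff scl_apply)

text \<open>
  The elements of the module are the families of vectors, one in the complement of \<open>Y x\<close> in \<open>X x\<close> for
  each vertex \<open>x\<close>.
\<close>

definition carr :: "'a \<Rightarrow> (nat \<Rightarrow> 'a) set"
  where "carr T = {m. (\<forall>x\<in>P. part m x \<in> complement x T) \<and> (\<forall>a i. a \<notin> lab ` P \<longrightarrow> m (prod_encode (a, i)) = 0)}"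

lemma assemble_outside: "a \<notin> lab ` P \<Longrightarrow> assemble u (prod_encode (a, i)) = 0"
  by (simp add: assemble_def)

lemma assemble_carr: "(\<And>x. x \<in> P \<Longrightarrow> u x \<in> complement x T) \<Longrightarrow> assemble u \<in> carr T"
  by (simp add: carr_def assemble_outside)

lemma carr_comp: "m \<in> carr T \<Longrightarrow> x \<in> P \<Longrightarrow> part m x \<in> complement x T"
  by (simp add: carr_def)

lemma carr_X: "m \<in> carr T \<Longrightarrow> x \<in> P \<Longrightarrow> part m x \<in> X x T"
  using carr_comp by (auto simp: complement_def)

lemma carr_eqI:
  assumes m: "m \<in> carr T" "m' \<in> carr S" and eq: "\<And>x. x \<in> P \<Longrightarrow> part m x = part m' x"
  shows "m = m'"
proof
  fix j
  obtain a i where j: "j = prod_encode (a, i)" by (metis prod_decode_inverse surj_pair)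
  show "m j = m' j"
  proof (cases "a \<in> lab ` P")
    case True
    then obtain x where "x \<in> P" "a = lab x" by auto
    then show ?thesis using fun_cong[OF eq, of x i] j by (simp add: part_def)
  qed (use m j in \<open>simp add: carr_def\<close>)
qed

lemma subspace_carr: "vec.subspace (carr T)"
  using subspace_complement[of _ T] unfolding vec.subspace_def carr_def
  by (auto simp: part_linear scl_apply)

text \<open>
  A path from \<open>x\<close> to \<open>y\<close> moves the vector at \<open>x\<close> to \<open>y\<close> and projects it to the complement there. As this
  depends on \<open>x\<close> and \<open>y\<close> only, the coefficients of parallel paths may be added up first.
\<close>

definition act :: "'a \<Rightarrow> ('p list \<Rightarrow> 'k) \<Rightarrow> (nat \<Rightarrow> 'a) \<Rightarrow> nat \<Rightarrow> 'a"
  where "act T f m = assemble (\<lambda>y. \<Sum>x\<in>P. scl (emb (path_sum Q f x y)) (proj y T (part m x)))"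

lemma part_act: "y \<in> P \<Longrightarrow> part (act T f m) y = (\<Sum>x\<in>P. scl (emb (path_sum Q f x y)) (proj y T (part m x)))"
  by (simp add: act_def)

lemma act_summand:
  assumes "m \<in> carr T" "x \<in> P" "y \<in> P"
  shows "scl (emb (path_sum Q f x y)) (proj y T (part m x)) \<in> complement y T"
proof (cases "path_sum Q f x y = 0")
  case True
  then show ?thesis using vec.subspace_0[OF subspace_complement[OF assms(3)]] by (simp add: emb_zero)
next
  case False
  then obtain p where p: "p \<in> paths Q" "hd p = x" "last p = y" by (rule path_sum_path)
  then have "part m x \<in> X y T" using path_X[of p "part m x" T] carr_X[OF assms(1,2)] by simp
  then show ?thesis
    by (intro vec.subspace_scale[OF subspace_complement] proj_complement assms)
qed

lemma act_carr: "m \<in> carr T \<Longrightarrow> act T f m \<in> carr T"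
  unfolding act_def
  by (intro assemble_carr vec.subspace_sum[OF subspace_complement] act_summand)

lemma act_cong: "(\<And>x y. x \<in> P \<Longrightarrow> y \<in> P \<Longrightarrow> path_sum Q f x y = path_sum Q g x y) \<Longrightarrow> m \<in> carr T \<Longrightarrow> act T f m = act T g m"
  by (rule carr_eqI[OF act_carr act_carr]) (auto simp: part_act)

lemma act_add_left:
  assumes "m \<in> carr T"
  shows "act T (\<lambda>p. f p + g p) m = act T f m + act T g m"
  by (rule carr_eqI[where T = T and S = T])
    (use assms in \<open>auto simp: act_carr vec.subspace_add[OF subspace_carr] part_act part_linear path_sum_add
      emb_add vec.scale_left_distrib sum.distrib\<close>)

lemma act_add_right:
  assumes "m \<in> carr T" "m' \<in> carr T"
  shows "act T f (m + m') = act T f m + act T f m'"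
  by (rule carr_eqI[where T = T and S = T])
    (use assms in \<open>auto simp: act_carr vec.subspace_add[OF subspace_carr] part_act part_linear proj_linear
      vec.scale_right_distrib sum.distrib\<close>)

lemma act_scl:
  assumes "m \<in> carr T"
  shows "act T f (scl c m) = scl c (act T f m)"
  by (rule carr_eqI[where T = T and S = T])
    (use assms in \<open>auto simp: act_carr vec.subspace_scale[OF subspace_carr] part_act part_linear proj_linear
      vec.scale_sum_right mult.commute\<close>)

lemma act_mult:
  assumes m: "m \<in> carr T"
  shows "act T (f \<otimes>\<^bsub>PA\<^esub> g) m = act T f (act T g m)"
proof (rule carr_eqI[OF act_carr act_carr])
  show "m \<in> carr T" "act T g m \<in> carr T" using m act_carr by auto
  fix y assume y: "y \<in> P"
  let ?S = "path_sum Q"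
  have key: "scl (emb (?S f z y)) (proj y T (scl (emb (?S g x z)) (proj z T (part m x)))) =
      scl (emb (?S f z y * ?S g x z)) (proj y T (part m x))" if "x \<in> P" "z \<in> P" for x z
  proof (cases "?S g x z = 0")
    case False
    then obtain q where q: "q \<in> paths Q" "hd q = x" "last q = z" by (rule path_sum_path)
    show ?thesis
    proof (cases "?S f z y = 0")
      case False
      then obtain p where p: "p \<in> paths Q" "hd p = z" "last p = y" by (rule path_sum_path)
      have xz: "part m x \<in> X z T" using path_X[of q "part m x" T] q carr_X[OF m that(1)] by simp
      have "proj y T (proj z T (part m x)) = proj y T (part m x)"
        using proj_proj[of p "part m x" T] xz p by simp
      then show ?thesis by (simp add: proj_linear y emb_mult)
    qed (simp add: emb_zero)
  qed (simp add: emb_zero proj_linear y)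
  have "part (act T (f \<otimes>\<^bsub>PA\<^esub> g) m) y =
      (\<Sum>x\<in>P. \<Sum>z\<in>P. scl (emb (?S f z y * ?S g x z)) (proj y T (part m x)))"
    using y by (simp add: part_act path_sum_mult finite_paths finite_P emb_sum vec.scale_sum_left)
  also have "\<dots> = (\<Sum>x\<in>P. \<Sum>z\<in>P. scl (emb (?S f z y)) (proj y T (scl (emb (?S g x z)) (proj z T (part m x)))))"
    by (intro sum.cong refl) (simp add: key)
  also have "\<dots> = (\<Sum>z\<in>P. \<Sum>x\<in>P. scl (emb (?S f z y)) (proj y T (scl (emb (?S g x z)) (proj z T (part m x)))))"
    by (rule sum.swap)
  also have "\<dots> = part (act T f (act T g m)) y"
    using y by (simp add: part_act proj_sum vec.scale_sum_right)
  finally show "part (act T (f \<otimes>\<^bsub>PA\<^esub> g) m) y = part (act T f (act T g m)) y" .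
qed

lemma act_one:
  assumes m: "m \<in> carr T"
  shows "act T (\<lambda>p. c * \<one>\<^bsub>PA\<^esub> p) m = scl (emb c) m"
proof (rule carr_eqI[OF act_carr[OF m] vec.subspace_scale[OF subspace_carr m]])
  fix y assume y: "y \<in> P"
  have "part (act T (\<lambda>p. c * \<one>\<^bsub>PA\<^esub> p) m) y =
      (\<Sum>x\<in>P. if x = y then scl (emb c) (proj y T (part m x)) else 0)"
    unfolding part_act[OF y] using y
    by (intro sum.cong refl) (auto simp: path_sum_scale path_sum_one[OF finite_paths] emb_zero)
  also have "\<dots> = scl (emb c) (part m y)"
    using y finite_P carr_comp[OF m y] by (simp add: complement_def)
  finally show "part (act T (\<lambda>p. c * \<one>\<^bsub>PA\<^esub> p) m) y = part (scl (emb c) m) y" by (simp add: part_linear)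
qed

lemma act_path:
  assumes m: "m \<in> carr T" and p: "p \<in> paths Q" and y: "y \<in> P"
  shows "part (act T (path_elt p) m) y = (if last p = y then proj y T (part m (hd p)) else 0)"
proof -
  have "part (act T (path_elt p) m) y = (\<Sum>x\<in>P. if x = hd p then if last p = y then proj y T (part m x) else 0 else 0)"
    unfolding part_act[OF y]
    by (intro sum.cong refl) (auto simp: path_sum_path_elt[OF finite_paths p] emb_zero emb_one)
  also have "\<dots> = (if last p = y then proj y T (part m (hd p)) else 0)"
  proof -
    have "hd p \<in> P" using p by (auto simp: paths_def)
    then show ?thesis using finite_P by simp
  qed
  finally show ?thesis .
qed

definition rep_module :: "'a \<Rightarrow> (('p list \<Rightarrow> 'k) set, nat \<Rightarrow> 'a) module"
  where "rep_module T = \<lparr>carrier = carr T, monoid.mult = \<lambda>_ _. 0, one = 0, zero = 0, add = (+),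
    module.smult = \<lambda>c. act T (SOME f. f \<in> c)\<rparr>"

lemma rep_module_simps [simp]:
  "carrier (rep_module T) = carr T" "\<zero>\<^bsub>rep_module T\<^esub> = 0" "m \<oplus>\<^bsub>rep_module T\<^esub> m' = m + m'"
  by (simp_all add: rep_module_def)

sublocale idl: ideal I PA
  by (rule bound_ideal_hasse(1)[OF finite_P po])

lemma R_carrier: "carrier R = (\<lambda>f. I +>\<^bsub>PA\<^esub> f) ` carrier PA"
  by (auto simp: incidence_algebra_def bound_algebra_def FactRing_def A_RCOSETS_def')

text \<open>
  The action of a coset is that of any representative, because the ideal is contained in the kernel of
  the sums over parallel paths.
\<close>

lemma smult_coset:
  assumes f: "f \<in> carrier PA" and m: "m \<in> carr T"
  shows "(I +>\<^bsub>PA\<^esub> f) \<odot>\<^bsub>rep_module T\<^esub> m = act T f m"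
proof -
  define g where "g = (SOME g. g \<in> I +>\<^bsub>PA\<^esub> f)"
  have "f \<in> I +>\<^bsub>PA\<^esub> f" using f by (rule idl.a_rcos_self)
  then have "g \<in> I +>\<^bsub>PA\<^esub> f" unfolding g_def by (rule someI[where P = "\<lambda>g. g \<in> I +>\<^bsub>PA\<^esub> f"])
  then obtain h where h: "h \<in> I" "g = h \<oplus>\<^bsub>PA\<^esub> f" by (auto simp: a_r_coset_def')
  then have "h \<in> path_sum_kernel Q" using bound_ideal_hasse(2)[OF finite_P po] by blast
  then have "path_sum Q g x y = path_sum Q f x y" if "x \<in> P" "y \<in> P" for x y
    using that by (simp add: h path_algebra_simps(5) path_sum_add path_sum_kernel_def)
  then have "act T g m = act T f m" using m by (intro act_cong)
  then show ?thesis by (simp add: rep_module_def g_def)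
qed

lemma left_module_rep_module: "left_module R (rep_module T)"
proof (intro left_module.intro left_module_axioms.intro)
  show "ring R" using idl.quotient_is_ring by (simp add: incidence_algebra_def bound_algebra_def)
  show "abelian_group (rep_module T)"
  proof (rule abelian_groupI)
    fix m assume "m \<in> carrier (rep_module T)"
    then show "\<exists>m'\<in>carrier (rep_module T). m' \<oplus>\<^bsub>rep_module T\<^esub> m = \<zero>\<^bsub>rep_module T\<^esub>"
      by (intro bexI[of _ "- m"]) (auto simp: vec.subspace_neg[OF subspace_carr])
  qed (auto simp: vec.subspace_add[OF subspace_carr] vec.subspace_0[OF subspace_carr] add.assoc add.commute)
  fix a m assume "a \<in> carrier R" and "m \<in> carrier (rep_module T)"
  then obtain f where f: "f \<in> carrier PA" "a = I +>\<^bsub>PA\<^esub> f" and m: "m \<in> carr T" by (auto simp: R_carrier)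
  show "a \<odot>\<^bsub>rep_module T\<^esub> m \<in> carrier (rep_module T)"
    using f m by (simp add: smult_coset act_carr)
  {
    fix m' assume "m' \<in> carrier (rep_module T)"
    then show "a \<odot>\<^bsub>rep_module T\<^esub> (m \<oplus>\<^bsub>rep_module T\<^esub> m') = a \<odot>\<^bsub>rep_module T\<^esub> m \<oplus>\<^bsub>rep_module T\<^esub> a \<odot>\<^bsub>rep_module T\<^esub> m'"
      using f m by (simp add: smult_coset act_add_right vec.subspace_add[OF subspace_carr])
  }
  fix b assume "b \<in> carrier R"
  then obtain g where g: "g \<in> carrier PA" "b = I +>\<^bsub>PA\<^esub> g" by (auto simp: R_carrier)
  have "a \<oplus>\<^bsub>R\<^esub> b = I +>\<^bsub>PA\<^esub> (f \<oplus>\<^bsub>PA\<^esub> g)" "a \<otimes>\<^bsub>R\<^esub> b = I +>\<^bsub>PA\<^esub> (f \<otimes>\<^bsub>PA\<^esub> g)"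
    using f g by (simp_all add: incidence_algebra_def bound_algebra_def FactRing_def idl.a_rcos_sum idl.rcoset_mult_add)
  then show "(a \<oplus>\<^bsub>R\<^esub> b) \<odot>\<^bsub>rep_module T\<^esub> m = a \<odot>\<^bsub>rep_module T\<^esub> m \<oplus>\<^bsub>rep_module T\<^esub> b \<odot>\<^bsub>rep_module T\<^esub> m"
    "(a \<otimes>\<^bsub>R\<^esub> b) \<odot>\<^bsub>rep_module T\<^esub> m = a \<odot>\<^bsub>rep_module T\<^esub> (b \<odot>\<^bsub>rep_module T\<^esub> m)"
    using f g m smult_coset[of "f \<oplus>\<^bsub>PA\<^esub> g" m T] smult_coset[of "f \<otimes>\<^bsub>PA\<^esub> g" m T]
    by (simp_all add: smult_coset act_carr act_mult path_algebra_mult_closed path_algebra_add_closed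
        path_algebra_simps(5) act_add_left)
next
  fix m assume "m \<in> carrier (rep_module T)"
  then have m: "m \<in> carr T" by simp
  have "\<one>\<^bsub>R\<^esub> = I +>\<^bsub>PA\<^esub> \<one>\<^bsub>PA\<^esub>" by (simp add: incidence_algebra_def bound_algebra_def FactRing_def)
  then show "\<one>\<^bsub>R\<^esub> \<odot>\<^bsub>rep_module T\<^esub> m = m"
    using act_one[OF m, of 1] smult_coset[OF idl.one_closed m] by (simp add: emb_one)
qed

end

section \<open>Endomorphism rings\<close>

lemma End_ring_simps:
  "carrier (End_ring R M) = lmod_hom R M M"
  "f \<otimes>\<^bsub>End_ring R M\<^esub> g = compose (carrier M) f g"
  "\<one>\<^bsub>End_ring R M\<^esub> = (\<lambda>x\<in>carrier M. x)"
  "\<zero>\<^bsub>End_ring R M\<^esub> = (\<lambda>x\<in>carrier M. \<zero>\<^bsub>M\<^esub>)"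
  "f \<oplus>\<^bsub>End_ring R M\<^esub> g = (\<lambda>x\<in>carrier M. f x \<oplus>\<^bsub>M\<^esub> g x)"
  by (simp_all add: End_ring_def)

lemma (in left_module) smult_zero: "a \<in> carrier R \<Longrightarrow> a \<odot>\<^bsub>M\<^esub> \<zero>\<^bsub>M\<^esub> = \<zero>\<^bsub>M\<^esub>"
  using smult_r_distr[of a "\<zero>\<^bsub>M\<^esub>" "\<zero>\<^bsub>M\<^esub>"] smult_closed[of a "\<zero>\<^bsub>M\<^esub>"] by (simp add: M.add.r_cancel_one)

lemma (in left_module) smult_minus: "a \<in> carrier R \<Longrightarrow> x \<in> carrier M \<Longrightarrow> a \<odot>\<^bsub>M\<^esub> (\<ominus>\<^bsub>M\<^esub> x) = \<ominus>\<^bsub>M\<^esub> (a \<odot>\<^bsub>M\<^esub> x)"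
  using smult_r_distr[of a "\<ominus>\<^bsub>M\<^esub> x" x]
  by (intro M.minus_equality[symmetric]) (simp_all add: smult_closed smult_zero M.l_neg)

lemma ring_End_ring:
  fixes R :: "'r ring" and M :: "('r, 'm) module"
  assumes "left_module R M"
  shows "ring (End_ring R M)"
proof (rule ringI)
  interpret left_module R M by (rule assms)
  let ?E = "End_ring R M"
  have ext: "f = g" if "f \<in> carrier M \<rightarrow>\<^sub>E A" "g \<in> carrier M \<rightarrow>\<^sub>E B" "\<And>x. x \<in> carrier M \<Longrightarrow> f x = g x" for f g :: "'m \<Rightarrow> 'm" and A B
    using that by (auto intro: extensionalityI simp: PiE_def)
  have hom: "f \<in> carrier M \<rightarrow>\<^sub>E carrier M" "x \<in> carrier M \<Longrightarrow> f x \<in> carrier M"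
    "x \<in> carrier M \<Longrightarrow> y \<in> carrier M \<Longrightarrow> f (x \<oplus>\<^bsub>M\<^esub> y) = f x \<oplus>\<^bsub>M\<^esub> f y"
    "a \<in> carrier R \<Longrightarrow> x \<in> carrier M \<Longrightarrow> f (a \<odot>\<^bsub>M\<^esub> x) = a \<odot>\<^bsub>M\<^esub> f x" if "f \<in> carrier ?E" for f x y a
    using that by (auto simp: End_ring_simps lmod_hom_def)
  have homI: "(\<lambda>x\<in>carrier M. f x) \<in> carrier ?E"
    if "\<And>x. x \<in> carrier M \<Longrightarrow> f x \<in> carrier M"
      "\<And>x y. x \<in> carrier M \<Longrightarrow> y \<in> carrier M \<Longrightarrow> f (x \<oplus>\<^bsub>M\<^esub> y) = f x \<oplus>\<^bsub>M\<^esub> f y"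
      "\<And>a x. a \<in> carrier R \<Longrightarrow> x \<in> carrier M \<Longrightarrow> f (a \<odot>\<^bsub>M\<^esub> x) = a \<odot>\<^bsub>M\<^esub> f x" for f
    using that by (auto simp: End_ring_simps lmod_hom_def smult_closed)
  show "abelian_group ?E"
  proof (rule abelian_groupI)
    fix f g assume fg: "f \<in> carrier ?E" "g \<in> carrier ?E"
    show "f \<oplus>\<^bsub>?E\<^esub> g \<in> carrier ?E"
      unfolding End_ring_simps(5)
      by (rule homI) (use hom[OF fg(1)] hom[OF fg(2)] in \<open>simp_all add: M.a_ac smult_r_distr smult_closed\<close>)
    show "f \<oplus>\<^bsub>?E\<^esub> g = g \<oplus>\<^bsub>?E\<^esub> f"
      using hom(2)[OF fg(1)] hom(2)[OF fg(2)] by (auto simp: End_ring_simps M.a_comm fun_eq_iff restrict_def)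
    fix h assume h: "h \<in> carrier ?E"
    show "f \<oplus>\<^bsub>?E\<^esub> g \<oplus>\<^bsub>?E\<^esub> h = f \<oplus>\<^bsub>?E\<^esub> (g \<oplus>\<^bsub>?E\<^esub> h)"
      using hom(2)[OF fg(1)] hom(2)[OF fg(2)] hom(2)[OF h] by (auto simp: End_ring_simps M.a_assoc fun_eq_iff restrict_def)
  next
    show "\<zero>\<^bsub>?E\<^esub> \<in> carrier ?E"
      unfolding End_ring_simps(4) by (rule homI) (simp_all add: smult_zero)
    fix f assume f: "f \<in> carrier ?E"
    show "\<zero>\<^bsub>?E\<^esub> \<oplus>\<^bsub>?E\<^esub> f = f"
      by (rule ext[OF _ hom(1)[OF f]]) (use hom(2)[OF f] in \<open>auto simp: End_ring_simps\<close>)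
    have "(\<lambda>x\<in>carrier M. \<ominus>\<^bsub>M\<^esub> f x) \<in> carrier ?E"
      by (rule homI) (use hom[OF f] in \<open>simp_all add: M.minus_add smult_minus smult_closed\<close>)
    moreover have "(\<lambda>x\<in>carrier M. \<ominus>\<^bsub>M\<^esub> f x) \<oplus>\<^bsub>?E\<^esub> f = \<zero>\<^bsub>?E\<^esub>"
      using hom(2)[OF f] by (auto simp: End_ring_simps M.l_neg fun_eq_iff restrict_def)
    ultimately show "\<exists>g\<in>carrier ?E. g \<oplus>\<^bsub>?E\<^esub> f = \<zero>\<^bsub>?E\<^esub>" by blast
  qed
  show "monoid ?E"
  proof (rule monoidI)
    show "\<one>\<^bsub>?E\<^esub> \<in> carrier ?E"
      unfolding End_ring_simps(3) by (rule homI) simp_all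
    fix f g assume fg: "f \<in> carrier ?E" "g \<in> carrier ?E"
    show "f \<otimes>\<^bsub>?E\<^esub> g \<in> carrier ?E"
      unfolding End_ring_simps(2) compose_def
      by (rule homI) (use hom[OF fg(1)] hom[OF fg(2)] in simp_all)
    fix h assume h: "h \<in> carrier ?E"
    show "f \<otimes>\<^bsub>?E\<^esub> g \<otimes>\<^bsub>?E\<^esub> h = f \<otimes>\<^bsub>?E\<^esub> (g \<otimes>\<^bsub>?E\<^esub> h)"
      using hom(2)[OF h] by (auto simp: End_ring_simps compose_def fun_eq_iff restrict_def)
  next
    fix f assume f: "f \<in> carrier ?E"
    show "\<one>\<^bsub>?E\<^esub> \<otimes>\<^bsub>?E\<^esub> f = f" "f \<otimes>\<^bsub>?E\<^esub> \<one>\<^bsub>?E\<^esub> = f"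
      by (rule ext[OF _ hom(1)[OF f]]; use hom(2)[OF f] in \<open>auto simp: End_ring_simps compose_def\<close>)+
  qed
  fix f g h assume f: "f \<in> carrier ?E" and g: "g \<in> carrier ?E" and h: "h \<in> carrier ?E"
  show "(f \<oplus>\<^bsub>?E\<^esub> g) \<otimes>\<^bsub>?E\<^esub> h = f \<otimes>\<^bsub>?E\<^esub> h \<oplus>\<^bsub>?E\<^esub> g \<otimes>\<^bsub>?E\<^esub> h"
    "h \<otimes>\<^bsub>?E\<^esub> (f \<oplus>\<^bsub>?E\<^esub> g) = h \<otimes>\<^bsub>?E\<^esub> f \<oplus>\<^bsub>?E\<^esub> h \<otimes>\<^bsub>?E\<^esub> g"
    using hom(2)[OF f] hom(2)[OF g] hom(2)[OF h] hom(3)[OF h]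
    by (auto simp: End_ring_simps compose_def fun_eq_iff restrict_def)
qed

section \<open>Homomorphisms between the modules\<close>

context poset_rep
begin

definition place :: "'p \<Rightarrow> (nat \<Rightarrow> 'a) \<Rightarrow> nat \<Rightarrow> 'a"
  where "place x c = assemble (\<lambda>y. if y = x then c else 0)"

lemma part_place: "y \<in> P \<Longrightarrow> part (place x c) y = (if y = x then c else 0)"
  by (simp add: place_def)

lemma place_carr: "x \<in> P \<Longrightarrow> c \<in> complement x T \<Longrightarrow> place x c \<in> carr T"
  unfolding place_def by (rule assemble_carr) (auto simp: vec.subspace_0[OF subspace_complement])

lemma place_linear: "place x (c + d) = place x c + place x d" "place x (scl a c) = scl a (place x c)" "place x 0 = 0"
  by (auto simp: place_def assemble_def fun_eq_iff scl_apply split: prod.splits)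

lemma vertex_path: "x \<in> P \<Longrightarrow> [x] \<in> paths Q"
  by (simp add: paths_def)

lemma act_vertex:
  assumes m: "m \<in> carr T" and x: "x \<in> P"
  shows "act T (path_elt [x]) m = place x (part m x)"
proof (rule carr_eqI[OF act_carr[OF m] place_carr[OF x carr_comp[OF m x]]])
  fix y assume "y \<in> P"
  then show "part (act T (path_elt [x]) m) y = part (place x (part m x)) y"
    using carr_comp[OF m x] by (simp add: act_path[OF m vertex_path[OF x]] part_place complement_def)
qed

lemma part_act_arrow:
  assumes m: "m \<in> carr T" and xy: "(x, y) \<in> hasse_arrows P po"
  shows "act T (path_elt [x, y]) m = place y (proj y T (part m x))"
proof -
  have P: "x \<in> P" "y \<in> P" using sub(5)[OF xy] by auto
  have path: "[x, y] \<in> paths Q" using P xy by (simp add: paths_def arrows_hasse)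
  have "proj y T (part m x) \<in> complement y T"
    using proj_complement[OF P(2)] sub(6)[OF xy] carr_X[OF m P(1)] by blast
  then show ?thesis
    by (intro carr_eqI[OF act_carr[OF m] place_carr[OF P(2)]])
      (auto simp: act_path[OF m path] part_place)
qed

lemma hom_facts:
  assumes h: "h \<in> lmod_hom R (rep_module T) (rep_module S)"
  shows "m \<in> carr T \<Longrightarrow> h m \<in> carr S"
    and "m \<in> carr T \<Longrightarrow> m' \<in> carr T \<Longrightarrow> h (m + m') = h m + h m'"
    and "f \<in> carrier PA \<Longrightarrow> m \<in> carr T \<Longrightarrow> h (act T f m) = act S f (h m)"
    and "m \<in> carr T \<Longrightarrow> h (scl (emb c) m) = scl (emb c) (h m)"
    and "h 0 = 0"
proof -
  show 1: "m \<in> carr T \<Longrightarrow> h m \<in> carr S" for m using h by (auto simp: lmod_hom_def)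
  show 2: "m \<in> carr T \<Longrightarrow> m' \<in> carr T \<Longrightarrow> h (m + m') = h m + h m'" for m m'
    using h by (auto simp: lmod_hom_def)
  show 3: "h (act T f m) = act S f (h m)" if "f \<in> carrier PA" "m \<in> carr T" for f m
  proof -
    have "I +>\<^bsub>PA\<^esub> f \<in> carrier R" using that(1) by (auto simp: R_carrier)
    then have "h ((I +>\<^bsub>PA\<^esub> f) \<odot>\<^bsub>rep_module T\<^esub> m) = (I +>\<^bsub>PA\<^esub> f) \<odot>\<^bsub>rep_module S\<^esub> h m"
      using h that(2) by (auto simp: lmod_hom_def)
    then show ?thesis using that 1 by (simp add: smult_coset)
  qed
  show "m \<in> carr T \<Longrightarrow> h (scl (emb c) m) = scl (emb c) (h m)"
    using 3[OF path_algebra_scale_closed[OF idl.one_closed], of m c] act_one[of m T c] act_one[of "h m" S c] 1[of m]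
    by simp
  have "(0 :: nat \<Rightarrow> 'a) \<in> carr T" by (rule vec.subspace_0[OF subspace_carr])
  from 2[OF this this] show "h 0 = 0" by simp
qed

definition family_of :: "((nat \<Rightarrow> 'a) \<Rightarrow> nat \<Rightarrow> 'a) \<Rightarrow> 'a \<Rightarrow> 'p \<Rightarrow> (nat \<Rightarrow> 'a) \<Rightarrow> nat \<Rightarrow> 'a"
  where "family_of h T x v = part (h (place x (proj x T v))) x"

lemma family_of_complement:
  assumes h: "h \<in> lmod_hom R (rep_module T) (rep_module S)" and x: "x \<in> P" and v: "v \<in> X x T"
  shows "family_of h T x v \<in> complement x S"
  unfolding family_of_def
  by (intro carr_comp[OF hom_facts(1)[OF h]] place_carr proj_complement x v)

lemma part_hom:
  assumes h: "h \<in> lmod_hom R (rep_module T) (rep_module S)" and x: "x \<in> P" and m: "m \<in> carr T"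
  shows "part (h m) x = family_of h T x (part m x)"
proof -
  have "act S (path_elt [x]) (h m) = h (place x (part m x))"
    using hom_facts(3)[OF h path_elt_carrier[OF vertex_path[OF x]] m] act_vertex[OF m x] by simp
  then have "part (h m) x = part (h (place x (part m x))) x"
    using act_vertex[OF hom_facts(1)[OF h m] x] by (metis part_place x)
  then show ?thesis using carr_comp[OF m x] by (simp add: family_of_def complement_def)
qed

text \<open>
  A homomorphism commutes with the idempotents of the vertices, hence acts on each vertex separately,
  and it commutes with the arrows, hence is natural.
\<close>

lemma natural_family_of:
  assumes h: "h \<in> lmod_hom R (rep_module T) (rep_module S)"
  shows "natural_family (range emb) P (hasse_arrows P po) X Y T S (family_of h T)"
  unfolding natural_family_def
proof (intro conjI ballI allI impI)
  fix x assume x: "x \<in> P"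
  have carr: "place x (proj x T v) \<in> carr T" if "v \<in> X x T" for v
    by (intro place_carr proj_complement x that)
  show "linear_on (range emb) (X x T) (family_of h T x)"
    unfolding linear_on_def
    by (auto simp: family_of_def proj_linear[OF x] place_linear part_linear hom_facts(2,4)[OF h] carr)
  show "family_of h T x ` X x T \<subseteq> X x S"
    using family_of_complement[OF h x] by (auto simp: complement_def)
  show "family_of h T x ` Y x T \<subseteq> Y x S"
    using proj(3)[OF x] vec.subspace_0[OF sub(2)[OF x]]
    by (auto simp: family_of_def place_linear hom_facts(5)[OF h] part_linear)
next
  fix x y v assume xy: "(x, y) \<in> hasse_arrows P po" and v: "v \<in> X x T"
  have P: "x \<in> P" "y \<in> P" using sub(5)[OF xy] by auto
  have path: "[x, y] \<in> paths Q" using P xy by (simp add: paths_def arrows_hasse)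
  let ?m = "place x (proj x T v)"
  have m: "?m \<in> carr T" by (intro place_carr proj_complement P v)
  have "h (act T (path_elt [x, y]) ?m) = act S (path_elt [x, y]) (h ?m)"
    by (rule hom_facts(3)[OF h path_elt_carrier[OF path] m])
  then have "h (place y (proj y T (proj x T v))) = place y (proj y S (part (h ?m) x))"
    using part_act_arrow[OF m xy] part_act_arrow[OF hom_facts(1)[OF h m] xy] P by (simp add: part_place)
  moreover have "proj y T (proj x T v) = proj y T v"
    using proj_proj[OF path, of v T] v by simp
  ultimately have eq: "family_of h T y v = proj y S (family_of h T x v)"
    using P by (simp add: family_of_def part_place)
  have "family_of h T x v \<in> X y S"
    using family_of_complement[OF h P(1) v] sub(6)[OF xy] by (auto simp: complement_def)
  from vec.subspace_neg[OF sub(2)[OF P(2)] proj(2)[OF P(2) this]]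
  show "family_of h T y v - family_of h T x v \<in> Y y S" by (simp add: eq)
qed

lemma hom_induced:
  assumes h: "h \<in> lmod_hom R (rep_module T) (rep_module S)"
  obtains \<phi> where "\<And>x y. \<phi> (x + y) = \<phi> x + \<phi> y" "\<And>c x. \<phi> (emb c * x) = emb c * \<phi> x"
    "\<And>x. \<phi> (T * x) = S * \<phi> x"
    "\<And>x v. x \<in> P \<Longrightarrow> v \<in> X x T \<Longrightarrow> (\<lambda>i. \<phi> (v i)) - family_of h T x v \<in> Y x S"
proof -
  obtain f where f: "induces (range emb) n P X Y T S f (family_of h T)"
    using full natural_family_of[OF h] unfolding full_rep_def by blast
  have pres: "\<forall>H\<in>X ` P \<union> Y ` P. preserves f T S H"
    using induces_preserves[OF rep natural_family_of[OF h] f] by auto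
  have lin: "linear_on (range emb) (coord_space n) f" "f ` coord_space n \<subseteq> coord_space n"
    using f by (auto simp: induces_def)
  obtain \<phi> where phi: "\<forall>w\<in>coord_space n. f w = (\<lambda>i. \<phi> (w i))" "\<forall>x y. \<phi> (x + y) = \<phi> x + \<phi> y"
      "\<forall>c\<in>range emb. \<forall>x. \<phi> (c * x) = c * \<phi> x" "\<forall>x. \<phi> (T * x) = S * \<phi> x"
    using rigid[unfolded scalar_rigid_def, rule_format, OF lin] pres unfolding scalar_map_def by blast
  show thesis
  proof (rule that[of \<phi>])
    fix x v assume x: "x \<in> P" and v: "v \<in> X x T"
    have "f v = (\<lambda>i. \<phi> (v i))" using phi(1) sub(4)[OF x] v by blast
    moreover have "f v - family_of h T x v \<in> Y x S" using f x v by (simp add: induces_def)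
    ultimately show "(\<lambda>i. \<phi> (v i)) - family_of h T x v \<in> Y x S" by simp
  qed (use phi in auto)
qed

text \<open>
  The map \<open>\<phi>\<close> that governs a homomorphism is multiplication by some \<open>a\<close> with \<open>T a = S a\<close>, once \<open>K\<close> has
  only such additive maps. At each vertex the homomorphism and multiplication by \<open>a\<close> agree modulo \<open>Y\<close>,
  and they are equal because both take values in a complement of \<open>Y\<close>.
\<close>

lemma hom_scalar:
  assumes h: "h \<in> lmod_hom R (rep_module T) (rep_module S)"
    and phi: "\<And>\<phi>. (\<And>x y. \<phi> (x + y) = \<phi> x + \<phi> y) \<Longrightarrow> (\<And>c x. \<phi> (emb c * x) = emb c * \<phi> x) \<Longrightarrow>
      (\<And>x. \<phi> (T * x) = S * \<phi> x) \<Longrightarrow> \<exists>a. \<forall>x. \<phi> x = a * x"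
  shows "\<exists>a. T * a = S * a \<and> (\<forall>m\<in>carr T. h m = scl a m)"
proof -
  obtain \<phi> where f: "\<And>x y. \<phi> (x + y) = \<phi> x + \<phi> y" "\<And>c x. \<phi> (emb c * x) = emb c * \<phi> x"
    "\<And>x. \<phi> (T * x) = S * \<phi> x"
    "\<And>x v. x \<in> P \<Longrightarrow> v \<in> X x T \<Longrightarrow> (\<lambda>i. \<phi> (v i)) - family_of h T x v \<in> Y x S"
    by (rule hom_induced[OF h]) blast
  obtain a where a: "\<And>x. \<phi> x = a * x" using phi[OF f(1-3)] by auto
  have aT: "T * a = S * a" using f(3)[of 1] a[of T] a[of 1] by (simp add: mult.commute)
  have "h m = scl a m" if m: "m \<in> carr T" for m
  proof (rule carr_eqI)
    have "scl a m \<in> carr S"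
    proof (cases "a = 0")
      case False
      then have "T = S" using aT by simp
      then show ?thesis using vec.subspace_scale[OF subspace_carr m] by simp
    qed (simp add: vec.subspace_0[OF subspace_carr])
    then show "scl a m \<in> carr S" .
    show "h m \<in> carr S" by (rule hom_facts(1)[OF h m])
    fix x assume x: "x \<in> P"
    have "(\<lambda>i. \<phi> (part m x i)) = scl a (part m x)" by (simp add: a scl_def)
    then have "scl a (part m x) - part (h m) x \<in> Y x S"
      using f(4)[OF x carr_X[OF m x]] part_hom[OF h x m] by simp
    moreover have "scl a (part m x) - part (h m) x \<in> complement x S"
      using carr_comp[OF \<open>scl a m \<in> carr S\<close> x] carr_comp[OF \<open>h m \<in> carr S\<close> x]
      by (simp add: part_linear vec.subspace_diff[OF subspace_complement[OF x]])
    ultimately have "scl a (part m x) - part (h m) x = 0" using complement_meets_Y[OF x] by blast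
    then show "part (h m) x = part (scl a m) x" by (simp add: part_linear)
  qed
  then show ?thesis using aT by blast
qed

lemma scalar_hom: "(\<lambda>m\<in>carr T. scl a m) \<in> lmod_hom R (rep_module T) (rep_module T)"
proof -
  have "(r \<odot>\<^bsub>rep_module T\<^esub> scl a m) = scl a (r \<odot>\<^bsub>rep_module T\<^esub> m) \<and> r \<odot>\<^bsub>rep_module T\<^esub> m \<in> carr T"
    if "r \<in> carrier R" "m \<in> carr T" for r m
    using that vec.subspace_scale[OF subspace_carr that(2)]
    by (auto simp: R_carrier smult_coset act_scl act_carr)
  then show ?thesis
    by (auto simp: lmod_hom_def vec.subspace_scale[OF subspace_carr] vec.subspace_add[OF subspace_carr]
        vec.scale_right_distrib)
qed

lemma carr_nonzero: obtains x m where "x \<in> P" "m \<in> carr T" "part m x \<noteq> 0"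
proof -
  obtain x where x: "x \<in> P" "X x T \<noteq> Y x T" using nonzero by auto
  then obtain v where v: "v \<in> X x T" "v \<notin> Y x T" using sub(3)[OF x(1)] by blast
  have "proj x T v \<noteq> 0" using proj(2)[OF x(1) v(1)] v(2) by auto
  then show thesis
    using that[of x "place x (proj x T v)"] place_carr[OF x(1) proj_complement[OF x(1) v(1)]] x(1)
    by (simp add: part_place)
qed

definition only_scalars :: "'a \<Rightarrow> bool"
  where "only_scalars T \<longleftrightarrow> (\<forall>\<phi>. (\<forall>x y. \<phi> (x + y) = \<phi> x + \<phi> y) \<longrightarrow> (\<forall>c x. \<phi> (emb c * x) = emb c * \<phi> x) \<longrightarrow>
      (\<forall>x. \<phi> (T * x) = T * \<phi> x) \<longrightarrow> (\<exists>a. \<forall>x. \<phi> x = a * x))"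

lemma End_scalar:
  assumes "only_scalars T" "h \<in> lmod_hom R (rep_module T) (rep_module T)"
  shows "\<exists>a. h = (\<lambda>m\<in>carr T. scl a m)"
proof -
  obtain a where "\<forall>m\<in>carr T. h m = scl a m"
    using hom_scalar[OF assms(2)] assms(1) unfolding only_scalars_def by blast
  then show ?thesis using assms(2) by (intro exI[of _ a]) (auto simp: lmod_hom_def PiE_def extensional_def fun_eq_iff)
qed

lemma brick_rep_module:
  assumes T: "only_scalars T"
  shows "brick R (rep_module T)"
proof -
  interpret M: left_module R "rep_module T" by (rule left_module_rep_module)
  let ?E = "End_ring R (rep_module T)"
  interpret E: ring ?E by (rule ring_End_ring[OF left_module_rep_module])
  obtain x m where m: "m \<in> carr T" "m \<noteq> 0" using carr_nonzero[of T] by (metis part_linear(3))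
  have "f \<in> Units ?E" if f: "f \<in> carrier ?E - {\<zero>\<^bsub>?E\<^esub>}" for f
  proof -
    obtain a where a: "f = (\<lambda>m\<in>carr T. scl a m)" using End_scalar[OF T] f by (auto simp: End_ring_simps)
    have "a \<noteq> 0" using f a by (auto simp: End_ring_simps)
    let ?g = "\<lambda>m\<in>carr T. scl (1 / a) m"
    have "?g \<otimes>\<^bsub>?E\<^esub> f = \<one>\<^bsub>?E\<^esub>" "f \<otimes>\<^bsub>?E\<^esub> ?g = \<one>\<^bsub>?E\<^esub>"
      using \<open>a \<noteq> 0\<close> vec.subspace_scale[OF subspace_carr]
      by (auto simp: a End_ring_simps compose_def fun_eq_iff scl_apply restrict_def)
    moreover have "?g \<in> carrier ?E" using scalar_hom by (simp add: End_ring_simps)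
    ultimately show ?thesis using f by (auto simp: Units_def)
  qed
  moreover have "\<zero>\<^bsub>?E\<^esub> \<notin> Units ?E"
  proof
    assume "\<zero>\<^bsub>?E\<^esub> \<in> Units ?E"
    then obtain g where "g \<in> carrier ?E" "g \<otimes>\<^bsub>?E\<^esub> \<zero>\<^bsub>?E\<^esub> = \<one>\<^bsub>?E\<^esub>" by (auto simp: Units_def)
    then have "\<one>\<^bsub>?E\<^esub> = \<zero>\<^bsub>?E\<^esub>" by simp
    from fun_cong[OF this, of m] have "m = 0" using m(1) by (simp add: End_ring_simps)
    then show False using m(2) by simp
  qed
  ultimately have "Units ?E = carrier ?E - {\<zero>\<^bsub>?E\<^esub>}" by (auto simp: Units_def)
  then show ?thesis using left_module_rep_module E.ring_axioms by (simp add: brick_def is_division_ring_def)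
qed

end

section \<open>Dimension and length of the modules\<close>

lemma sum_fun_apply: "(sum f A) x = (\<Sum>a\<in>A. f a x)"
  by (induction A rule: infinite_finite_induct) auto

lemma subspace_chain_bound:
  fixes N :: "nat \<Rightarrow> (nat \<Rightarrow> 'a::field) set"
  assumes "\<And>i. i \<le> q \<Longrightarrow> vec.subspace (N i)" "\<And>i. i < q \<Longrightarrow> N i \<subset> N (Suc i)"
    and "N q \<subseteq> vec.span E" "finite E"
  shows "q \<le> card E"
proof -
  have "\<exists>B\<subseteq>N i. vec.independent B \<and> finite B \<and> card B = i" if "i \<le> q" for i
    using that
  proof (induction i)
    case 0
    then show ?case by (intro exI[of _ "{}"]) (simp add: vec.independent_empty)
  next
    case (Suc i)
    then obtain B where B: "B \<subseteq> N i" "vec.independent B" "finite B" "card B = i" by auto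
    obtain v where v: "v \<in> N (Suc i)" "v \<notin> N i" using assms(2)[of i] Suc by auto
    have "vec.span B \<subseteq> N i" using B(1) assms(1)[of i] Suc by (intro vec.span_minimal) auto
    then have "v \<notin> vec.span B" "v \<notin> B" using v(2) B(1) by auto
    then show ?case
      using B v assms(2)[of i] Suc by (intro exI[of _ "insert v B"]) (auto simp: vec.independent_insertI)
  qed
  then obtain B where B: "B \<subseteq> N q" "vec.independent B" "card B = q" by auto
  then show ?thesis using vec.independent_span_bound[OF assms(4) B(2)] assms(3) by auto
qed

context poset_rep
begin

definition ambient_basis :: "(nat \<Rightarrow> 'a) set"
  where "ambient_basis = (\<lambda>j. single j 1) ` prod_encode ` (lab ` P \<times> {..<n})"

lemma finite_ambient_basis: "finite ambient_basis"
  by (simp add: ambient_basis_def finite_P)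

lemma carr_span: "carr T \<subseteq> vec.span ambient_basis"
proof
  fix m assume m: "m \<in> carr T"
  let ?J = "prod_encode ` (lab ` P \<times> {..<n})"
  have finJ: "finite ?J" by (simp add: finite_P)
  have outside: "m j = 0" if "j \<notin> ?J" for j
  proof -
    obtain a i where j: "j = prod_encode (a, i)" by (metis prod_decode_inverse surj_pair)
    show ?thesis
    proof (cases "a \<in> lab ` P")
      case True
      then obtain x where x: "x \<in> P" "a = lab x" by auto
      then have "n \<le> i" using that j by auto
      moreover have "part m x \<in> coord_space n" using carr_X[OF m x(1)] sub(4)[OF x(1)] by blast
      ultimately show ?thesis using x j by (simp add: part_def coord_space_def)
    qed (use m j in \<open>simp add: carr_def\<close>)
  qed
  have "m = (\<Sum>j\<in>?J. scl (m j) (single j 1))"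
  proof
    fix k
    have "(\<Sum>j\<in>?J. scl (m j) (single j 1)) k = (\<Sum>j\<in>?J. if j = k then m k else 0)"
      unfolding sum_fun_apply by (rule sum.cong) (auto simp: scl_apply single_apply)
    also have "\<dots> = m k" using outside[of k] finJ by (simp add: sum.delta)
    finally show "m k = (\<Sum>j\<in>?J. scl (m j) (single j 1)) k" by simp
  qed
  also have "\<dots> \<in> vec.span ambient_basis"
    by (intro vec.span_sum vec.span_scale vec.span_base) (auto simp: ambient_basis_def)
  finally show "m \<in> vec.span ambient_basis" .
qed

text \<open>
  Multiplications by elements of \<open>K\<close> are endomorphisms. So the submodules over the endomorphism ring
  are \<open>K\<close>-subspaces of a space of finite dimension.
\<close>

lemma endofinite_rep_module: "endofinite R (rep_module T)"
proof -
  let ?E = "End_ring R (rep_module T)" and ?M = "eval_module (rep_module T)"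
  have bound: "q \<le> card ambient_basis"
    if N: "\<forall>i\<le>q. submodule (N i) ?E ?M" "\<forall>i<q. N i \<subset> N (Suc i)" for q N
  proof (rule subspace_chain_bound[where N = N])
    fix i assume "i \<le> q"
    then interpret N: submodule "N i" ?E ?M using N(1) by simp
    have "scl a m \<in> N i" if m: "m \<in> N i" for a m
    proof -
      have "(\<lambda>m\<in>carr T. scl a m) \<in> carrier ?E" using scalar_hom by (simp add: End_ring_simps)
      from N.smult_closed[OF this m] show ?thesis
        using subsetD[OF N.subset m] by (simp add: eval_module_def)
    qed
    moreover have "0 \<in> N i" "\<And>v w. v \<in> N i \<Longrightarrow> w \<in> N i \<Longrightarrow> v + w \<in> N i"
      using N.one_closed N.m_closed by (simp_all add: eval_module_def)
    ultimately show "vec.subspace (N i)" unfolding vec.subspace_def by blast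
  next
    interpret N: submodule "N q" ?E ?M using N(1) by simp
    have "N q \<subseteq> carr T" using N.subset by (simp add: eval_module_def)
    then show "N q \<subseteq> vec.span ambient_basis" using carr_span by blast
  qed (use N finite_ambient_basis in auto)
  have "endolength R (rep_module T) \<le> enat (card ambient_basis)"
    unfolding endolength_def module_length_def by (rule SUP_least) (use bound in auto)
  then show ?thesis unfolding endofinite_def by (rule le_less_trans) simp
qed

lemma a_inv_rep_module:
  assumes "m \<in> carr T"
  shows "\<ominus>\<^bsub>rep_module T\<^esub> m = - m"
proof -
  interpret M: left_module R "rep_module T" by (rule left_module_rep_module)
  show ?thesis
    by (rule M.minus_equality) (use assms in \<open>auto simp: vec.subspace_neg[OF subspace_carr]\<close>)
qed

lemma submodule_rep_moduleI:
  assumes "N \<subseteq> carr T" "0 \<in> N" "\<And>v w. v \<in> N \<Longrightarrow> w \<in> N \<Longrightarrow> v + w \<in> N" "\<And>v. v \<in> N \<Longrightarrow> - v \<in> N"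
    and act: "\<And>f v. f \<in> carrier PA \<Longrightarrow> v \<in> N \<Longrightarrow> act T f v \<in> N"
  shows "submodule N R (rep_module T)"
proof (intro submodule.intro subgroup.intro submodule_axioms.intro)
  show "inv\<^bsub>add_monoid (rep_module T)\<^esub> v \<in> N" if "v \<in> N" for v
    using a_inv_rep_module[OF subsetD[OF assms(1) that]] assms(4)[OF that] by (simp add: a_inv_def)
  show "r \<odot>\<^bsub>rep_module T\<^esub> v \<in> N" if "r \<in> carrier R" "v \<in> N" for r v
    using that assms(1) by (auto simp: R_carrier smult_coset act)
qed (use assms in auto)

lemma submodule_rep_moduleD:
  assumes "submodule N R (rep_module T)"
  shows "N \<subseteq> carr T" "0 \<in> N" "v \<in> N \<Longrightarrow> w \<in> N \<Longrightarrow> v + w \<in> N" "v \<in> N \<Longrightarrow> - v \<in> N"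
    "r \<in> carrier R \<Longrightarrow> v \<in> N \<Longrightarrow> r \<odot>\<^bsub>rep_module T\<^esub> v \<in> N"
proof -
  interpret N: submodule N R "rep_module T" by (rule assms)
  show 1: "N \<subseteq> carr T" using N.subset by simp
  show "0 \<in> N" using N.one_closed by simp
  show "v \<in> N \<Longrightarrow> w \<in> N \<Longrightarrow> v + w \<in> N" using N.m_closed[of v w] by simp
  show "- v \<in> N" if "v \<in> N"
    using N.m_inv_closed[OF that] a_inv_rep_module[OF subsetD[OF 1 that]] by (simp add: a_inv_def)
  show "r \<in> carrier R \<Longrightarrow> v \<in> N \<Longrightarrow> r \<odot>\<^bsub>rep_module T\<^esub> v \<in> N" by (rule N.smult_closed)
qed

text \<open>
  A vertex that is maximal among those with a nonzero space: its outgoing arrows act as zero.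
\<close>

lemma maximal_support:
  "\<exists>z\<in>P. (\<exists>v\<in>complement z T. v \<noteq> 0) \<and>
    (\<forall>y\<in>P. (z, y) \<in> po \<longrightarrow> y \<noteq> z \<longrightarrow> complement y T \<subseteq> {0})"
proof -
  define Z where "Z = {z \<in> P. \<exists>v\<in>complement z T. v \<noteq> 0}"
  define up where "up z = {w \<in> P. (z, w) \<in> po}" for z
  obtain x m where "x \<in> P" "m \<in> carr T" "part m x \<noteq> 0" by (rule carr_nonzero)
  then have "x \<in> Z" using carr_comp by (auto simp: Z_def)
  then obtain z where z: "z \<in> Z" "\<forall>y. y \<in> Z \<longrightarrow> card (up z) \<le> card (up y)"
    using ex_has_least_nat[of "\<lambda>z. z \<in> Z" x "\<lambda>z. card (up z)"] by blast
  have "complement y T \<subseteq> {0}" if y: "y \<in> P" "(z, y) \<in> po" "y \<noteq> z" for y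
  proof (rule ccontr)
    assume "\<not> complement y T \<subseteq> {0}"
    then have "y \<in> Z" using y by (auto simp: Z_def)
    have zP: "z \<in> P" using z(1) by (simp add: Z_def)
    have "up y \<subseteq> up z" using y partial_order_onD(2)[OF po] by (auto simp: up_def trans_def)
    moreover have "z \<in> up z" using zP partial_order_onD(1)[OF po] by (auto simp: up_def refl_on_def)
    moreover have "z \<notin> up y" using y partial_order_onD(3)[OF po] by (auto simp: up_def antisym_def)
    ultimately have "up y \<subset> up z" by auto
    moreover have "finite (up z)" using finite_P by (simp add: up_def)
    ultimately have "card (up y) < card (up z)" by (rule psubset_card_mono[rotated])
    then show False using z(2) \<open>y \<in> Z\<close> by (simp add: leD)
  qed
  then show ?thesis using z(1) unfolding Z_def by blast
qed

text \<open>
  At such a vertex every subspace over the ground field is a submodule, in particular \<open>K\<^sub>i v\<close> for an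
  ascending chain of \<open>k\<close>-subspaces \<open>K\<^sub>i\<close> of the field \<open>K\<close>.
\<close>

lemma module_length_infinite:
  fixes K :: "nat \<Rightarrow> 'a set"
  assumes K: "\<And>i. K i \<subset> K (Suc i)" "\<And>i. 0 \<in> K i" "\<And>i a b. a \<in> K i \<Longrightarrow> b \<in> K i \<Longrightarrow> a + b \<in> K i"
    "\<And>i c a. a \<in> K i \<Longrightarrow> emb c * a \<in> K i"
  shows "module_length R (rep_module T) = \<infinity>"
proof -
  obtain z v where z: "z \<in> P" and v: "v \<in> complement z T" "v \<noteq> 0"
    and max: "\<And>y. y \<in> P \<Longrightarrow> (z, y) \<in> po \<Longrightarrow> y \<noteq> z \<Longrightarrow> complement y T \<subseteq> {0}"
    using maximal_support[of T] by blast
  \<comment> \<open>The embedding of the field \<open>K\<close> as the line of \<open>v\<close> at the vertex \<open>z\<close>.\<close>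
  define j where "j a = place z (scl a v)" for a
  have scl: "scl a v \<in> complement z T" for a
    by (rule vec.subspace_scale[OF subspace_complement[OF z] v(1)])
  have j: "j a \<in> carr T" for a unfolding j_def by (rule place_carr[OF z scl])
  have j_add: "j (a + b) = j a + j b" for a b
    by (simp add: j_def vec.scale_left_distrib place_linear)
  have j_0: "j 0 = 0" by (simp add: j_def place_linear)
  have emb_neg: "emb (- 1) = - 1"
    using emb_add[of "- 1" 1] emb_zero emb_one by (simp add: eq_neg_iff_add_eq_0)
  have j_neg: "- j a = j (emb (- 1) * a)" for a
  proof -
    have "j a + j (- a) = 0" using j_add[of a "- a"] j_0 by simp
    then show ?thesis by (simp add: emb_neg eq_neg_iff_add_eq_0 neg_eq_iff_add_eq_0)
  qed
  have "inj j"
  proof (rule injI)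
    fix a b assume "j a = j b"
    then have "part (j a) z = part (j b) z" by simp
    then show "a = b" using v(2) z by (simp add: j_def part_place)
  qed
  have act: "act T f (j a) = j (emb (path_sum Q f z z) * a)" for f a
  proof (rule carr_eqI[OF act_carr[OF j] j])
    fix y assume y: "y \<in> P"
    have "part (act T f (j a)) y = (\<Sum>x\<in>P. if x = z then scl (emb (path_sum Q f x y)) (proj y T (scl a v)) else 0)"
      unfolding part_act[OF y] by (intro sum.cong refl) (auto simp: j_def part_place proj_linear y)
    also have "\<dots> = scl (emb (path_sum Q f z y)) (proj y T (scl a v))" using z finite_P by simp
    also have "\<dots> = part (j (emb (path_sum Q f z z) * a)) y"
    proof (cases "y = z")
      case True
      then show ?thesis using scl[of a] z by (simp add: j_def part_place complement_def)
    next
      case False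
      have "scl (emb (path_sum Q f z y)) (proj y T (scl a v)) = 0"
      proof (cases "path_sum Q f z y = 0")
        case nonzero: False
        then obtain p where "p \<in> paths Q" "hd p = z" "last p = y" by (rule path_sum_path)
        then have "(z, y) \<in> po" using hasse_path_po[OF po] by blast
        then have "complement y T \<subseteq> {0}" using max y False by blast
        moreover have "part (j a) z = scl a v" using z by (simp add: j_def part_place)
        then have "scl (emb (path_sum Q f z y)) (proj y T (scl a v)) \<in> complement y T"
          using act_summand[OF j z y, of f a] by simp
        ultimately show ?thesis by blast
      qed (simp add: emb_zero)
      then show ?thesis using False y by (simp add: j_def part_place)
    qed
    finally show "part (act T f (j a)) y = part (j (emb (path_sum Q f z z) * a)) y" .
  qed
  have "submodule (j ` K i) R (rep_module T)" for i
  proof (rule submodule_rep_moduleI)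
    show "0 \<in> j ` K i" by (rule image_eqI[where x = 0]) (simp_all add: j_0 K(2))
    fix v w assume "v \<in> j ` K i" "w \<in> j ` K i"
    then obtain a b where "a \<in> K i" "b \<in> K i" "v = j a" "w = j b" by auto
    then show "v + w \<in> j ` K i" using K(3)[of a i b] by (simp flip: j_add)
  next
    fix v f assume "v \<in> j ` K i"
    then obtain a where "a \<in> K i" "v = j a" by auto
    then show "- v \<in> j ` K i" "act T f v \<in> j ` K i" using K(4)[of a i] by (simp_all add: j_neg act)
  qed (use j in auto)
  moreover have "j ` K i \<subset> j ` K (Suc i)" for i
    using K(1)[of i] \<open>inj j\<close> by (simp add: psubset_eq inj_image_subset_iff inj_image_eq_iff)
  ultimately have "enat q \<le> module_length R (rep_module T)" for q
    unfolding module_length_def by (intro SUP_upper CollectI exI[of _ "\<lambda>i. j ` K i"]) auto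
  from this[of "Suc (the_enat (module_length R (rep_module T)))"] show ?thesis
    by (cases "module_length R (rep_module T)") auto
qed

text \<open>
  The projection onto a direct summand is an endomorphism, hence a scalar; being idempotent, it is
  \<open>0\<close> or \<open>1\<close>.
\<close>

lemma indecomposable_rep_module:
  assumes T: "only_scalars T"
  shows "indecomposable R (rep_module T)"
  unfolding indecomposable_def
proof (intro conjI allI impI)
  obtain x m where "x \<in> P" "m \<in> carr T" "part m x \<noteq> 0" by (rule carr_nonzero)
  then have "m \<in> carr T" "m \<noteq> 0" by (auto simp: part_linear)
  then show "carrier (rep_module T) \<noteq> {\<zero>\<^bsub>rep_module T\<^esub>}" by auto
  fix A B
  assume "submodule A R (rep_module T) \<and> submodule B R (rep_module T) \<and> A \<inter> B = {\<zero>\<^bsub>rep_module T\<^esub>} \<and>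
    A <+>\<^bsub>rep_module T\<^esub> B = carrier (rep_module T)"
  then have AB: "submodule A R (rep_module T)" "submodule B R (rep_module T)" and meet: "A \<inter> B = {0}"
    and eq: "(\<Union>a\<in>A. \<Union>b\<in>B. {a + b}) = carr T"
    by (auto simp: set_add_def')
  have sum: "\<exists>a\<in>A. \<exists>b\<in>B. m = a + b" if "m \<in> carr T" for m
    using that unfolding eq[symmetric] by blast
  interpret M: left_module R "rep_module T" by (rule left_module_rep_module)
  note A = submodule_rep_moduleD[OF AB(1)] and B = submodule_rep_moduleD[OF AB(2)]
  have unique: "a = a'" if "a \<in> A" "a' \<in> A" "m - a \<in> B" "m - a' \<in> B" for a a' m
  proof -
    have "a + - a' \<in> A" by (rule A(3)[OF that(1) A(4)[OF that(2)]])
    moreover have "(m - a') + - (m - a) \<in> B" by (rule B(3)[OF that(4) B(4)[OF that(3)]])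
    ultimately have "a - a' \<in> A" "a - a' \<in> B" by simp_all
    then have "a - a' \<in> {0}" unfolding meet[symmetric] by (rule IntI)
    then show ?thesis by simp
  qed
  \<comment> \<open>The projection onto \<open>A\<close> along \<open>B\<close>.\<close>
  define h where "h = (\<lambda>m\<in>carr T. THE a. a \<in> A \<and> m - a \<in> B)"
  have hI: "h m = a" if "m \<in> carr T" "a \<in> A" "m - a \<in> B" for m a
  proof -
    have "(THE a. a \<in> A \<and> m - a \<in> B) = a"
    proof (rule the_equality)
      show "a \<in> A \<and> m - a \<in> B" using that by (intro conjI)
      show "a' = a" if a': "a' \<in> A \<and> m - a' \<in> B" for a'
        by (rule unique[OF conjunct1[OF a'] \<open>a \<in> A\<close> conjunct2[OF a'] \<open>m - a \<in> B\<close>])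
    qed
    then show ?thesis using that(1) by (simp add: h_def)
  qed
  have hD: "h m \<in> A" "m - h m \<in> B" if m: "m \<in> carr T" for m
  proof -
    obtain a b where ab: "a \<in> A" "b \<in> B" "m = a + b" using sum[OF m] by auto
    then have "h m = a" by (intro hI[OF m]) simp_all
    then show "h m \<in> A" "m - h m \<in> B" using ab by simp_all
  qed
  have "h \<in> lmod_hom R (rep_module T) (rep_module T)"
    unfolding lmod_hom_def
  proof (intro CollectI conjI ballI)
    show "h \<in> carrier (rep_module T) \<rightarrow>\<^sub>E carrier (rep_module T)"
      using hD(1) A(1) by (auto simp: h_def)
    fix m m' assume "m \<in> carrier (rep_module T)" "m' \<in> carrier (rep_module T)"
    then have m: "m \<in> carr T" "m' \<in> carr T" by auto
    have "(m - h m) + (m' - h m') \<in> B" by (rule B(3)[OF hD(2)[OF m(1)] hD(2)[OF m(2)]])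
    moreover have "m + m' - (h m + h m') = (m - h m) + (m' - h m')" by simp
    ultimately have "m + m' - (h m + h m') \<in> B" by (simp only:)
    then have "h (m + m') = h m + h m'"
      by (intro hI vec.subspace_add[OF subspace_carr] m A(3) hD(1))
    then show "h (m \<oplus>\<^bsub>rep_module T\<^esub> m') = h m \<oplus>\<^bsub>rep_module T\<^esub> h m'" by simp
  next
    fix r m assume r: "r \<in> carrier R" and "m \<in> carrier (rep_module T)"
    then have m: "m \<in> carr T" by simp
    have "h m \<in> carr T" "m - h m \<in> carr T" using hD[OF m] A(1) B(1) by auto
    then have "r \<odot>\<^bsub>rep_module T\<^esub> m = r \<odot>\<^bsub>rep_module T\<^esub> h m + r \<odot>\<^bsub>rep_module T\<^esub> (m - h m)"
      using M.smult_r_distr[OF r, of "h m" "m - h m"] by simp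
    moreover have "r \<odot>\<^bsub>rep_module T\<^esub> (m - h m) \<in> B" by (rule B(5)[OF r hD(2)[OF m]])
    moreover have "r \<odot>\<^bsub>rep_module T\<^esub> h m \<in> A" by (rule A(5)[OF r hD(1)[OF m]])
    moreover have "r \<odot>\<^bsub>rep_module T\<^esub> m \<in> carr T" using M.smult_closed[OF r, of m] m by simp
    ultimately show "h (r \<odot>\<^bsub>rep_module T\<^esub> m) = r \<odot>\<^bsub>rep_module T\<^esub> h m"
      by (intro hI) simp_all
  qed
  then obtain c where c: "h = (\<lambda>m\<in>carr T. scl c m)" using End_scalar[OF T] by blast
  show "A = {\<zero>\<^bsub>rep_module T\<^esub>} \<or> B = {\<zero>\<^bsub>rep_module T\<^esub>}"
  proof (cases "A = {0}")
    case False
    then obtain a where a: "a \<in> A" "a \<noteq> 0" using A(2) by blast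
    then have "h a = a" using subsetD[OF A(1) a(1)] B(2) by (intro hI) simp_all
    then have "scl c a = scl 1 a" using subsetD[OF A(1) a(1)] by (simp add: c)
    then have "c = 1" using a(2) vec.scale_cancel_right[of c a 1] by simp
    have "b = 0" if b: "b \<in> B" for b
    proof -
      have "h b = 0" using b A(2) subsetD[OF B(1) b] by (intro hI) simp_all
      then show ?thesis using subsetD[OF B(1) b] by (simp add: c \<open>c = 1\<close>)
    qed
    then show ?thesis using B(2) by auto
  qed simp
qed

lemma not_iso_rep_module:
  assumes "T \<noteq> S" and emb: "surj emb"
  shows "\<not> lmod_iso R (rep_module T) (rep_module S)"
proof
  assume "lmod_iso R (rep_module T) (rep_module S)"
  then obtain h where h: "h \<in> lmod_hom R (rep_module T) (rep_module S)" and bij: "bij_betw h (carr T) (carr S)"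
    by (auto simp: lmod_iso_def)
  have "\<exists>a. T * a = S * a \<and> (\<forall>m\<in>carr T. h m = scl a m)"
  proof (rule hom_scalar[OF h])
    fix \<phi> :: "'a \<Rightarrow> 'a" assume phi: "\<And>c x. \<phi> (emb c * x) = emb c * \<phi> x"
    have "\<phi> x = \<phi> 1 * x" for x
    proof -
      obtain c where "x = emb c" using emb by blast
      then show ?thesis using phi[of c 1] by (simp add: mult.commute)
    qed
    then show "\<exists>a. \<forall>x. \<phi> x = a * x" by blast
  qed
  then obtain a where "T * a = S * a" "\<forall>m\<in>carr T. h m = scl a m" by blast
  then have zero: "h m = 0" if "m \<in> carr T" for m using that assms(1) by simp
  obtain x m where m: "x \<in> P" "m \<in> carr T" "part m x \<noteq> 0" by (rule carr_nonzero)
  have "(0 :: nat \<Rightarrow> 'a) \<in> carr T" by (rule vec.subspace_0[OF subspace_carr])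
  moreover have "h m = h 0" using zero m(2) calculation by simp
  ultimately have "m = 0" using bij m(2) unfolding bij_betw_def inj_on_def by blast
  then show False using m(3) by (simp add: part_linear)
qed

lemma scalar_action:
  assumes m: "m \<in> carr T"
  shows "incidence_scalar P po c \<odot>\<^bsub>rep_module T\<^esub> m = scl (emb c) m"
  unfolding incidence_scalar_def bound_scalar_def
  using smult_coset[OF path_algebra_scale_closed[OF idl.one_closed] m, of c] act_one[OF m, of c] by simp

lemma has_dim_rep_module:
  assumes emb: "bij emb"
  shows "\<exists>d\<le>card ambient_basis. has_dim (incidence_scalar P po) (rep_module T) d"
proof -
  interpret M: left_module R "rep_module T" by (rule left_module_rep_module)
  obtain B where B: "B \<subseteq> carr T" "vec.independent B" "carr T \<subseteq> vec.span B"
    using vec.basis_exists by metis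
  have "B \<subseteq> vec.span ambient_basis" using B(1) carr_span by blast
  then have fin: "finite B" and card: "card B \<le> card ambient_basis"
    using vec.independent_span_bound[OF finite_ambient_basis B(2)] by auto
  have finsum: "finsum (rep_module T) g B' = sum g B'" if "B' \<subseteq> B" "\<And>b. b \<in> B \<Longrightarrow> g b \<in> carr T" for g B'
  proof -
    have "finite B'" using that(1) fin by (rule finite_subset)
    then show ?thesis
      using that(1)
    proof (induction B')
      case (insert b B')
      have "g \<in> B' \<rightarrow> carrier (rep_module T)" "g b \<in> carrier (rep_module T)"
        using insert(4) that(2) by auto
      then show ?case using insert by (simp add: M.finsum_insert)
    qed simp
  qed
  have eq: "(\<Oplus>\<^bsub>rep_module T\<^esub>b\<in>B. incidence_scalar P po (c b) \<odot>\<^bsub>rep_module T\<^esub> b) = (\<Sum>b\<in>B. scl (emb (c b)) b)" for c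
  proof -
    have "incidence_scalar P po (c b) \<odot>\<^bsub>rep_module T\<^esub> b = scl (emb (c b)) b" if "b \<in> B" for b
      using scalar_action B(1) that by blast
    moreover have "scl (emb (c b)) b \<in> carr T" if "b \<in> B" for b
      using vec.subspace_scale[OF subspace_carr] B(1) that by blast
    ultimately show ?thesis by (simp add: finsum)
  qed
  have "\<exists>!c. c \<in> B \<rightarrow>\<^sub>E UNIV \<and> m = (\<Sum>b\<in>B. scl (emb (c b)) b)" if m: "m \<in> carr T" for m
  proof (rule ex_ex1I)
    have "m \<in> vec.span B" using B(3) m by blast
    then obtain u where u: "m = (\<Sum>b\<in>B. scl (u b) b)" unfolding vec.span_finite[OF fin] by blast
    have "(\<Sum>b\<in>B. scl (emb ((\<lambda>b\<in>B. inv_into UNIV emb (u b)) b)) b) = (\<Sum>b\<in>B. scl (u b) b)"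
      using emb by (intro sum.cong refl) (simp add: bij_is_surj surj_f_inv_f)
    then show "\<exists>c. c \<in> B \<rightarrow>\<^sub>E UNIV \<and> m = (\<Sum>b\<in>B. scl (emb (c b)) b)"
      using u by (intro exI[of _ "\<lambda>b\<in>B. inv_into UNIV emb (u b)"]) auto
    fix c c'
    assume c: "c \<in> B \<rightarrow>\<^sub>E UNIV \<and> m = (\<Sum>b\<in>B. scl (emb (c b)) b)"
      and c': "c' \<in> B \<rightarrow>\<^sub>E UNIV \<and> m = (\<Sum>b\<in>B. scl (emb (c' b)) b)"
    have "(\<Sum>b\<in>B. scl (emb (c b) - emb (c' b)) b) = 0"
      using c c' by (simp add: vec.scale_left_diff_distrib sum_subtractf)
    then have "emb (c b) - emb (c' b) = 0" if "b \<in> B" for b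
      by (rule vec.independentD[OF B(2) fin subset_refl _ that])
    then have "c b = c' b" if "b \<in> B" for b
      using that bij_is_inj[OF emb] by (auto dest: injD)
    then show "c = c'" using c c' by (auto intro: PiE_ext)
  qed
  then have "has_dim (incidence_scalar P po) (rep_module T) (card B)"
    unfolding has_dim_def by (intro exI[of _ B]) (use B(1) fin in \<open>simp add: eq\<close>)
  then show ?thesis using card by blast
qed

end

section \<open>Scalars of the field and of the function field\<close>

text \<open>
  Over a finite field, the polynomial \<open>1 + \<Prod>\<^sub>a (x - a)\<close> has no root.
\<close>

lemma infinite_alg_closed: "infinite (UNIV :: 'k::alg_closed_field set)"
proof
  assume fin: "finite (UNIV :: 'k set)"
  define q where "q = (\<Prod>a\<in>(UNIV :: 'k set). [:- a, 1:])"
  have root: "poly q x = 0" for x using fin by (auto simp: q_def poly_prod)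
  have "q \<noteq> 0" using fin by (auto simp: q_def)
  have deg: "degree q > 0"
  proof (rule ccontr)
    assume "\<not> degree q > 0"
    then obtain c where "q = [:c:]" by (auto elim: degree_eq_zeroE)
    then show False using \<open>q \<noteq> 0\<close> root[of 0] by simp
  qed
  then have "degree (1 + q) = degree q" by (intro degree_add_eq_right) simp
  then obtain x where "poly (1 + q) x = 0" using alg_closed_imp_poly_has_root[of "1 + q"] deg by auto
  then show False using root by simp
qed

definition const_fract :: "'k::field \<Rightarrow> 'k poly fract"
  where "const_fract c = Fract [:c:] 1"

definition t_fract :: "'k::field poly fract"
  where "t_fract = Fract [:0, 1:] 1"

lemma fract_mult_poly:
  fixes \<phi> :: "'k::field poly fract \<Rightarrow> 'k poly fract"
  assumes add: "\<And>x y. \<phi> (x + y) = \<phi> x + \<phi> y" and c: "\<And>c x. \<phi> (const_fract c * x) = const_fract c * \<phi> x"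
    and t: "\<And>x. \<phi> (t_fract * x) = t_fract * \<phi> x"
  shows "\<phi> (Fract p 1 * x) = Fract p 1 * \<phi> x"
proof (induction p arbitrary: x)
  case 0
  have "\<phi> 0 = 0" using c[of 0 0] by (simp add: const_fract_def Zero_fract_def[symmetric])
  then show ?case by (simp add: Zero_fract_def[symmetric])
next
  case (pCons a p)
  have "Fract (pCons a p) 1 = const_fract a + t_fract * Fract p 1"
    by (simp add: const_fract_def t_fract_def)
  then show ?case using pCons(2)[of x] by (simp add: distrib_right add c t mult.assoc)
qed

lemma fract_only_scalars:
  fixes \<phi> :: "'k::field poly fract \<Rightarrow> 'k poly fract"
  assumes "\<And>x y. \<phi> (x + y) = \<phi> x + \<phi> y" "\<And>c x. \<phi> (const_fract c * x) = const_fract c * \<phi> x"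
    and "\<And>x. \<phi> (t_fract * x) = t_fract * \<phi> x"
  shows "\<exists>a. \<forall>x. \<phi> x = a * x"
proof (intro exI allI)
  note poly = fract_mult_poly[OF assms]
  fix x :: "'k poly fract"
  obtain p q where x: "x = Fract p q" "q \<noteq> 0" by (cases x) auto
  have q: "Fract q 1 \<noteq> 0" using x(2) by (simp add: Zero_fract_def eq_fract)
  have "Fract q 1 * x = Fract p 1 * 1" using x by (simp add: One_fract_def eq_fract mult.commute)
  then have "Fract q 1 * \<phi> x = Fract p 1 * \<phi> 1" using poly[of q x] poly[of p 1] by simp
  moreover have "Fract p 1 = Fract q 1 * x" using x by (simp add: eq_fract mult.commute)
  ultimately have "Fract q 1 * \<phi> x = Fract q 1 * (\<phi> 1 * x)" by (simp add: mult.commute mult.left_commute)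
  then show "\<phi> x = \<phi> 1 * x" using q by simp
qed

text \<open>
  This moves a representation from the numbered vertices of a critical quiver to the elements of the
  poset.
\<close>

lemma scalar_model_relabel:
  assumes "scalar_model C V A" and f: "inj_on f P" "f ` P = V" "map_prod f f ` B = A" and BP: "B \<subseteq> P \<times> P"
  shows "\<exists>n X Y. full_rep C n P B X Y \<and> scalar_rigid C n (X ` P \<union> Y ` P) \<and> (\<exists>x\<in>P. \<forall>T. X x T \<noteq> Y x T)"
proof -
  obtain n X Y where full: "full_rep C n V A X Y" and rigid: "scalar_rigid C n (X ` V \<union> Y ` V)"
    and ne: "\<exists>x\<in>V. \<forall>T. X x T \<noteq> Y x T" using assms(1) unfolding scalar_model_def by blast
  have rep: "subquotient_rep n V A X Y" using full by (simp add: full_rep_def)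
  have fV: "f x \<in> V" if "x \<in> P" for x using that f(2) by auto
  have fA: "(f x, f y) \<in> A" if "(x, y) \<in> B" for x y using that f(3) by force
  define g where "g = inv_into P f"
  have gf: "g (f x) = x" if "x \<in> P" for x using that f(1) by (simp add: g_def)
  have rep': "subquotient_rep n P B (X \<circ> f) (Y \<circ> f)"
    using rep fV fA BP by (auto simp: subquotient_rep_def)
  have "\<exists>u. induces C n P (X \<circ> f) (Y \<circ> f) T S u k" if nat: "natural_family C P B (X \<circ> f) (Y \<circ> f) T S k" for T S k
  proof -
    have "natural_family C V A X Y T S (\<lambda>a. k (g a))"
      unfolding natural_family_def
    proof (intro conjI ballI allI impI)
      fix a assume "a \<in> V"
      then obtain x where x: "x \<in> P" "a = f x" using f(2) by auto
      then show "linear_on C (X a T) (k (g a))" "k (g a) ` X a T \<subseteq> X a S" "k (g a) ` Y a T \<subseteq> Y a S"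
        using nat by (auto simp: natural_family_def gf)
    next
      fix a b v assume ab: "(a, b) \<in> A" and v: "v \<in> X a T"
      then obtain x y where xy: "(x, y) \<in> B" "a = f x" "b = f y" using f(3) by auto
      then have "x \<in> P" "y \<in> P" using BP by auto
      then show "k (g b) v - k (g a) v \<in> Y b S"
        using natural_familyD(4)[OF nat xy(1), of v] xy v by (simp add: gf)
    qed
    then obtain u where "induces C n V X Y T S u (\<lambda>a. k (g a))" using full unfolding full_rep_def by blast
    then have "induces C n P (X \<circ> f) (Y \<circ> f) T S u k"
      using fV by (auto simp: induces_def) (metis gf fV)
    then show ?thesis by blast
  qed
  then have "full_rep C n P B (X \<circ> f) (Y \<circ> f)" using rep' by (simp add: full_rep_def)
  moreover have "scalar_rigid C n ((X \<circ> f) ` P \<union> (Y \<circ> f) ` P)"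
  proof -
    have "(X \<circ> f) ` P = X ` V" "(Y \<circ> f) ` P = Y ` V" unfolding f(2)[symmetric] by (rule image_comp[symmetric])+
    then show ?thesis using rigid by simp
  qed
  moreover have "\<exists>x\<in>P. \<forall>T. (X \<circ> f) x T \<noteq> (Y \<circ> f) x T" using ne f(2) by auto
  ultimately show ?thesis by blast
qed

lemma poset_rep_exists:
  fixes emb :: "'k::field \<Rightarrow> 'a::field" and A :: "(nat \<times> nat) set"
  assumes "finite P" "partial_order_on P po"
    and "scalar_model (range emb) V A" "inj_on f P" "f ` P = V" "map_prod f f ` hasse_arrows P po = A"
    and emb: "\<And>a b. emb (a + b) = emb a + emb b" "\<And>a b. emb (a * b) = emb a * emb b" "emb 1 = 1"
  shows "\<exists>n X Y. poset_rep P po emb n X Y f"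
proof -
  have "hasse_arrows P po \<subseteq> P \<times> P" by (auto simp: hasse_arrows_def)
  from scalar_model_relabel[OF assms(3-6) this] show ?thesis
    using assms(1,2,4) emb unfolding poset_rep_def by blast
qed

text \<open>
  The modules of all parameters are pairwise non-isomorphic bricks of bounded dimension, so the
  pigeonhole principle provides an infinite set of parameters with equal dimensions.
\<close>

theorem brick_continuous_incidence_algebra:
  fixes P :: "'p set" and A :: "(nat \<times> nat) set"
  assumes "finite P" "partial_order_on P po"
    and "scalar_model (UNIV :: 'k::alg_closed_field set) V A"
    and "inj_on f P" "f ` P = V" "map_prod f f ` hasse_arrows P po = A"
  shows "brick_continuous (incidence_algebra P po)
    (incidence_scalar P po :: 'k \<Rightarrow> ('p list \<Rightarrow> 'k) set)"
proof -
  have "scalar_model (range (\<lambda>c :: 'k. c)) V A" using assms(3) by simp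
  from poset_rep_exists[OF assms(1,2) this assms(4-6)]
  have "\<exists>n X Y. poset_rep P po (\<lambda>c :: 'k. c) n X Y f" by simp
  then obtain n X Y where "poset_rep P po (\<lambda>c :: 'k. c) n X Y f" by (elim exE)
  then interpret poset_rep P po "\<lambda>c :: 'k. c" n X Y f .
  have bij: "bij (\<lambda>c :: 'k. c)" using bij_id by (simp add: id_def)
  have "\<forall>T. \<exists>d. d \<le> card ambient_basis \<and> has_dim (incidence_scalar P po) (rep_module T) d"
    using has_dim_rep_module[OF bij] by blast
  then obtain d where d: "\<forall>T. d T \<le> card ambient_basis \<and> has_dim (incidence_scalar P po) (rep_module T) (d T)"
    unfolding choice_iff by (elim exE)
  have "finite (range d)" by (rule finite_subset[of _ "{..card ambient_basis}"]) (use d in auto)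
  then obtain T0 where L: "infinite {T. d T = d T0}"
    using pigeonhole_infinite[OF infinite_alg_closed, of d] by auto
  define L where "L = {T. d T = d T0}"
  have not_iso: "\<not> lmod_iso R (rep_module T) (rep_module S)" if "T \<noteq> S" for T S
    by (rule not_iso_rep_module[OF that]) simp
  have "lmod_iso R (rep_module T) (rep_module T)" for T
    unfolding lmod_iso_def
    by (rule bexI[OF _ scalar_hom[of 1 T]]) (auto simp: bij_betw_def inj_on_def)
  then have "inj rep_module" using not_iso by (intro injI) metis
  then have "inj_on rep_module L" by (rule inj_on_subset) simp
  then have "infinite (rep_module ` L)" using L finite_imageD[of rep_module L] by (auto simp: L_def)
  moreover have "brick R (rep_module T)" for T
  proof (rule brick_rep_module, unfold only_scalars_def, intro allI impI)
    fix \<phi> :: "'k \<Rightarrow> 'k" assume phi: "\<forall>c x. \<phi> (c * x) = c * \<phi> x"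
    have "\<phi> x = \<phi> 1 * x" for x using phi[rule_format, of x 1] by (simp add: mult.commute)
    then show "\<exists>a. \<forall>x. \<phi> x = a * x" by blast
  qed
  moreover have "has_dim (incidence_scalar P po) (rep_module T) (d T0)" if "T \<in> L" for T
    using d[rule_format, of T] that by (simp add: L_def)
  moreover have "pairwise (\<lambda>M N. \<not> lmod_iso R M N) (rep_module ` L)"
  proof (rule pairwiseI)
    fix M N assume "M \<in> rep_module ` L" "N \<in> rep_module ` L" "M \<noteq> N"
    then obtain T S where "M = rep_module T" "N = rep_module S" "T \<noteq> S" by auto
    then show "\<not> lmod_iso R M N" by (simp add: not_iso)
  qed
  ultimately show ?thesis
    unfolding brick_continuous_def by (intro exI[of _ "d T0"] exI[of _ "rep_module ` L"]) auto
qed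

text \<open>
  The parameter is the variable of the field of rational functions. The polynomials of degree less
  than \<open>i\<close> form the ascending chain of subspaces that makes the length infinite.
\<close>

theorem generic_brick_incidence_algebra:
  fixes P :: "'p set" and A :: "(nat \<times> nat) set"
  assumes "finite P" "partial_order_on P po"
    and "scalar_model (range const_fract :: 'k::field poly fract set) V A"
    and "inj_on f P" "f ` P = V" "map_prod f f ` hasse_arrows P po = A"
  shows "\<exists>G :: (('p list \<Rightarrow> 'k) set, nat \<Rightarrow> 'k poly fract) module. generic_brick (incidence_algebra P po) G"
proof -
  have "\<exists>n X Y. poset_rep P po (const_fract :: 'k \<Rightarrow> _) n X Y f"
    by (rule poset_rep_exists[OF assms]) (simp_all add: const_fract_def One_fract_def one_pCons mult.commute)
  then obtain n X Y where "poset_rep P po (const_fract :: 'k \<Rightarrow> _) n X Y f" by (elim exE)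
  then interpret poset_rep P po "const_fract :: 'k \<Rightarrow> _" n X Y f .
  have T: "only_scalars t_fract" unfolding only_scalars_def using fract_only_scalars by blast
  define K :: "nat \<Rightarrow> 'k poly fract set" where "K i = (\<lambda>p. Fract p 1) ` {p. \<forall>j\<ge>i. coeff p j = 0}" for i
  have inj: "Fract p 1 = Fract q 1 \<longleftrightarrow> p = q" for p q :: "'k poly" by (simp add: eq_fract)
  have "module_length R (rep_module t_fract) = \<infinity>"
  proof (rule module_length_infinite[where K = K])
    fix i
    have "Fract (monom 1 i) 1 \<in> K (Suc i)" "Fract (monom 1 i) 1 \<notin> K i"
      by (auto simp: K_def inj image_iff) 
    moreover have "K i \<subseteq> K (Suc i)" by (auto simp: K_def)
    ultimately show "K i \<subset> K (Suc i)" by blast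
    show "0 \<in> K i" by (auto simp: K_def Zero_fract_def)
    fix a b assume "a \<in> K i" "b \<in> K i"
    then obtain p q where "a = Fract p 1" "b = Fract q 1" "\<forall>j\<ge>i. coeff p j = 0" "\<forall>j\<ge>i. coeff q j = 0"
      by (auto simp: K_def)
    then show "a + b \<in> K i" unfolding K_def by (intro image_eqI[of _ _ "p + q"]) auto
  next
    fix i c a assume "a \<in> K i"
    then obtain p where "a = Fract p 1" "\<forall>j\<ge>i. coeff p j = 0" by (auto simp: K_def)
    then show "const_fract c * a \<in> K i"
      unfolding K_def const_fract_def by (intro image_eqI[of _ _ "Polynomial.smult c p"]) auto
  qed
  then have "generic_brick R (rep_module t_fract)"
    using left_module_rep_module indecomposable_rep_module[OF T] endofinite_rep_module brick_rep_module[OF T]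
    by (simp add: generic_brick_def generic_module_def)
  then show ?thesis by blast
qed

theorem theorem2p8:
  fixes P :: "'p set" and po :: "'p rel" and Q :: "nat bquiver"
  assumes "finite P" and "partial_order_on P po"
    and "Q \<in> critical_bquivers"
    and "bquiver_iso TYPE('k::alg_closed_field) (hasse_bquiver P po) Q \<or>
         bquiver_iso TYPE('k) (hasse_bquiver P po) (op_bquiver Q)"
  shows "brick_continuous (incidence_algebra P po)
           (incidence_scalar P po :: 'k \<Rightarrow> ('p list \<Rightarrow> 'k) set) \<and>
         (\<exists>G :: (('p list \<Rightarrow> 'k) set, nat \<Rightarrow> 'k poly fract) module.
           generic_brick (incidence_algebra P po) G)"
proof -
  obtain Q' where Q': "Q' = Q \<or> Q' = op_bquiver Q" "bquiver_iso TYPE('k) (hasse_bquiver P po) Q'"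
    using assms(4) by blast
  then obtain f where f: "inj_on f P" "f ` P = verts Q'" "map_prod f f ` hasse_arrows P po = arrows Q'"
    by (auto simp: bquiver_iso_def relabel_def arrows_hasse)
  have model: "bq_model C Q'" for C :: "'b::field set"
    using critical_model[OF assms(3), of C] Q'(1) by auto
  show ?thesis
    by (intro conjI brick_continuous_incidence_algebra[OF assms(1,2) model f]
        generic_brick_incidence_algebra[OF assms(1,2) model f])
qed

end
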